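(* Let $S$ be the set of odd primes $p$ such that the multiplicative order $m_p$ of $2$ modulo $p$ is not squarefree. Then there is a constant $C$ such that $$\mathsf M_S(N)=\frac{6}{\pi^2}\log N+C+o(N^{-1/2})\qquad (N\to\infty).$$
   Context: $\mathbb P$ is the set of rational primes and $|\cdot|_p$ is the $p$-adic absolute value on $\mathbb Q$ with $|p|_p=p^{-1}$. For $S\subseteq\mathbb P$ let $R_S=\{r\in\mathbb Q: |r|_p\le 1\text{ for all }p\in\mathbb P\setminus S\}$, and let $T_S$ be the continuous endomorphism of the compact dual group $\widehat{R_S}$ dual to $r\mapsto 2r$ on the discrete group $R_S$. A closed orbit $\tau$ of length $|\tau|=n$ is a set $\{x,T_S(x),\dots,T_S^n(x)=x\}$ of cardinality $n$. Define $\mathsf M_S(N)=\sum_{|\tau|\le N}e^{-h|\tau|}$, the sum over closed orbits of $T_S$ of length at most $N$, where $h=h(T_S)$ is the topological entropy. It is known that $h(T_S)=\log 2$ and that the number of points with $T_S^nx=x$ is $(2^n-1)\prod_{p\in S}|2^n-1|_p$, so that, with $|x|_S=\prod_{p\in S}|x|_p$ and $\mu$ the Möbius function, $$\mathsf M_S(N)=\sum_{n\le N}\frac1{n2^n}\sum_{d\mid n}\mu(n/d)\,(2^d-1)\,|2^d-1|_S .$$ *)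

theory Defs
  imports
    "HOL-Analysis.Analysis"
    "HOL-Computational_Algebra.Squarefree"
    "HOL-Number_Theory.Number_Theory"
    "HOL-Algebra.Group"
    "HOL-Library.Landau_Symbols"
begin

definition padic_abs :: "nat \<Rightarrow> rat \<Rightarrow> real" where
  "padic_abs p r =
     (if r = 0 then 0
      else (case quotient_of r of (a, b) \<Rightarrow>
        real p powi (int (multiplicity (int p) b) - int (multiplicity (int p) a))))"

definition R_ring :: "nat set \<Rightarrow> rat set" where
  "R_ring S = {r. \<forall>p. prime p \<and> p \<notin> S \<longrightarrow> padic_abs p r \<le> 1}"

definition R_group :: "nat set \<Rightarrow> rat monoid" where
  "R_group S = \<lparr>carrier = R_ring S, monoid.mult = (+), one = 0\<rparr>"

definition circle_group :: "complex monoid" where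
  "circle_group = \<lparr>carrier = sphere 0 1, monoid.mult = (*), one = 1\<rparr>"

text \<open>Characters are extensional functions, so that distinct elements of the dual differ
  on the carrier of the group.\<close>

definition pontryagin_dual :: "('a, 'b) monoid_scheme \<Rightarrow> ('a \<Rightarrow> complex) monoid" where
  "pontryagin_dual G =
     \<lparr>carrier = hom G circle_group \<inter> extensional (carrier G),
      monoid.mult = (\<lambda>u v. \<lambda>x\<in>carrier G. u x * v x),
      one = (\<lambda>x\<in>carrier G. 1)\<rparr>"

text \<open>On the dual of a discrete group the compact-open topology is the topology of
  pointwise convergence.\<close>

definition dual_topology :: "('a, 'b) monoid_scheme \<Rightarrow> ('a \<Rightarrow> complex) topology" where
  "dual_topology G =
     subtopology (product_topology (\<lambda>_. euclidean) (carrier G)) (carrier (pontryagin_dual G))"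

definition dual_endo ::
  "('a, 'b) monoid_scheme \<Rightarrow> ('a \<Rightarrow> 'a) \<Rightarrow> ('a \<Rightarrow> complex) \<Rightarrow> ('a \<Rightarrow> complex)" where
  "dual_endo G \<phi> u = compose (carrier G) u \<phi>"

definition T_map :: "nat set \<Rightarrow> (rat \<Rightarrow> complex) \<Rightarrow> (rat \<Rightarrow> complex)" where
  "T_map S = dual_endo (R_group S) (\<lambda>r. 2 * r)"

text \<open>Topological entropy of a continuous self-map of a compact space, following Adler,
  Konheim and McAndrew. The limit that defines the entropy relative to an open cover exists by
  subadditivity and is written as a limit superior. For an open cover \<open>U\<close>,
  \<open>iterated_join X f U n\<close> is the join of the preimages of \<open>U\<close> under the
  iterates \<open>f ^^ k\<close>, \<open>k < n\<close>.\<close>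

definition open_cover :: "'a topology \<Rightarrow> 'a set set \<Rightarrow> bool" where
  "open_cover X U \<longleftrightarrow> (\<forall>u\<in>U. openin X u) \<and> \<Union>U = topspace X"

definition cover_number :: "'a topology \<Rightarrow> 'a set set \<Rightarrow> nat" where
  "cover_number X U = Inf {card V |V. V \<subseteq> U \<and> finite V \<and> \<Union>V = topspace X}"

definition iterated_join ::
  "'a topology \<Rightarrow> ('a \<Rightarrow> 'a) \<Rightarrow> 'a set set \<Rightarrow> nat \<Rightarrow> 'a set set" where
  "iterated_join X f U n =
     {{x \<in> topspace X. \<forall>k<n. (f ^^ k) x \<in> u k} |u. \<forall>k<n. u k \<in> U}"

definition cover_entropy :: "'a topology \<Rightarrow> ('a \<Rightarrow> 'a) \<Rightarrow> 'a set set \<Rightarrow> ereal" where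
  "cover_entropy X f U =
     limsup (\<lambda>n. ereal (ln (real (cover_number X (iterated_join X f U n))) / real n))"

definition topological_entropy :: "'a topology \<Rightarrow> ('a \<Rightarrow> 'a) \<Rightarrow> ereal" where
  "topological_entropy X f = (SUP U\<in>{U. open_cover X U}. cover_entropy X f U)"

text \<open>No closed orbit has length 0, since the set below always contains \<open>x\<close>.\<close>

definition closed_orbit :: "'a set \<Rightarrow> ('a \<Rightarrow> 'a) \<Rightarrow> nat \<Rightarrow> 'a set \<Rightarrow> bool" where
  "closed_orbit A f n \<tau> \<longleftrightarrow>
     (\<exists>x\<in>A. (f ^^ n) x = x \<and> \<tau> = (\<lambda>k. (f ^^ k) x) ` {0..n} \<and> card \<tau> = n)"

definition entropy_T :: "nat set \<Rightarrow> real" where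
  "entropy_T S = real_of_ereal (topological_entropy (dual_topology (R_group S)) (T_map S))"

definition mertens_sum :: "nat set \<Rightarrow> nat \<Rightarrow> real" where
  "mertens_sum S N =
     (\<Sum>\<tau> | \<exists>n\<le>N. closed_orbit (carrier (pontryagin_dual (R_group S))) (T_map S) n \<tau>.
        exp (- entropy_T S * real (card \<tau>)))"

end

theory Submission
  imports
    Defs
    "HOL-Complex_Analysis.Complex_Analysis"
    "HOL-Library.Discrete_Functions"
    "HOL-Real_Asymp.Real_Asymp"
begin

text \<open>If \<open>n\<close> is squarefree, every prime \<open>p\<close> dividing \<open>2 ^ n - 1\<close> has squarefree order, so \<open>T\<^sub>S ^^ n\<close> has
  exactly \<open>2 ^ n - 1\<close> fixed points. If \<open>n\<close> is divisible by the square of a prime \<open>l\<close>, the part of \<open>2 ^ n - 1\<close> prime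
  to \<open>S\<close> divides \<open>(2 ^ (n div l) - 1) * l\<close>, so there are at most \<open>n * 2 ^ (n div 2)\<close> fixed points.
  Hence \<open>M\<^sub>S(N)\<close> is, up to a constant and an exponentially small error, the sum of \<open>1/n\<close> over the squarefree
  \<open>n \<le> N\<close>. The error term of that sum is \<open>o(N powr (-1/2))\<close> as soon as \<open>\<Sum>\<mu>(d)/d\<close> converges, which is the
  strength of the prime number theorem; it follows from the non-vanishing of \<open>\<zeta>\<close> on the line \<open>Re s = 1\<close>
  by Newman's Tauberian theorem.\<close>

section \<open>The Moebius function and the zeta function\<close>

text \<open>The trivial bound |\<mu>(d)| \<le> 1 makes the tail of the sum of \<mu>(d)/d^2 beyond X
  only O(1/X). With X of order sqrt N this gives an error O(N^(-1/2)), just short of the claim.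
  Partial summation turns the bare convergence of the sum of \<mu>(d)/d into a tail o(1/X), which
  closes the gap; no rate enters, and convergence without a rate is what Newman's method delivers.
  The set S is tailored so that |2^n - 1|_S is 1 for squarefree n and exponentially small otherwise;
  hence the density 6/\<pi>^2 of the squarefree numbers becomes the leading coefficient. Entropy and
  fixed points are computed from the definitions. The ring \<open>R\<^sub>S\<close> is a
  localization of \<int> in which the primes of S are units, and a character is fixed by the n-th
  iterate iff it is trivial on (2^n - 1) \<open>R\<^sub>S\<close>, which equals q
  \<open>R\<^sub>S\<close> for the part q of 2^n - 1 prime to S; the quotient is cyclic of order
  q.\<close>

definition moebius_mu :: "nat \<Rightarrow> int" where
  "moebius_mu n = (if squarefree n then (-1) ^ card (prime_factors n) else 0)"

lemma moebius_mu_0 [simp]: "moebius_mu 0 = 0"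
  by (simp add: moebius_mu_def)

lemma moebius_mu_1 [simp]: "moebius_mu (Suc 0) = 1"
  using squarefree_1[where 'a = nat] by (simp add: moebius_mu_def)

lemma abs_moebius_mu_le: "\<bar>moebius_mu n\<bar> \<le> 1"
  by (simp add: moebius_mu_def power_abs)

lemma moebius_prime_times:
  assumes "prime p" "\<not> p dvd d"
  shows "moebius_mu (p * d) = - moebius_mu d"
proof -
  have d0: "d \<noteq> 0" and p0: "p \<noteq> 0" using assms by (auto intro: Nat.gr0I)
  have cop: "coprime p d" using assms by (simp add: prime_imp_coprime)
  have "squarefree (p * d) \<longleftrightarrow> squarefree d"
    using cop assms by (metis squarefree_mult_coprime squarefree_multD(2) squarefree_prime)
  moreover have "card (prime_factors (p * d)) = Suc (card (prime_factors d))"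
  proof -
    have "prime_factors (p * d) = insert p (prime_factors d)"
      using assms d0 p0 by (simp add: prime_factors_product prime_prime_factors)
    moreover have "p \<notin> prime_factors d" using assms by auto
    ultimately show ?thesis by simp
  qed
  ultimately show ?thesis by (simp add: moebius_mu_def)
qed

text \<open>Fix one prime p dividing n. The squarefree divisors of n pair off as d and p * d with d
  prime to p, and the two terms of a pair cancel.\<close>

lemma sum_moebius_divisors:
  assumes "n > 0"
  shows "(\<Sum>d | d dvd n. moebius_mu d) = (if n = 1 then 1 else 0)"
proof (cases "n = 1")
  case False
  then obtain p where p: "prime p" "p dvd n" using prime_factor_nat by blast
  define D where "D = {d. d dvd n \<and> squarefree d}"
  define A where "A = {d \<in> D. \<not> p dvd d}"
  have fin: "finite {d. d dvd n}" using assms by simp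
  then have finD: "finite D" unfolding D_def by (rule rev_finite_subset) auto
  then have finA: "finite A" unfolding A_def by simp
  have D: "D = A \<union> (\<lambda>d. p * d) ` A"
  proof (intro equalityI subsetI)
    fix d assume d: "d \<in> D"
    show "d \<in> A \<union> (\<lambda>d. p * d) ` A"
    proof (cases "p dvd d")
      case True
      then obtain e where e: "d = p * e" by blast
      have "\<not> p dvd e"
      proof
        assume "p dvd e"
        then have "p ^ 2 dvd d" using e by (simp add: power2_eq_square)
        with d p show False unfolding D_def by (auto dest: squarefreeD)
      qed
      moreover have "e dvd n" "squarefree e"
        using d e by (auto simp: D_def intro: dvd_trans dest: squarefree_multD)
      ultimately show ?thesis using e by (auto simp: A_def D_def)
    qed (use d in \<open>auto simp: A_def\<close>)
  next
    fix d assume "d \<in> A \<union> (\<lambda>d. p * d) ` A"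
    then show "d \<in> D"
    proof
      assume "d \<in> (\<lambda>d. p * d) ` A"
      then obtain e where e: "d = p * e" "e dvd n" "squarefree e" "\<not> p dvd e"
        by (auto simp: A_def D_def)
      have "coprime p e" using e p by (simp add: prime_imp_coprime)
      then show ?thesis
        using e p squarefree_mult_coprime[of p e] squarefree_prime[of p] divides_mult[of p n e]
        by (simp add: D_def)
    qed (auto simp: A_def)
  qed
  have "(\<Sum>d | d dvd n. moebius_mu d) = (\<Sum>d\<in>D. moebius_mu d)"
    using fin by (intro sum.mono_neutral_right) (auto simp: D_def moebius_mu_def)
  also have "\<dots> = (\<Sum>d\<in>A. moebius_mu d) + (\<Sum>d\<in>(\<lambda>d. p * d) ` A. moebius_mu d)"
    unfolding D using finA by (intro sum.union_disjoint) (auto simp: A_def)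
  also have "(\<Sum>d\<in>(\<lambda>d. p * d) ` A. moebius_mu d) = (\<Sum>d\<in>A. moebius_mu (p * d))"
    using p by (subst sum.reindex) (auto simp: inj_on_def)
  also have "\<dots> = (\<Sum>d\<in>A. - moebius_mu d)"
    using p by (intro sum.cong refl moebius_prime_times) (auto simp: A_def)
  finally show ?thesis using False by (simp add: sum_negf)
qed (simp)

text \<open>The d whose square divides n are exactly the divisors of \<open>square_part n\<close>,
  so \<open>sum_moebius_divisors\<close> applies to that number.\<close>

lemma sum_moebius_square_divisors:
  assumes "n > 0"
  shows "(\<Sum>d | d\<^sup>2 dvd n. moebius_mu d) = (if squarefree n then 1 else 0)"
proof -
  have "square_part n = 1 \<longleftrightarrow> squarefree n"
  proof
    assume "squarefree n"
    then show "square_part n = 1" using square_part_square_dvd squarefreeD by fastforce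
  next
    assume "square_part n = 1"
    then show "squarefree n"
      by (metis dvd_square_part_iff squarefreeI)
  qed
  then show ?thesis
    using assms sum_moebius_divisors[of "square_part n"]
    by (simp add: dvd_square_part_iff) (metis gr0I square_part_0_iff)
qed

section \<open>Dirichlet series of \<zeta> and 1/\<zeta>\<close>

lemma norm_of_nat_powr: "norm ((of_nat n :: complex) powr s) = real n powr Re s"
  by (subst norm_powr_real_powr) auto

lemma of_nat_mult_powr:
  "(of_nat (m * n) :: complex) powr s = of_nat m powr s * of_nat n powr s"
  unfolding of_nat_mult by (rule powr_times_real) auto

lemma powr_abs_summable_on:
  assumes "Re s > 1"
  shows "(\<lambda>n. norm ((of_nat n :: complex) powr (-s))) summable_on A"
proof -
  have "summable (\<lambda>n. real n powr (- Re s))"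
    using assms by (simp add: summable_real_powr_iff)
  then have "(\<lambda>n. norm ((of_nat n :: complex) powr (-s))) summable_on UNIV"
    by (intro norm_summable_imp_summable_on) (simp add: norm_of_nat_powr)
  then show ?thesis by (rule summable_on_subset_banach) auto
qed

text \<open>The summand at 0 vanishes because \<open>0 powr s = 0\<close>.\<close>

definition zeta :: "complex \<Rightarrow> complex" where
  "zeta s = (\<Sum>\<^sub>\<infinity>n. of_nat n powr (-s))"

lemma has_sum_zeta:
  assumes "Re s > 1"
  shows "((\<lambda>n. of_nat n powr (-s)) has_sum zeta s) UNIV"
  unfolding zeta_def using powr_abs_summable_on[OF assms]
  by (simp add: abs_summable_summable)

lemma has_sum_zeta_pos:
  assumes "Re s > 1"
  shows "((\<lambda>n. of_nat n powr (-s)) has_sum zeta s) {0<..}"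
  by (rule has_sum_cong_neutral[THEN iffD1, OF _ _ _ has_sum_zeta[OF assms]]) auto

lemma moebius_abs_summable_on:
  assumes "Re s > 1"
  shows "(\<lambda>n. norm (of_int (moebius_mu n) * (of_nat n :: complex) powr (-s))) summable_on A"
proof (rule summable_on_comparison_test[OF powr_abs_summable_on[OF assms]])
  fix n
  have "\<bar>real_of_int (moebius_mu n)\<bar> \<le> 1"
    using abs_moebius_mu_le[of n] by linarith
  then show "norm (of_int (moebius_mu n) * (of_nat n :: complex) powr (-s))
      \<le> norm ((of_nat n :: complex) powr (-s))"
    by (simp add: norm_mult mult_left_le_one_le)
qed auto

text \<open>Both facts come from one computation: the product of the two absolutely convergent
  series, regrouped by k = m * n, has the inner sums of \<mu> over the divisors of k, and only k = 1
  survives. Hence the product of the two sums is 1.\<close>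

lemma
  assumes "Re s > 1"
  shows zeta_nonzero: "zeta s \<noteq> 0"
    and has_sum_moebius: "((\<lambda>n. of_int (moebius_mu n) * (of_nat n :: complex) powr (-s)) has_sum inverse (zeta s)) UNIV"
proof -
  \<comment> \<open>Index 0 is left out because the regrouping by products would have an infinite
    fibre over 0.\<close>
  define M where "M = (\<Sum>\<^sub>\<infinity>n\<in>{0<..}. of_int (moebius_mu n) * (of_nat n :: complex) powr (-s))"
  have M: "((\<lambda>n. of_int (moebius_mu n) * (of_nat n :: complex) powr (-s)) has_sum M) {0<..}"
    unfolding M_def using moebius_abs_summable_on[OF assms] by (simp add: abs_summable_summable)
  define f where "f = (\<lambda>(m, n). of_int (moebius_mu m) * (of_nat m :: complex) powr (-s) * of_nat n powr (-s))"
  have abs: "(\<lambda>p. norm (f p)) summable_on {0<..} \<times> {0<..}"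
  proof -
    define c where "c = (\<Sum>\<^sub>\<infinity>n\<in>{0<..}. norm ((of_nat n :: complex) powr (-s)))"
    have c: "((\<lambda>n. norm ((of_nat n :: complex) powr (-s))) has_sum c) {0<..}"
      unfolding c_def using powr_abs_summable_on[OF assms] by simp
    show ?thesis
    proof (rule summable_on_SigmaI)
      show "((\<lambda>n. norm (f (m, n))) has_sum
          norm (of_int (moebius_mu m) * (of_nat m :: complex) powr (-s)) * c) {0<..}" for m
        using has_sum_cmult_right[OF c] by (simp add: f_def norm_mult)
      show "(\<lambda>m. norm (of_int (moebius_mu m) * (of_nat m :: complex) powr (-s)) * c) summable_on {0<..}"
        by (intro summable_on_cmult_left moebius_abs_summable_on assms)
    qed auto
  qed
  have "(f has_sum (M * zeta s)) ({0<..} \<times> {0<..})"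
  proof (rule has_sum_SigmaI)
    show "((\<lambda>n. f (m, n)) has_sum of_int (moebius_mu m) * (of_nat m :: complex) powr (-s) * zeta s) {0<..}" for m
      using has_sum_cmult_right[OF has_sum_zeta_pos[OF assms]] by (simp add: f_def)
    show "((\<lambda>m. of_int (moebius_mu m) * (of_nat m :: complex) powr (-s) * zeta s) has_sum M * zeta s) {0<..}"
      using has_sum_cmult_left[OF M] .
    show "f summable_on {0<..} \<times> {0<..}" using abs by (rule abs_summable_summable)
  qed
  moreover have "(f has_sum (M * zeta s)) ({0<..} \<times> {0<..}) \<longleftrightarrow>
      ((\<lambda>(k, m). of_int (moebius_mu m) * (of_nat k :: complex) powr (-s)) has_sum (M * zeta s))
        (Sigma {0<..} (\<lambda>k. {m. m dvd k}))"
    by (rule has_sum_reindex_bij_witness[of _ "\<lambda>(k, m). (m, k div m)" "\<lambda>(m, n). (m * n, m)"])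
       (auto simp: f_def of_nat_mult_powr simp del: of_nat_mult elim!: dvdE)
  ultimately have "((\<lambda>(k, m). of_int (moebius_mu m) * (of_nat k :: complex) powr (-s)) has_sum (M * zeta s))
      (Sigma {0<..} (\<lambda>k. {m. m dvd k}))" by simp
  then have "((\<lambda>k. if k = 1 then 1 else 0) has_sum (M * zeta s)) {0::nat<..}"
  proof (rule has_sum_SigmaD)
    fix k :: nat assume k: "k \<in> {0<..}"
    have "(\<Sum>m | m dvd k. of_int (moebius_mu m) * (of_nat k :: complex) powr (-s))
        = of_int (\<Sum>m | m dvd k. moebius_mu m) * of_nat k powr (-s)"
      by (simp add: sum_distrib_right)
    also have "\<dots> = (if k = 1 then 1 else 0)"
      using k sum_moebius_divisors[of k] by simp
    finally show "((\<lambda>m. case (k, m) of (k, m) \<Rightarrow> of_int (moebius_mu m) * (of_nat k :: complex) powr (-s))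
        has_sum (if k = 1 then 1 else 0)) {m. m dvd k}"
      using k by (auto intro!: has_sum_finiteI)
  qed
  moreover have "((\<lambda>k. if k = 1 then 1 else 0) has_sum (1::complex)) {0::nat<..}"
    by (subst has_sum_cong_neutral[where T = "{1}" and g = "\<lambda>_. 1"])
       (auto intro!: has_sum_finiteI)
  ultimately have "M * zeta s = 1" by (rule has_sum_unique)
  then show "zeta s \<noteq> 0" by auto
  from \<open>M * zeta s = 1\<close> have "M = inverse (zeta s)"
    by (metis inverse_unique mult.commute)
  with M show "((\<lambda>n. of_int (moebius_mu n) * (of_nat n :: complex) powr (-s)) has_sum inverse (zeta s)) UNIV"
    by (subst has_sum_cong_neutral[of "{0<..}" UNIV]) auto
qed

section \<open>Euler product\<close>

text \<open>Sieve of Eratosthenes: if B is the set already sifted by A, sifting by a further prime q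
  removes q * B, whose sum is q^(-s) times that of B.\<close>

lemma has_sum_sieved_zeta:
  assumes s: "Re s > 1" and "finite A" "\<And>p. p \<in> A \<Longrightarrow> prime p"
  shows "((\<lambda>n. of_nat n powr (-s)) has_sum (zeta s * (\<Prod>p\<in>A. 1 - of_nat p powr (-s)))) {n. \<forall>p\<in>A. \<not> p dvd n}"
  using assms(2,3)
proof (induction A)
  case empty
  then show ?case using has_sum_zeta[OF s] by simp
next
  case (insert q A)
  define B where "B = {n. \<forall>p\<in>A. \<not> p dvd n}"
  define Z where "Z = zeta s * (\<Prod>p\<in>A. 1 - of_nat p powr (-s))"
  have q: "prime q" using insert by auto
  have Z: "((\<lambda>n. of_nat n powr (-s)) has_sum Z) B" using insert by (simp add: B_def Z_def)
  have "((\<lambda>n. of_nat n powr (-s)) has_sum (of_nat q powr (-s) * Z)) ((\<lambda>n. q * n) ` B)"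
  proof (subst has_sum_reindex)
    show "inj_on ((*) q) B" using q by (auto simp: inj_on_def)
    show "((\<lambda>n. of_nat n powr - s) \<circ> (*) q has_sum of_nat q powr - s * Z) B"
      using has_sum_cmult_right[OF Z] by (simp add: o_def of_nat_mult_powr del: of_nat_mult)
  qed
  then have "((\<lambda>n. of_nat n powr (-s)) has_sum (Z - of_nat q powr (-s) * Z)) (B - (\<lambda>n. q * n) ` B)"
  proof (rule has_sum_Diff[OF Z])
    show "(\<lambda>n. q * n) ` B \<subseteq> B"
    proof safe
      fix n assume n: "n \<in> B"
      show "q * n \<in> B"
        unfolding B_def
      proof safe
        fix p assume p: "p \<in> A" "p dvd q * n"
        then have "prime p" "p \<noteq> q" using insert by auto
        with p q have "p dvd n" by (metis prime_dvd_mult_nat primes_dvd_imp_eq)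
        with n p show False by (auto simp: B_def)
      qed
    qed
  qed
  moreover have "B - (\<lambda>n. q * n) ` B = {n. \<forall>p\<in>insert q A. \<not> p dvd n}"
    by (auto simp: B_def dvd_def image_iff) (metis mult.left_commute)+
  ultimately show ?case
    using insert by (simp add: Z_def algebra_simps)
qed

text \<open>After sifting by all primes up to P, only the term 1 and terms with n > P remain, so the
  distance to 1 is at most a tail of the absolutely convergent series. Keeping \<open>zeta s\<close>
  as a factor avoids infinite products and their inverses.\<close>

lemma zeta_Euler_product:
  assumes s: "Re s > 1"
  shows "(\<lambda>P. zeta s * (\<Prod>p | prime p \<and> p \<le> P. 1 - of_nat p powr (-s))) \<longlonglongrightarrow> 1"
proof -
  define f where "f = (\<lambda>n. (of_nat n :: complex) powr (-s))"
  have abs: "(\<lambda>n. norm (f n)) summable_on A" for A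
    unfolding f_def by (rule powr_abs_summable_on[OF s])
  define c where "c = (\<Sum>\<^sub>\<infinity>n. norm (f n))"
  have c: "((\<lambda>n. norm (f n)) has_sum c) UNIV" using abs by (simp add: c_def)
  have bound: "norm (zeta s * (\<Prod>p | prime p \<and> p \<le> P. 1 - of_nat p powr (-s)) - 1)
      \<le> c - (\<Sum>n\<le>P. norm (f n))" for P
  proof -
    define B where "B = {n. \<forall>p\<in>{p. prime p \<and> p \<le> P}. \<not> p dvd n}"
    have B: "(f has_sum (zeta s * (\<Prod>p | prime p \<and> p \<le> P. 1 - of_nat p powr (-s)))) B"
      unfolding f_def B_def by (rule has_sum_sieved_zeta) (use s in auto)
    have B1: "1 \<in> B" by (auto simp: B_def)
    have "(f has_sum (zeta s * (\<Prod>p | prime p \<and> p \<le> P. 1 - of_nat p powr (-s)) - 1)) (B - {1})"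
      by (rule has_sum_Diff[OF B]) (use B1 in \<open>auto intro!: has_sum_finiteI simp: f_def\<close>)
    then have "zeta s * (\<Prod>p | prime p \<and> p \<le> P. 1 - of_nat p powr (-s)) - 1 = infsum f (B - {1})"
      by (simp add: infsumI)
    also have "norm \<dots> \<le> (\<Sum>\<^sub>\<infinity>n\<in>B - {1}. norm (f n))"
      by (rule norm_infsum_bound[OF abs])
    also have "\<dots> \<le> (\<Sum>\<^sub>\<infinity>n\<in>UNIV - {..P}. norm (f n))"
    proof (rule infsum_mono_neutral[OF abs abs])
      fix n assume n: "n \<in> B - {1} - (UNIV - {..P})"
      then have nP: "n \<le> P" "n \<noteq> 1" "n \<in> B" by auto
      \<comment> \<open>Any n > 1 up to P has a prime factor up to P and is sifted out. The number 0
        lies in B when P < 2, but its term is 0.\<close>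
      have "n = 0"
      proof (rule ccontr)
        assume "n \<noteq> 0"
        then obtain p where "prime p" "p dvd n" using prime_factor_nat[OF nP(2)] by blast
        moreover have "p \<le> n" using \<open>n \<noteq> 0\<close> \<open>p dvd n\<close> by (simp add: dvd_imp_le)
        ultimately show False using nP by (auto simp: B_def)
      qed
      then show "norm (f n) \<le> 0" by (simp add: f_def)
    qed auto
    also have "\<dots> = c - (\<Sum>n\<le>P. norm (f n))"
      by (rule infsumI, rule has_sum_Diff[OF c]) (auto intro!: has_sum_finiteI)
    finally show ?thesis .
  qed
  have "(\<lambda>P. \<Sum>n\<le>P. norm (f n)) \<longlonglongrightarrow> c"
    using has_sum_imp_sums[OF c] by (simp add: sums_def_le)
  then have "(\<lambda>P. c - (\<Sum>n\<le>P. norm (f n))) \<longlonglongrightarrow> 0"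
    by (auto intro!: tendsto_eq_intros)
  then have "(\<lambda>P. zeta s * (\<Prod>p | prime p \<and> p \<le> P. 1 - of_nat p powr (-s)) - 1) \<longlonglongrightarrow> 0"
    by (rule Lim_null_comparison[rotated]) (use bound in auto)
  then show ?thesis by (simp add: LIM_zero_iff)
qed

section \<open>Continuation of (s - 1) \<zeta>(s) to Re s > 0\<close>

text \<open>Equals \<open>(s - 1) * (n powr (-s) - \<integral>x powr (-s))\<close> with \<open>x\<close> ranging over \<open>[n, n + 1]\<close>.\<close>

definition zeta_term :: "nat \<Rightarrow> complex \<Rightarrow> complex" where
  "zeta_term n s = (s - 1) * of_nat n powr (-s) - (of_nat n powr (1 - s) - of_nat (Suc n) powr (1 - s))"

text \<open>This is (s - 1) \<zeta>(s), continued to Re s > 0; the factor s - 1 removes the pole.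
  The leading 1 is s - 1 times the integral of x^(-s) over all x \<ge> 1.\<close>

definition zeta_ext :: "complex \<Rightarrow> complex" where
  "zeta_ext s = 1 + (\<Sum>n. zeta_term (Suc n) s)"

lemma closed_segment_of_nat_Suc:
  assumes "w \<in> closed_segment (of_nat n :: complex) (of_nat (Suc n))"
  obtains x where "w = of_real x" "real n \<le> x" "x \<le> real n + 1"
proof -
  from assms obtain u where u: "0 \<le> u" "u \<le> 1" "w = (1 - u) *\<^sub>R of_nat n + u *\<^sub>R of_nat (Suc n)"
    by (auto simp: closed_segment_def)
  then have "w = of_real (real n + u)" by (simp add: scaleR_conv_of_real algebra_simps)
  with u that show thesis by (metis add_increasing2 add_left_mono order_refl)
qed

lemma norm_of_real_powr: "x \<ge> 0 \<Longrightarrow> norm (complex_of_real x powr s) = x powr Re s"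
  by (subst norm_powr_real_powr) auto

text \<open>Two mean value estimates on the segment from n to n + 1: the first bounds the deviation
  of w^(-s) from n^(-s), the second integrates this deviation. The power of n gained in this way
  makes the series converge for Re s > 0 and not only for Re s > 1.\<close>

lemma norm_zeta_term_le:
  assumes s: "Re s > 0" and n: "n > 0"
  shows "norm (zeta_term n s) \<le> norm (s - 1) * norm s * real n powr (- Re s - 1)"
proof -
  let ?S = "closed_segment (of_nat n :: complex) (of_nat (Suc n))"
  have pos: "w \<notin> \<real>\<^sub>\<le>\<^sub>0" if "w \<in> ?S" for w
    using closed_segment_of_nat_Suc[OF that] n by (force simp: complex_nonpos_Reals_iff)
  have bound1: "norm (of_nat n powr (-s) - w powr (-s)) \<le> norm s * real n powr (- Re s - 1)"
    if w: "w \<in> ?S" for w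
  proof -
    have "norm (w powr (-s) - of_nat n powr (-s)) \<le> norm s * real n powr (- Re s - 1) * norm (w - of_nat n)"
    proof (rule field_differentiable_bound)
      fix z assume z: "z \<in> ?S"
      show "((\<lambda>z. z powr (-s)) has_field_derivative (-s * z powr (- s - 1))) (at z within ?S)"
        using has_field_derivative_powr[OF pos[OF z], of "-s"] has_field_derivative_at_within by blast
      from z obtain x where x: "z = of_real x" "real n \<le> x" by (rule closed_segment_of_nat_Suc)
      have "norm (z powr (- s - 1)) = x powr (- Re s - 1)"
        using x n by (simp add: norm_of_real_powr)
      also have "\<dots> \<le> real n powr (- Re s - 1)"
        using x n s by (intro powr_mono2') auto
      finally show "norm (-s * z powr (- s - 1)) \<le> norm s * real n powr (- Re s - 1)"
        by (simp add: norm_mult mult_left_mono)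
    qed (use w in auto)
    moreover have "norm (w - of_nat n) \<le> 1"
    proof -
      from w obtain x where x: "w = of_real x" "real n \<le> x" "x \<le> real n + 1" by (rule closed_segment_of_nat_Suc)
      then have "w - of_nat n = of_real (x - real n)" by simp
      then have "norm (w - of_nat n) = \<bar>x - real n\<bar>" by (simp only: norm_of_real)
      with x show ?thesis by simp
    qed
    ultimately show ?thesis
      by (subst norm_minus_commute) (smt (verit) mult_left_le mult_nonneg_nonneg norm_ge_zero powr_ge_zero)
  qed
  \<comment> \<open>The increment of \<phi> over the segment is \<open>zeta_term n s\<close>, and
    its derivative is (s - 1) times the deviation bounded in \<open>bound1\<close>.\<close>
  define \<phi> where "\<phi> = (\<lambda>z. (s - 1) * of_nat n powr (-s) * z + z powr (1 - s))"
  have "norm (\<phi> (of_nat (Suc n)) - \<phi> (of_nat n))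
      \<le> norm (s - 1) * (norm s * real n powr (- Re s - 1)) * norm (of_nat (Suc n) - of_nat n :: complex)"
  proof (rule field_differentiable_bound)
    fix z assume z: "z \<in> ?S"
    show "(\<phi> has_field_derivative ((s - 1) * (of_nat n powr (-s) - z powr (-s)))) (at z within ?S)"
      unfolding \<phi>_def
      by (rule derivative_eq_intros refl has_field_derivative_at_within[OF has_field_derivative_powr[OF pos[OF z]]])+
         (simp add: algebra_simps)
    show "norm ((s - 1) * (of_nat n powr (-s) - z powr (-s))) \<le> norm (s - 1) * (norm s * real n powr (- Re s - 1))"
      unfolding norm_mult using bound1[OF z] by (intro mult_left_mono) auto
  qed auto
  moreover have "\<phi> (of_nat (Suc n)) - \<phi> (of_nat n) = zeta_term n s"
    by (simp add: \<phi>_def zeta_term_def algebra_simps)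
  moreover have "(of_nat (Suc n) - of_nat n :: complex) = 1" by simp
  ultimately show ?thesis by (simp add: mult.assoc)
qed

lemma summable_Suc_powr: "e > 0 \<Longrightarrow> summable (\<lambda>n. real (Suc n) powr (- e - 1))"
  using summable_real_powr_iff[of "-e - 1"] by (subst (asm) summable_Suc_iff[symmetric]) simp

lemma zeta_ext_holomorphic: "zeta_ext holomorphic_on {s. Re s > 0}"
proof (rule holomorphic_uniform_sequence[where f = "\<lambda>N s. 1 + (\<Sum>n<N. zeta_term (Suc n) s)"])
  show "open {s. Re s > 0}" by (rule open_halfspace_Re_gt)
  show "(\<lambda>s. 1 + (\<Sum>n<N. zeta_term (Suc n) s)) holomorphic_on {s. Re s > 0}" for N
    unfolding zeta_term_def
    by (intro holomorphic_intros) (auto simp del: of_nat_Suc)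
  fix s :: complex assume s: "s \<in> {s. Re s > 0}"
  define d where "d = Re s / 2"
  define B where "B = norm s + d"
  have d: "d > 0" using s by (simp add: d_def)
  have near: "Re z \<ge> d \<and> norm z \<le> B" if "z \<in> cball s d" for z
  proof -
    have *: "norm (s - z) \<le> d" using that by (simp add: dist_norm)
    have "Re (s - z) \<le> d" using complex_Re_le_cmod[of "s - z"] * by linarith
    moreover have "norm z \<le> norm s + norm (s - z)" by (metis norm_minus_commute norm_triangle_sub)
    ultimately show ?thesis using * by (auto simp: d_def B_def)
  qed
  have "uniform_limit (cball s d) (\<lambda>N z. \<Sum>n<N. zeta_term (Suc n) z) (\<lambda>z. \<Sum>n. zeta_term (Suc n) z) sequentially"
  proof (rule Weierstrass_m_test)
    show "summable (\<lambda>n. ((B + 1) * B) * real (Suc n) powr (- d - 1))"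
      using summable_Suc_powr[OF d] by (rule summable_mult)
    fix n z assume z: "z \<in> cball s d"
    have "norm (zeta_term (Suc n) z) \<le> norm (z - 1) * norm z * real (Suc n) powr (- Re z - 1)"
      using near[OF z] d by (intro norm_zeta_term_le) auto
    also have "\<dots> \<le> ((B + 1) * B) * real (Suc n) powr (- d - 1)"
    proof (intro mult_mono)
      show "norm (z - 1) \<le> B + 1" using near[OF z] norm_triangle_ineq4[of z 1] by simp
      show "norm z \<le> B" using near[OF z] by simp
      show "real (Suc n) powr (- Re z - 1) \<le> real (Suc n) powr (- d - 1)"
        using near[OF z] by (intro powr_mono) auto
      show "0 \<le> B + 1" "0 \<le> (B + 1) * B" using d by (auto simp: B_def)
    qed auto
    finally show "norm (zeta_term (Suc n) z) \<le> ((B + 1) * B) * real (Suc n) powr (- d - 1)" .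
  qed
  then have "uniform_limit (cball s d) (\<lambda>N z. 1 + (\<Sum>n<N. zeta_term (Suc n) z)) zeta_ext sequentially"
    unfolding zeta_ext_def by (intro uniform_limit_add uniform_limit_const)
  moreover have "cball s d \<subseteq> {s. Re s > 0}" using near d by force
  ultimately show "\<exists>d. 0 < d \<and> cball s d \<subseteq> {s. Re s > 0} \<and>
      uniform_limit (cball s d) (\<lambda>N s. 1 + (\<Sum>n<N. zeta_term (Suc n) s)) zeta_ext sequentially"
    using d by blast
qed

lemma zeta_ext_1 [simp]: "zeta_ext 1 = 1"
proof -
  have "complex_of_nat (Suc n) \<noteq> 0" for n by (simp del: of_nat_Suc)
  then have "zeta_term (Suc n) 1 = 0" for n by (simp add: zeta_term_def del: of_nat_Suc)
  then show ?thesis by (simp add: zeta_ext_def)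
qed

lemma zeta_ext_eq:
  assumes s: "Re s > 1"
  shows "zeta_ext s = (s - 1) * zeta s"
proof -
  \<comment> \<open>The differences of powers telescope between 1 and (N + 1)^(1 - s), and the
    latter tends to 0 for Re s > 1.\<close>
  have partial: "(\<Sum>n<N. zeta_term (Suc n) s)
      = (s - 1) * (\<Sum>n<Suc N. of_nat n powr (-s)) - 1 + of_nat (Suc N) powr (1 - s)" for N
  proof (induction N)
    case (Suc N)
    then show ?case by (simp add: zeta_term_def algebra_simps del: of_nat_Suc)
  qed simp
  have "(\<lambda>N. of_nat (Suc N) powr (1 - s) :: complex) \<longlonglongrightarrow> 0"
  proof (rule tendsto_norm_zero_cancel)
    have "(\<lambda>N. real N powr (1 - Re s)) \<longlonglongrightarrow> 0"
      using s by (intro tendsto_neg_powr filterlim_real_sequentially) auto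
    then have "(\<lambda>N. real (Suc N) powr (1 - Re s)) \<longlonglongrightarrow> 0" by (rule LIMSEQ_Suc)
    then show "(\<lambda>N. norm (of_nat (Suc N) powr (1 - s) :: complex)) \<longlonglongrightarrow> 0"
      unfolding norm_of_nat_powr by simp
  qed
  moreover have "(\<lambda>N. \<Sum>n<Suc N. of_nat n powr (-s)) \<longlonglongrightarrow> zeta s"
    using has_sum_imp_sums[OF has_sum_zeta[OF s]] unfolding sums_def by (rule LIMSEQ_Suc)
  ultimately have "(\<lambda>N. \<Sum>n<N. zeta_term (Suc n) s) \<longlonglongrightarrow> (s - 1) * zeta s - 1 + 0"
    unfolding partial by (intro tendsto_intros)
  then have "(\<lambda>n. zeta_term (Suc n) s) sums ((s - 1) * zeta s - 1)" by (simp add: sums_def)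
  then show ?thesis by (simp add: zeta_ext_def sums_unique[symmetric])
qed

section \<open>Non-vanishing on the line Re s = 1\<close>

text \<open>The logarithm of the left side is a power series whose n-th term is -x^n / n times 3 + 4
  Re v + Re(v^2) with v = w^n. For |v| = 1 this factor equals 2 (1 + Re v)^2, so every term is at
  most 0.\<close>

lemma three_four_one:
  fixes x :: real and w :: complex
  assumes x: "0 \<le> x" "x < 1" and w: "norm w = 1"
  shows "norm (1 - complex_of_real x) ^ 3 * norm (1 - of_real x * w) ^ 4 * norm (1 - of_real x * w\<^sup>2) \<le> 1"
proof -
  have ln_norm: "(\<lambda>n. - (Re (z ^ n) / real n)) sums ln (norm (1 - z))" if z: "norm z < 1" for z :: complex
  proof -
    have "(\<lambda>n. (-1) ^ Suc n / of_nat n * (-z) ^ n) sums Ln (1 + (-z))"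
      using z by (intro Ln_series) simp
    then have "(\<lambda>n. Re ((-1) ^ Suc n / of_nat n * (-z) ^ n)) sums Re (Ln (1 + (-z)))" by (rule sums_Re)
    moreover have "Re ((-1) ^ Suc n / of_nat n * (-z) ^ n) = - (Re (z ^ n) / real n)" for n
    proof -
      have "(-1) ^ Suc n / of_nat n * (-z) ^ n = - (((-1) * (-1)) ^ n * z ^ n / of_nat n)"
        unfolding power_mult_distrib power_minus[of z n] by simp
      then have "(-1) ^ Suc n / of_nat n * (-z) ^ n = - (z ^ n / of_nat n)" by simp
      then have "Re ((-1) ^ Suc n / of_nat n * (-z) ^ n) = Re (- (z ^ n / of_nat n))" by (rule arg_cong)
      then show ?thesis by (simp only: uminus_complex.sel Re_divide_of_nat)
    qed
    moreover have "1 - z \<noteq> 0" using z by auto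
    ultimately show ?thesis by (simp del: power_Suc)
  qed
  have n1: "norm (of_real x :: complex) < 1" "norm (of_real x * w) < 1" "norm (of_real x * w\<^sup>2) < 1"
    using x w by (simp_all add: norm_mult norm_power)
  have nz: "norm (1 - z) > 0" if "norm z < 1" for z :: complex using that by auto
  define L where "L = 3 * ln (norm (1 - complex_of_real x)) + 4 * ln (norm (1 - of_real x * w)) + ln (norm (1 - of_real x * w\<^sup>2))"
  have "(\<lambda>n. 3 * (- (Re (of_real x ^ n) / real n)) + 4 * (- (Re ((of_real x * w) ^ n) / real n))
       + - (Re ((of_real x * w\<^sup>2) ^ n) / real n)) sums L"
    unfolding L_def by (intro sums_add sums_mult ln_norm n1)
  moreover have "3 * (- (Re (of_real x ^ n) / real n)) + 4 * (- (Re ((of_real x * w) ^ n) / real n))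
       + - (Re ((of_real x * w\<^sup>2) ^ n) / real n) \<le> 0" for n
  proof -
    define v where "v = w ^ n"
    have v: "norm v = 1" using w by (simp add: v_def norm_power)
    have "(Re v)\<^sup>2 + (Im v)\<^sup>2 = 1" using v by (simp add: cmod_def)
    then have "Re (v\<^sup>2) = 2 * (Re v)\<^sup>2 - 1" by (simp add: power2_eq_square)
    then have "3 + 4 * Re v + Re (v\<^sup>2) = 2 * (1 + Re v)\<^sup>2" by (simp add: power2_eq_square algebra_simps)
    then have nonneg: "0 \<le> x ^ n / real n * (3 + 4 * Re v + Re (v\<^sup>2))" using x by simp
    have re: "Re ((of_real x * w) ^ n) = x ^ n * Re v" "Re ((of_real x * w\<^sup>2) ^ n) = x ^ n * Re (v\<^sup>2)"
      "Re (of_real x ^ n) = x ^ n"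
      by (simp_all add: v_def power_mult_distrib flip: of_real_power power_mult mult.commute[of n 2])
    show ?thesis unfolding re using nonneg by (simp add: algebra_simps add_divide_distrib)
  qed
  ultimately have "L \<le> 0" by (metis (no_types, lifting) sums_le sums_zero)
  moreover have "ln (norm (1 - complex_of_real x) ^ 3 * norm (1 - of_real x * w) ^ 4 * norm (1 - of_real x * w\<^sup>2)) = L"
    using nz[OF n1(1)] nz[OF n1(2)] nz[OF n1(3)]
    by (simp add: L_def ln_mult ln_realpow)
  ultimately show ?thesis
    using nz[OF n1(1)] nz[OF n1(2)] nz[OF n1(3)] by (metis ln_le_zero_iff mult_pos_pos zero_less_power)
qed

text \<open>The same expression formed from finite Euler products is at most 1, prime by prime, by
  \<open>three_four_one\<close>. Multiplied by the expression for \<zeta> it tends to 1, so the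
  latter is at least 1. No logarithm of \<zeta> is taken.\<close>

lemma zeta_three_four_one:
  assumes \<sigma>: "\<sigma> > 1"
  shows "norm (zeta (of_real \<sigma>)) ^ 3 * norm (zeta (Complex \<sigma> t)) ^ 4 * norm (zeta (Complex \<sigma> (2 * t))) \<ge> 1"
proof -
  define E where "E = (\<lambda>s P. \<Prod>p | prime p \<and> p \<le> P. 1 - complex_of_nat p powr (-s))"
  define q where "q = (\<lambda>f. norm (f (complex_of_real \<sigma>)) ^ 3 * norm (f (Complex \<sigma> t)) ^ 4 * norm (f (Complex \<sigma> (2 * t)) :: complex))"
  have "(\<lambda>P. q (\<lambda>s. zeta s * E s P)) \<longlonglongrightarrow> norm (1::complex) ^ 3 * norm (1::complex) ^ 4 * norm (1::complex)"
    unfolding q_def E_def using \<sigma>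
    by (intro tendsto_intros zeta_Euler_product) auto
  moreover have "q (\<lambda>s. zeta s * E s P) = q zeta * q (\<lambda>s. E s P)" for P
    by (simp add: q_def norm_mult power_mult_distrib)
  moreover have "q (\<lambda>s. E s P) \<le> 1" for P
  proof -
    have "q (\<lambda>s. E s P) = (\<Prod>p | prime p \<and> p \<le> P. q (\<lambda>s. 1 - complex_of_nat p powr (-s)))"
      by (simp add: q_def E_def prod_norm prod.distrib flip: prod_power_distrib)
    also have "\<dots> \<le> 1"
    proof (rule prod_le_1)
      fix p assume "p \<in> {p. prime p \<and> p \<le> P}"
      then have p: "p > 1" by (auto dest: prime_gt_1_nat)
      define x where "x = real p powr (-\<sigma>)"
      define w where "w = complex_of_nat p powr (- Complex 0 t)"
      have x: "complex_of_nat p powr (- of_real \<sigma>) = of_real x"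
        by (simp add: x_def flip: powr_of_real)
      have "- Complex \<sigma> t = - of_real \<sigma> + - Complex 0 t"
        "- Complex \<sigma> (2 * t) = - of_real \<sigma> + (- Complex 0 t + - Complex 0 t)"
        by (simp_all add: complex_eq_iff)
      then have "complex_of_nat p powr (- Complex \<sigma> t) = of_real x * w"
        "complex_of_nat p powr (- Complex \<sigma> (2 * t)) = of_real x * w\<^sup>2"
        unfolding x[symmetric] w_def power2_eq_square by (simp_all only: powr_add)
      moreover have "norm w = 1" using p by (simp add: w_def norm_of_nat_powr)
      moreover have "0 \<le> x" "x < 1" using p \<sigma> by (auto simp: x_def powr_less_one)
      ultimately show "0 \<le> q (\<lambda>s. 1 - complex_of_nat p powr (-s)) \<and> q (\<lambda>s. 1 - complex_of_nat p powr (-s)) \<le> 1"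
        using three_four_one[of x w] by (simp add: q_def x)
    qed
    finally show ?thesis .
  qed
  moreover have "q zeta \<ge> 0" by (simp add: q_def)
  ultimately have "(\<lambda>P. q (\<lambda>s. zeta s * E s P)) \<longlonglongrightarrow> 1" "\<And>P. q (\<lambda>s. zeta s * E s P) \<le> q zeta"
    by (simp_all add: mult_left_le)
  then have "1 \<le> q zeta" by (intro LIMSEQ_le_const2) auto
  then show ?thesis by (simp add: q_def)
qed

text \<open>On the line itself, a zero at 1 + it enters the 3-4-1 product with exponent 4 and the
  pole at 1 with exponent 3. As \<sigma> decreases to 1, a factor \<sigma> - 1 is left over and
  forces the product to 0, although it is at least 1.\<close>

lemma zeta_ext_nonzero:
  assumes "Re s \<ge> 1"
  shows "zeta_ext s \<noteq> 0"
proof (cases "Re s > 1")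
  case True
  then show ?thesis using zeta_nonzero[OF True] by (auto simp: zeta_ext_eq)
next
  case False
  then have Re: "Re s = 1" using assms by simp
  show ?thesis
  proof (cases "Im s = 0")
    case True
    then have "s = 1" using Re by (simp add: complex_eq_iff)
    then show ?thesis by simp
  next
    case t: False
    define t where "t = Im s"
    have s: "s = Complex 1 t" using Re by (simp add: t_def complex_eq_iff)
    show ?thesis
    proof
      assume zero: "zeta_ext s = 0"
      have diff: "zeta_ext field_differentiable at s"
        using zeta_ext_holomorphic Re
        by (intro holomorphic_on_imp_differentiable_at) (auto simp: open_halfspace_Re_gt)
      then obtain D where D: "(zeta_ext has_field_derivative D) (at s)" by (auto simp: field_differentiable_def)
      have cont: "isCont zeta_ext z" if "Re z > 0" for z
        using zeta_ext_holomorphic that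
        by (intro field_differentiable_imp_continuous_at holomorphic_on_imp_differentiable_at)
           (auto simp: open_halfspace_Re_gt)
      have lim: "((\<lambda>\<sigma>. zeta_ext (Complex \<sigma> u)) \<longlongrightarrow> zeta_ext (Complex 1 u)) (at_right 1)" for u
      proof (rule isCont_tendsto_compose[OF cont])
        show "((\<lambda>\<sigma>. Complex \<sigma> u) \<longlongrightarrow> Complex 1 u) (at_right 1)" by (intro tendsto_intros)
      qed auto
      have lim1: "((\<lambda>\<sigma>. zeta_ext (Complex \<sigma> t) / of_real (\<sigma> - 1)) \<longlongrightarrow> D) (at_right 1)"
      proof -
        have "((\<lambda>z. (zeta_ext z - zeta_ext s) / (z - s)) \<longlongrightarrow> D) (at s)"
          using D by (simp add: has_field_derivative_iff)
        moreover have "filterlim (\<lambda>\<sigma>. Complex \<sigma> t) (at s) (at_right 1)"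
          unfolding filterlim_at
        proof
          show "((\<lambda>\<sigma>. Complex \<sigma> t) \<longlongrightarrow> s) (at_right 1)" unfolding s by (intro tendsto_intros)
          show "\<forall>\<^sub>F \<sigma> in at_right 1. Complex \<sigma> t \<in> UNIV \<and> Complex \<sigma> t \<noteq> s"
            using eventually_at_right_less[of 1] by eventually_elim (auto simp: s)
        qed
        ultimately have "((\<lambda>\<sigma>. (zeta_ext (Complex \<sigma> t) - zeta_ext s) / (Complex \<sigma> t - s)) \<longlongrightarrow> D) (at_right 1)"
          by (rule filterlim_compose)
        moreover have "Complex \<sigma> t - s = of_real (\<sigma> - 1)" for \<sigma> by (simp add: s complex_eq_iff)
        ultimately show ?thesis using zero by simp
      qed
      \<comment> \<open>The 3-4-1 product for \<zeta>, rewritten through \<open>zeta_ext\<close>: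
        the pole contributes (\<sigma> - 1)^(-3), the difference quotient at the supposed zero
        absorbs (\<sigma> - 1)^4, and the other denominators stay away from 0 because t is not
        0.\<close>
      define Q where "Q = (\<lambda>\<sigma>. (\<sigma> - 1) * (norm (zeta_ext (Complex \<sigma> 0)) ^ 3 *
        norm (zeta_ext (Complex \<sigma> t) / of_real (\<sigma> - 1)) ^ 4 * norm (zeta_ext (Complex \<sigma> (2 * t))))
        / (norm (Complex (\<sigma> - 1) t) ^ 4 * norm (Complex (\<sigma> - 1) (2 * t))))"
      have "(Q \<longlongrightarrow> (1 - 1) * (norm (zeta_ext (Complex 1 0)) ^ 3 * norm D ^ 4 * norm (zeta_ext (Complex 1 (2 * t))))
        / (norm (Complex (1 - 1) t) ^ 4 * norm (Complex (1 - 1) (2 * t)))) (at_right 1)"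
        unfolding Q_def using t by (intro tendsto_intros lim lim1) (auto simp: t_def complex_eq_iff)
      then have "(Q \<longlongrightarrow> 0) (at_right 1)" by simp
      moreover have "\<forall>\<^sub>F \<sigma> in at_right 1. 1 \<le> Q \<sigma>"
        using eventually_at_right_less[of 1]
      proof eventually_elim
        fix \<sigma> :: real assume \<sigma>: "1 < \<sigma>"
        have z: "norm (zeta (Complex \<sigma> u)) = norm (zeta_ext (Complex \<sigma> u)) / norm (Complex (\<sigma> - 1) u)" for u
        proof -
          have "Complex \<sigma> u - 1 = Complex (\<sigma> - 1) u" "Complex (\<sigma> - 1) u \<noteq> 0"
            using \<sigma> by (auto simp: complex_eq_iff)
          then show ?thesis using \<sigma> by (simp add: zeta_ext_eq norm_mult)
        qed
        have r: "norm (Complex (\<sigma> - 1) 0) = \<sigma> - 1" using \<sigma> by (simp add: cmod_def)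
        have "1 \<le> norm (zeta (Complex \<sigma> 0)) ^ 3 * norm (zeta (Complex \<sigma> t)) ^ 4 * norm (zeta (Complex \<sigma> (2 * t)))"
          using zeta_three_four_one[OF \<sigma>, of t] by (simp add: complex_of_real_def)
        also have "\<dots> = Q \<sigma>"
        proof -
          have *: "(a / d) ^ 3 * (b / n) ^ 4 * (c / m) = d * (a ^ 3 * (b / d) ^ 4 * c) / (n ^ 4 * m)"
            if "d > 0" for a b c d m n :: real
            using that by (simp add: power_divide power3_eq_cube power4_eq_xxxx)
          show ?thesis
            using *[of "\<sigma> - 1"] \<sigma> unfolding z r Q_def norm_divide norm_of_real by simp
        qed
        finally show "1 \<le> Q \<sigma>" .
      qed
      ultimately have "1 \<le> (0::real)"
        by (intro tendsto_lowerbound[of Q]) auto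
      then show False by simp
    qed
  qed
qed

section \<open>A Tauberian theorem\<close>

text \<open>Comparison with the integral of t^(-1-x) over [n, n + 1]; the right side is written as a
  difference so that it telescopes.\<close>

lemma powr_diff_Suc_le:
  assumes "x > 0" "n > 0"
  shows "real (Suc n) powr (-1 - x) \<le> (real n powr (-x) - real (Suc n) powr (-x)) / x"
proof -
  have "\<exists>z>real n. z < real (Suc n) \<and>
      real (Suc n) powr (-x) - real n powr (-x) = (real (Suc n) - real n) * (-x * z powr (-x - 1))"
    using assms by (intro MVT2) (auto intro!: derivative_eq_intros)
  then obtain z where z: "z > real n" "z < real (Suc n)"
    "real n powr (-x) - real (Suc n) powr (-x) = x * z powr (-x - 1)" by auto
  have "real (Suc n) powr (-x - 1) \<le> z powr (-x - 1)"
    using assms z by (intro powr_mono2') auto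
  moreover have "-1 - x = -x - 1" by simp
  ultimately show ?thesis using assms z by (simp only: nonzero_mult_div_cancel_left)
qed

text \<open>Comparison with the integral of t^(x-1) up to N, which is N^x / x. The extra summand 1/N
  accounts for the last term of the sum, which the integral misses when the integrand
  increases.\<close>

lemma sum_powr_le:
  assumes x: "x > 0"
  shows "(\<Sum>n\<le>N. real n powr (x - 1)) \<le> real N powr x * (1 / real N + 1 / x)"
proof (cases "N = 0")
  case False
  have diff: "\<exists>z>real n. z < real (Suc n) \<and> (real (Suc n) powr x - real n powr x) / x = z powr (x - 1)"
    if "n > 0" for n
  proof -
    have "\<exists>z>real n. z < real (Suc n) \<and>
        real (Suc n) powr x - real n powr x = (real (Suc n) - real n) * (x * z powr (x - 1))"
      using that by (intro MVT2) (auto intro!: derivative_eq_intros)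
    with x show ?thesis by auto
  qed
  have "(\<Sum>n\<le>N. real n powr (x - 1)) \<le> real N powr x / x + real N powr (x - 1)"
  \<comment> \<open>The direction in which t^(x-1) is monotone decides whether the term is compared
    with the interval to its right (x \<ge> 1) or to its left (x < 1).\<close>
  proof (cases "x \<ge> 1")
    case True
    have "(\<Sum>n\<le>N. real n powr (x - 1)) \<le> real N powr x / x + real N powr (x - 1)"
    proof (induction N)
      case (Suc N)
      show ?case
      proof (cases "N = 0")
        case False
        then obtain z where z: "z > real N" "z < real (Suc N)" "(real (Suc N) powr x - real N powr x) / x = z powr (x - 1)"
          using diff[of N] by auto
        have "real N powr (x - 1) \<le> z powr (x - 1)" using z True by (intro powr_mono2) auto
        then show ?thesis using Suc z by (simp add: diff_divide_distrib)
      qed (use x in auto)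
    qed simp
    then show ?thesis .
  next
    case False
    have "(\<Sum>n\<le>N. real n powr (x - 1)) \<le> real N powr x / x"
    proof (induction N)
      case (Suc N)
      show ?case
      proof (cases "N = 0")
        case N: False
        then obtain z where z: "z > real N" "z < real (Suc N)" "(real (Suc N) powr x - real N powr x) / x = z powr (x - 1)"
          using diff[of N] by auto
        have "real (Suc N) powr (x - 1) \<le> z powr (x - 1)" using z False by (intro powr_mono2') auto
        then show ?thesis using Suc z by (simp add: diff_divide_distrib)
      qed (use x False in auto)
    qed simp
    then show ?thesis by (smt (verit) powr_ge_zero)
  qed
  also have "\<dots> = real N powr x * (1 / real N + 1 / x)"
    using False by (simp add: powr_diff field_simps)
  finally show ?thesis .
qed simp

text \<open>Termwise comparison with a telescoping series. On the right half circle of Newman's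
  contour the factor 1 / Re z is compensated by the kernel.\<close>

lemma Dirichlet_tail_bound:
  fixes a :: "nat \<Rightarrow> complex"
  assumes a: "\<And>n. norm (a n) \<le> 1" and x: "Re z > 0" and N: "N > 0"
    and G: "(\<lambda>n. a n * of_nat n powr (-1 - z)) sums G"
  shows "norm (G - (\<Sum>n\<le>N. a n * of_nat n powr (-1 - z))) \<le> real N powr (- Re z) / Re z"
proof -
  define f where "f = (\<lambda>n. a n * of_nat n powr (-1 - z))"
  have "f sums G" using G by (simp add: f_def)
  then have "(\<lambda>n. f (n + Suc N)) sums (G - (\<Sum>n<Suc N. f n))" by (rule sums_split_initial_segment)
  then have sums: "(\<lambda>n. f (n + Suc N)) sums (G - (\<Sum>n\<le>N. f n))" by (simp only: lessThan_Suc_atMost)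
  define g where "g = (\<lambda>n. real (n + N) powr (- Re z) / Re z)"
  have bound: "norm (f (n + Suc N)) \<le> g n - g (Suc n)" for n
  proof -
    have "norm (f (n + Suc N)) \<le> 1 * real (n + Suc N) powr (-1 - Re z)"
      unfolding f_def norm_mult norm_of_nat_powr using a by (intro mult_mono) auto
    also have "\<dots> \<le> g n - g (Suc n)"
      using powr_diff_Suc_le[OF x, of "n + N"] N by (simp add: g_def diff_divide_distrib add_ac)
    finally show ?thesis .
  qed
  have "g \<longlonglongrightarrow> 0"
  proof -
    have "(\<lambda>n. real n powr (- Re z)) \<longlonglongrightarrow> 0"
      using x by (intro tendsto_neg_powr filterlim_real_sequentially) auto
    then have "(\<lambda>n. real (n + N) powr (- Re z)) \<longlonglongrightarrow> 0" by (rule LIMSEQ_ignore_initial_segment)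
    then show ?thesis unfolding g_def by (rule tendsto_divide_zero)
  qed
  then have gs: "(\<lambda>n. g n - g (Suc n)) sums (g 0 - 0)" by (rule telescope_sums')
  have "norm (\<Sum>n. f (n + Suc N)) \<le> (\<Sum>n. g n - g (Suc n))"
    using bound gs by (intro norm_suminf_le) (auto simp: sums_iff)
  then show ?thesis using sums gs by (simp add: sums_iff f_def g_def)
qed

section \<open>Ingredients of the contour argument\<close>

text \<open>Dominated convergence: N^z is bounded by 1 and tends to 0 at interior points of the
  segment. The endpoints may lie on the imaginary axis, where nothing decays; they form a null set,
  so the integral is taken over the open interval.\<close>

lemma contour_integral_linepath_powr_tendsto_0:
  assumes F: "continuous_on (closed_segment a b) F"
    and neg: "\<And>u. 0 < u \<Longrightarrow> u < 1 \<Longrightarrow> Re (linepath a b u) < 0"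
  shows "(\<lambda>N. contour_integral (linepath a b) (\<lambda>z. F z * of_nat N powr z)) \<longlonglongrightarrow> 0"
proof -
  have cont: "continuous_on {0..1} (\<lambda>u. F (linepath a b u))"
    using F by (rule continuous_on_compose2) (auto simp: linepath_image_01[symmetric] intro: continuous_on_linepath)
  define h where "h = (\<lambda>N u. F (linepath a b u) * of_nat N powr linepath a b u * (b - a))"
  have int: "contour_integral (linepath a b) (\<lambda>z. F z * of_nat N powr z) = integral {0<..<1} (h N)" for N
    by (simp add: contour_integral_integral h_def flip: integral_open_interval_real)
  have cont_h: "continuous_on {0..1} (h N)" for N
  proof (cases "N = 0")
    case False
    show ?thesis unfolding h_def powr_def using False
      by (auto intro!: continuous_intros cont continuous_on_linepath)
  qed (simp add: h_def)
  have "compact ((\<lambda>u. F (linepath a b u)) ` {0..1})" by (intro compact_continuous_image cont) simp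
  then obtain B where B: "\<And>u. u \<in> {0..1} \<Longrightarrow> norm (F (linepath a b u)) \<le> B"
    by (meson compact_imp_bounded bounded_iff imageI)
  have "(\<lambda>N. integral {0<..<1} (h N)) \<longlonglongrightarrow> integral {0<..<1::real} (\<lambda>_. 0 :: complex)"
  proof (rule dominated_convergence(2))
    show "h N integrable_on {0<..<1}" for N
      using integrable_continuous_real[OF cont_h[of N]] by (simp add: integrable_on_Icc_iff_Ioo)
    show "(\<lambda>_. B * norm (b - a)) integrable_on {0<..<1::real}"
      by (simp add: integrable_on_const flip: integrable_on_Icc_iff_Ioo)
    fix u :: real assume u: "u \<in> {0<..<1}"
    have re: "Re (linepath a b u) < 0" using neg u by auto
    show "norm (h N u) \<le> B * norm (b - a)" for N
    proof -
      have "real N powr Re (linepath a b u) \<le> 1"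
      proof (cases "N = 0")
        case False
        then have "real N powr Re (linepath a b u) \<le> real N powr 0" using re by (intro powr_mono) auto
        with False show ?thesis by simp
      qed simp
      then have "norm (F (linepath a b u)) * real N powr Re (linepath a b u) \<le> B * 1"
        using B[of u] u by (intro mult_mono) (auto intro: order_trans[OF norm_ge_zero])
      then show ?thesis
        by (simp add: h_def norm_mult norm_of_nat_powr mult_right_mono)
    qed
    have "(\<lambda>N. real N powr Re (linepath a b u)) \<longlonglongrightarrow> 0"
      using re by (intro tendsto_neg_powr filterlim_real_sequentially) auto
    then have *: "(\<lambda>N. of_nat N powr linepath a b u :: complex) \<longlonglongrightarrow> 0"
      by (intro tendsto_norm_zero_cancel[of "\<lambda>N. of_nat N powr linepath a b u"]) (simp add: norm_of_nat_powr)
    have "(\<lambda>N. h N u) \<longlonglongrightarrow> F (linepath a b u) * 0 * (b - a)"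
      unfolding h_def by (intro tendsto_mult tendsto_const *)
    then show "(\<lambda>N. h N u) \<longlonglongrightarrow> 0" by simp
  qed
  then show ?thesis by (simp add: int)
qed

lemma has_contour_integral_inverse_part_circlepath:
  assumes "R > 0" "s < t"
  shows "((\<lambda>w. 1 / (w - 0)) has_contour_integral \<i> * of_real (t - s)) (part_circlepath 0 R s t)"
proof -
  have "((\<lambda>_. \<i>) has_integral of_real (t - s) * \<i>) {s..t}"
    using has_integral_const_real[of \<i> s t] assms by (simp add: scaleR_conv_of_real)
  then show ?thesis
    unfolding has_contour_integral_part_circlepath_iff[OF assms(2)]
    using assms by (simp add: mult.commute)
qed

text \<open>On the circle, R^2 = z * cnj z, so the kernel collapses to (z + cnj z) / R^2. The
  resulting factor |Re z| cancels the singularity 1 / |Re z| of the series bounds.\<close>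

lemma norm_Newman_kernel:
  assumes "norm z = R" "R > 0"
  shows "norm ((1 + z\<^sup>2 / of_real (R\<^sup>2)) / z) = 2 * \<bar>Re z\<bar> / R\<^sup>2"
proof -
  have z0: "z \<noteq> 0" using assms by auto
  have "of_real (R\<^sup>2) = z * cnj z" using assms by (simp add: complex_norm_square[symmetric])
  then have "(1 + z\<^sup>2 / of_real (R\<^sup>2)) / z = (z + cnj z) / of_real (R\<^sup>2)"
    using z0 by (simp add: field_simps power2_eq_square)
  also have "norm \<dots> = 2 * \<bar>Re z\<bar> / R\<^sup>2"
    by (simp add: complex_add_cnj norm_divide norm_power norm_mult)
  finally show ?thesis .
qed

lemma winding_number_from_has_contour_integral:
  assumes "((\<lambda>w. 1 / (w - z)) has_contour_integral 2 * of_real pi * \<i>) g" "valid_path g" "z \<notin> path_image g"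
  shows "winding_number g z = 1"
  using assms by (simp add: winding_number_valid_path contour_integral_unique)

text \<open>Newman's contour argument, with the left part of the contour replaced by two sides of a
  triangle so that everything happens inside a convex neighbourhood.\<close>

theorem Newman_Tauberian:
  fixes a :: "nat \<Rightarrow> complex" and G :: "complex \<Rightarrow> complex"
  assumes a: "\<And>n. norm (a n) \<le> 1"
    and U: "open U" "{z. Re z \<ge> 0} \<subseteq> U" "G holomorphic_on U"
    and G: "\<And>z. Re z > 0 \<Longrightarrow> (\<lambda>n. a n * of_nat n powr (-1 - z)) sums G z"
  shows "(\<lambda>n. a n / of_nat n) sums G 0"
proof -
  define S where "S = (\<lambda>N z. \<Sum>n\<le>N. a n * of_nat n powr (-1 - z))"
  \<comment> \<open>The sequence J depends on R but tends to 0 for each fixed R; so R is chosen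
    before N.\<close>
  have main: "\<exists>J :: nat \<Rightarrow> complex. J \<longlonglongrightarrow> 0 \<and> (\<forall>N>0. norm (G 0 - S N 0) \<le> 2 / R + 1 / real N + norm (J N))"
    if R: "R > 0" for R :: real
  proof -
    \<comment> \<open>The kernel has value 1 at 0, so Cauchy's formula returns the values at 0. The
      factor 1 + z^2 / R^2 vanishes at the two points where the contour meets the imaginary
      axis.\<close>
    define K where "K = (\<lambda>N z. (of_nat N :: complex) powr z * (1 + z\<^sup>2 / of_real (R\<^sup>2)))"
    define p where "p = complex_of_real R * \<i>"
    \<comment> \<open>By compactness of this piece of the imaginary axis, a strip of fixed width
      \<epsilon> to its left still belongs to U. The segment exceeds the radius R by 1, so the
      circle's right half fits into the open strip V.\<close>
    define L where "L = closed_segment (Complex 0 (- (R + 1))) (Complex 0 (R + 1))"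
    have L: "Complex 0 y \<in> L" if "\<bar>y\<bar> < R + 1" for y
    proof -
      define u where "u = (y + R + 1) / (2 * (R + 1))"
      have "0 \<le> u" "u \<le> 1" using that R by (auto simp: u_def field_simps)
      moreover have "Complex 0 y = (1 - u) *\<^sub>R Complex 0 (- (R + 1)) + u *\<^sub>R Complex 0 (R + 1)"
      proof -
        have "u * (2 * (R + 1)) = y + (R + 1)" using R by (simp add: u_def)
        then show ?thesis by (simp add: complex_eq_iff algebra_simps)
      qed
      ultimately show ?thesis unfolding L_def closed_segment_def by blast
    qed
    have "L \<subseteq> U" using U(2) by (force simp: L_def closed_segment_def)
    then obtain \<epsilon> where \<epsilon>: "\<epsilon> > 0" "(\<Union>x\<in>L. ball x \<epsilon>) \<subseteq> U"
      using compact_subset_open_imp_ball_epsilon_subset[of L U] U(1) unfolding L_def by auto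
    define V where "V = {z. Re z > -\<epsilon>} \<inter> ({z. Im z < R + 1} \<inter> {z. Im z > - (R + 1)})"
    have V: "open V" "convex V"
      unfolding V_def
      by (intro open_Int open_halfspace_Re_gt open_halfspace_Im_gt open_halfspace_Im_lt
           convex_Int convex_halfspace_Re_gt convex_halfspace_Im_gt convex_halfspace_Im_lt)+
    have "V \<subseteq> U"
    proof
      fix z assume z: "z \<in> V"
      show "z \<in> U"
      proof (cases "Re z \<ge> 0")
        case False
        have "Complex 0 (Im z) \<in> L" using z by (intro L) (auto simp: V_def)
        moreover have "Complex 0 (Im z) - z = of_real (- Re z)" by (simp add: complex_eq_iff)
        then have "dist (Complex 0 (Im z)) z < \<epsilon>" using z False by (simp add: dist_norm V_def)
        ultimately show ?thesis using \<epsilon>(2) unfolding ball_def by blast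
      qed (use U(2) in auto)
    qed
    then have GV: "G holomorphic_on V" using U(3) holomorphic_on_subset by blast
    define \<delta> where "\<delta> = \<epsilon> / 2"
    have \<delta>: "0 < \<delta>" "\<delta> < \<epsilon>" using \<epsilon> by (auto simp: \<delta>_def)
    \<comment> \<open>A and A' are the right and left halves of the circle, B is the detour through
      the tip -\<delta>. G is integrated over A and B, the partial sum S N, which is entire, over A
      and A'.\<close>
    define A where "A = part_circlepath 0 R (- (pi / 2)) (pi / 2)"
    define A' where "A' = part_circlepath 0 R (pi / 2) (3 * pi / 2)"
    define B where "B = linepath p (- of_real \<delta>) +++ linepath (- of_real \<delta>) (- p)"
    have path_ends: "pathstart (part_circlepath 0 R s t) = of_real R * cis s"
      "pathfinish (part_circlepath 0 R s t) = of_real R * cis t" for s t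
      by (simp_all add: cis_conv_exp)
    have cis: "cis (pi / 2) = \<i>" "cis (- (pi / 2)) = - \<i>" by (simp_all add: complex_eq_iff)
    have "cis (3 * pi / 2) = cis (pi + pi / 2)" by (rule arg_cong[where f = cis]) simp
    also have "\<dots> = cis pi * cis (pi / 2)" by (simp only: cis_mult)
    finally have cis3: "cis (3 * pi / 2) = - \<i>" using cis by simp
    have A: "valid_path A" "pathstart A = - p" "pathfinish A = p"
      and A': "valid_path A'" "pathstart A' = p" "pathfinish A' = - p"
      unfolding A_def A'_def p_def path_ends cis cis3 by simp_all
    have B: "valid_path B" "pathstart B = p" "pathfinish B = - p"
      by (auto simp: B_def)
    have imA: "norm z = R \<and> Re z \<ge> 0" if "z \<in> path_image A" for z
    proof -
      from that obtain t where t: "- (pi / 2) \<le> t" "t \<le> pi / 2" "z = of_real R * cis t"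
        by (auto simp: A_def path_image_part_circlepath' closed_segment_eq_real_ivl)
      with R show ?thesis by (simp add: norm_mult cos_ge_zero)
    qed
    have imA': "norm z = R \<and> Re z \<le> 0" if "z \<in> path_image A'" for z
    proof -
      from that obtain t where t: "pi / 2 \<le> t" "t \<le> 3 * pi / 2" "z = of_real R * cis t"
        by (auto simp: A'_def path_image_part_circlepath' closed_segment_eq_real_ivl)
      have "cos (t - pi) \<ge> 0" using t by (intro cos_ge_zero) auto
      then have "cos t \<le> 0" by (simp add: cos_diff)
      with R t show ?thesis by (simp add: norm_mult mult_nonneg_nonpos)
    qed
    have ends: "z = p \<or> z = - p" if "norm z = R" "Re z = 0" for z
    proof -
      have "\<bar>Im z\<bar> = R" using that by (simp add: cmod_def)
      then show ?thesis using that by (auto simp: p_def complex_eq_iff abs_if split: if_splits)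
    qed
    have imB: "z \<in> V \<and> (Re z < 0 \<or> Re z = 0 \<and> Im z \<noteq> 0)" if "z \<in> path_image B" for z
    proof
      have "p \<in> V" "- p \<in> V" "- of_real \<delta> \<in> V" using R \<epsilon> \<delta> by (auto simp: V_def p_def)
      then have "closed_segment p (- of_real \<delta>) \<subseteq> V" "closed_segment (- of_real \<delta>) (- p) \<subseteq> V"
        using V by (simp_all add: closed_segment_subset)
      with that show "z \<in> V" by (auto simp: B_def path_image_join)
      from that have "z \<in> closed_segment p (- of_real \<delta>) \<or> z \<in> closed_segment (- p) (- of_real \<delta>)"
        by (auto simp: B_def path_image_join closed_segment_commute)
      then obtain q u where q: "q = p \<or> q = - p" and u: "0 \<le> u" "u \<le> 1"
        "z = (1 - u) *\<^sub>R q + u *\<^sub>R (- of_real \<delta>)"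
        unfolding closed_segment_def by blast
      then have "Re z = - (u * \<delta>)" "\<bar>Im z\<bar> = (1 - u) * R"
        using R by (auto simp: p_def abs_mult)
      then show "Re z < 0 \<or> Re z = 0 \<and> Im z \<noteq> 0"
        using u R \<delta> by (cases "u = 0") auto
    qed
    have AV: "path_image A \<subseteq> V - {0}"
    proof
      fix z assume z: "z \<in> path_image A"
      then show "z \<in> V - {0}" using imA[OF z] R \<epsilon> abs_Im_le_cmod[of z] by (auto simp: V_def)
    qed
    have BV: "path_image B \<subseteq> V - {0}" using imB by fastforce
    have wA: "((\<lambda>w. 1 / (w - 0)) has_contour_integral \<i> * pi) A"
      using has_contour_integral_inverse_part_circlepath[of R "- (pi / 2)" "pi / 2"] R by (simp add: A_def)
    have wA': "((\<lambda>w. 1 / (w - 0)) has_contour_integral \<i> * pi) A'"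
      using has_contour_integral_inverse_part_circlepath[of R "pi / 2" "3 * pi / 2"] R by (simp add: A'_def)
    \<comment> \<open>To the left of the imaginary axis and at its nonzero points, -w avoids the
      branch cut of \<open>Ln\<close>, so \<open>Ln (- w)\<close> is a primitive along all of
      B.\<close>
    have wB: "((\<lambda>w. 1 / (w - 0)) has_contour_integral \<i> * pi) B"
    proof -
      have "((\<lambda>w. 1 / (w - 0)) has_contour_integral (Ln (- (pathfinish B)) - Ln (- (pathstart B)))) B"
      proof (rule contour_integral_primitive[where f = "\<lambda>w. Ln (- w)", OF _ B(1) order_refl])
        fix x assume "x \<in> path_image B"
        then have "- x \<notin> \<real>\<^sub>\<le>\<^sub>0" "x \<noteq> 0" using imB[of x] by (auto simp: complex_nonpos_Reals_iff)
        then show "((\<lambda>w. Ln (- w)) has_field_derivative 1 / (x - 0)) (at x within path_image B)"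
          by (auto intro!: derivative_eq_intros simp: field_simps)
      qed
      moreover have "Ln p = Ln (of_real R) + \<i> * pi / 2" "Ln (- p) = Ln (of_real R) - \<i> * pi / 2"
        using Ln_times_of_real[of R \<i>] Ln_times_of_real[of R "-\<i>"] R by (simp_all add: p_def)
      ultimately show ?thesis by (simp add: B)
    qed
    have windB: "winding_number (A +++ B) 0 = 1"
    proof (rule winding_number_from_has_contour_integral)
      show "((\<lambda>w. 1 / (w - 0)) has_contour_integral 2 * of_real pi * \<i>) (A +++ B)"
        using has_contour_integral_join[OF wA wB A(1) B(1)] by (simp add: algebra_simps)
    qed (use A B AV BV in \<open>auto simp: path_image_join\<close>)
    have windA': "winding_number (A +++ A') 0 = 1"
    proof (rule winding_number_from_has_contour_integral)
      show "((\<lambda>w. 1 / (w - 0)) has_contour_integral 2 * of_real pi * \<i>) (A +++ A')"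
        using has_contour_integral_join[OF wA wA' A(1) A'(1)] by (simp add: algebra_simps)
      show "0 \<notin> path_image (A +++ A')"
        using imA imA' R A A' by (force simp: path_image_join)
    qed (use A A' in auto)
    have K_hol: "K N holomorphic_on X" for N X unfolding K_def using R by (auto intro!: holomorphic_intros)
    have S_hol: "S N holomorphic_on X" for N X unfolding S_def by (auto intro!: holomorphic_intros)
    have K0: "K N 0 = 1" if "N > 0" for N using that by (simp add: K_def)
    have cont: "continuous_on X (\<lambda>z. F z * K N z / z)" if "F holomorphic_on V" "X \<subseteq> V - {0}" for F N X
      using that K_hol[of N X]
      by (intro continuous_intros holomorphic_on_imp_continuous_on holomorphic_on_subset[OF that(1)]) auto
    \<comment> \<open>The contribution of B is the only one without an explicit bound: it uses just
      continuity of G on B and the decay of N^z there.\<close>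
    define J where "J = (\<lambda>N. contour_integral B (\<lambda>z. G z * K N z / z) / (2 * pi * \<i>))"
    have J: "J \<longlonglongrightarrow> 0"
    proof -
      have lim: "(\<lambda>N. contour_integral (linepath u v) (\<lambda>z. G z * (1 + z\<^sup>2 / of_real (R\<^sup>2)) / z * of_nat N powr z)) \<longlonglongrightarrow> 0"
        if "closed_segment u v \<subseteq> path_image B" "\<And>t. 0 < t \<Longrightarrow> t < 1 \<Longrightarrow> Re (linepath u v t) < 0" for u v
      proof (rule contour_integral_linepath_powr_tendsto_0[OF _ that(2)])
        show "continuous_on (closed_segment u v) (\<lambda>z. G z * (1 + z\<^sup>2 / of_real (R\<^sup>2)) / z)"
          using that(1) BV R
          by (intro continuous_intros holomorphic_on_imp_continuous_on holomorphic_on_subset[OF GV]) auto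
      qed
      have eq: "G z * K N z / z = G z * (1 + z\<^sup>2 / of_real (R\<^sup>2)) / z * of_nat N powr z" for N z
        by (simp add: K_def)
      have seg: "closed_segment p (- of_real \<delta>) \<subseteq> path_image B" "closed_segment (- of_real \<delta>) (- p) \<subseteq> path_image B"
        by (auto simp: B_def path_image_join)
      have "contour_integral B (\<lambda>z. G z * K N z / z) =
          contour_integral (linepath p (- of_real \<delta>)) (\<lambda>z. G z * K N z / z)
          + contour_integral (linepath (- of_real \<delta>) (- p)) (\<lambda>z. G z * K N z / z)" for N
        unfolding B_def using seg BV
        by (intro contour_integral_join contour_integrable_continuous_linepath cont GV) auto
      moreover have "(\<lambda>N. contour_integral (linepath p (- of_real \<delta>)) (\<lambda>z. G z * K N z / z)
          + contour_integral (linepath (- of_real \<delta>) (- p)) (\<lambda>z. G z * K N z / z)) \<longlonglongrightarrow> 0 + 0"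
        unfolding eq using \<delta>
        by (intro tendsto_add lim seg) (auto simp: linepath_def p_def)
      ultimately show ?thesis unfolding J_def by (auto intro: tendsto_divide_zero)
    qed
    have bound: "norm (G 0 - S N 0) \<le> 2 / R + 1 / real N + norm (J N)" if N: "N > 0" for N
    proof -
      define IA where "IA = contour_integral A (\<lambda>z. (G z - S N z) * K N z / z)"
      define IA' where "IA' = contour_integral A' (\<lambda>z. S N z * K N z / z)"
      have intA: "(\<lambda>z. F z * K N z / z) contour_integrable_on A" if "F holomorphic_on V" for F
        unfolding A_def using AV
        by (intro contour_integrable_continuous_part_circlepath cont that) (simp add: A_def)
      have intB: "(\<lambda>z. G z * K N z / z) contour_integrable_on B"
        unfolding B_def using BV
        by (auto simp: B_def path_image_join intro!: contour_integrable_joinI contour_integrable_continuous_linepath cont GV)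
      have intA': "(\<lambda>z. S N z * K N z / z) contour_integrable_on A'"
        unfolding A'_def
      proof (intro contour_integrable_continuous_part_circlepath continuous_intros holomorphic_on_imp_continuous_on S_hol K_hol)
        show "\<forall>z\<in>path_image (part_circlepath 0 R (pi / 2) (3 * pi / 2)). z \<noteq> 0"
          using imA' R by (force simp: A'_def)
      qed
      have "((\<lambda>w. G w * K N w / (w - 0)) has_contour_integral (2 * pi * \<i> * winding_number (A +++ B) 0 * (G 0 * K N 0))) (A +++ B)"
      proof (intro Cauchy_integral_formula_convex_simple[of V] holomorphic_intros GV K_hol V)
        show "0 \<in> interior V" using V \<epsilon> R unfolding interior_open[OF V(1)] by (simp add: V_def)
      qed (use A B AV BV in \<open>auto simp: path_image_join\<close>)
      then have "contour_integral (A +++ B) (\<lambda>w. G w * K N w / w) = 2 * pi * \<i> * G 0"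
        using N by (simp add: windB K0 contour_integral_unique)
      then have eqG: "contour_integral A (\<lambda>w. G w * K N w / w) + contour_integral B (\<lambda>w. G w * K N w / w) = 2 * pi * \<i> * G 0"
        using intA[OF GV] intB A B by simp
      have "((\<lambda>w. S N w * K N w / (w - 0)) has_contour_integral (2 * pi * \<i> * winding_number (A +++ A') 0 * (S N 0 * K N 0))) (A +++ A')"
      proof (intro Cauchy_integral_formula_convex_simple[of UNIV] holomorphic_intros S_hol K_hol)
        show "path_image (A +++ A') \<subseteq> UNIV - {0}"
          using imA imA' R A A' by (force simp: path_image_join)
      qed (use A A' in auto)
      then have "contour_integral (A +++ A') (\<lambda>w. S N w * K N w / w) = 2 * pi * \<i> * S N 0"
        using N by (simp add: windA' K0 contour_integral_unique)
      then have eqS: "contour_integral A (\<lambda>w. S N w * K N w / w) + IA' = 2 * pi * \<i> * S N 0"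
        using intA[OF S_hol] intA' A A' by (simp add: IA'_def)
      have "IA = contour_integral A (\<lambda>w. G w * K N w / w) - contour_integral A (\<lambda>w. S N w * K N w / w)"
        unfolding IA_def using contour_integral_diff[OF intA[OF GV] intA[OF S_hol]]
        by (simp add: left_diff_distrib diff_divide_distrib)
      moreover have "2 * pi * \<i> * J N = contour_integral B (\<lambda>w. G w * K N w / w)" by (simp add: J_def)
      ultimately have "2 * pi * \<i> * (G 0 - S N 0) = IA - IA' + 2 * pi * \<i> * J N"
        unfolding right_diff_distrib eqG[symmetric] eqS[symmetric] by simp
      then have le: "norm (2 * pi * \<i> * (G 0 - S N 0)) \<le> norm IA + norm IA' + norm (2 * pi * \<i> * J N)"
        by (metis norm_triangle_ineq norm_triangle_ineq4 add_mono_thms_linordered_semiring(3) order_trans)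
      \<comment> \<open>The tail bound N^(-x) / x with x = Re z, the factor N^x of K and the
        kernel's 2 x / R^2 multiply to 2 / R^2. The endpoints p and -p, where x = 0, are excluded as
        a finite exceptional set.\<close>
      have IA: "norm IA \<le> 2 / R\<^sup>2 * R * (pi / 2 - - (pi / 2))"
      proof (rule has_contour_integral_bound_part_circlepath_strong[of _ _ 0 R "- (pi / 2)" "pi / 2" "{p, -p}"])
        show "((\<lambda>z. (G z - S N z) * K N z / z) has_contour_integral IA) (part_circlepath 0 R (- (pi / 2)) (pi / 2))"
          unfolding IA_def A_def[symmetric]
          by (intro has_contour_integral_integral intA holomorphic_intros GV S_hol)
        fix z assume "z \<in> path_image (part_circlepath 0 R (- (pi / 2)) (pi / 2)) - {p, - p}"
        then have z: "norm z = R" "Re z > 0" using imA[of z] ends[of z] by (auto simp: A_def less_le)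
        have "norm ((G z - S N z) * K N z / z) = norm (G z - S N z) * real N powr Re z * norm ((1 + z\<^sup>2 / of_real (R\<^sup>2)) / z)"
          by (simp add: K_def norm_mult norm_divide norm_of_nat_powr)
        also have "\<dots> = norm (G z - S N z) * (real N powr Re z * (2 * Re z / R\<^sup>2))"
          using norm_Newman_kernel[OF z(1) R] z by simp
        also have "\<dots> \<le> real N powr (- Re z) / Re z * (real N powr Re z * (2 * Re z / R\<^sup>2))"
          using Dirichlet_tail_bound[OF a z(2) N G[OF z(2)]] z by (intro mult_right_mono) (auto simp: S_def)
        also have "\<dots> = 2 / R\<^sup>2"
          using z N by (simp add: powr_minus field_simps)
        finally show "norm ((G z - S N z) * K N z / z) \<le> 2 / R\<^sup>2" .
      qed (use R in auto)
      \<comment> \<open>The partial sum is estimated absolutely by \<open>sum_powr_le\<close> with x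
        = -Re z. The summand 1 / x of that bound cancels against the kernel, and the summand 1 / N
        leads to the correction R / N.\<close>
      have IA': "norm IA' \<le> 2 / R\<^sup>2 * (1 + R / real N) * R * (3 * pi / 2 - pi / 2)"
      proof (rule has_contour_integral_bound_part_circlepath_strong[of _ _ 0 R "pi / 2" "3 * pi / 2" "{p, -p}"])
        show "((\<lambda>z. S N z * K N z / z) has_contour_integral IA') (part_circlepath 0 R (pi / 2) (3 * pi / 2))"
          unfolding IA'_def A'_def[symmetric] by (intro has_contour_integral_integral intA')
        fix z assume "z \<in> path_image (part_circlepath 0 R (pi / 2) (3 * pi / 2)) - {p, - p}"
        then have z: "norm z = R" "Re z < 0" using imA'[of z] ends[of z] by (auto simp: A'_def less_le)
        define x where "x = - Re z"
        have x: "x > 0" "x \<le> R" using z abs_Re_le_cmod[of z] by (auto simp: x_def)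
        have "norm (S N z) \<le> (\<Sum>n\<le>N. 1 * real n powr (x - 1))"
          unfolding S_def
        proof (rule order_trans[OF norm_sum], rule sum_mono)
          fix n
          have *: "Re (-1 - z) = x - 1" by (simp add: x_def)
          show "norm (a n * of_nat n powr (-1 - z)) \<le> 1 * real n powr (x - 1)"
            unfolding norm_mult norm_of_nat_powr * by (intro mult_right_mono a) auto
        qed
        also have "\<dots> \<le> real N powr x * (1 / real N + 1 / x)" using sum_powr_le[OF x(1)] by simp
        finally have S_le: "norm (S N z) \<le> real N powr x * (1 / real N + 1 / x)" .
        have "norm (S N z * K N z / z) = norm (S N z) * real N powr Re z * norm ((1 + z\<^sup>2 / of_real (R\<^sup>2)) / z)"
          by (simp add: K_def norm_mult norm_divide norm_of_nat_powr)
        also have "\<dots> = norm (S N z) * (real N powr (-x) * (2 * x / R\<^sup>2))"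
          using norm_Newman_kernel[OF z(1) R] z by (simp add: x_def)
        also have "\<dots> \<le> real N powr x * (1 / real N + 1 / x) * (real N powr (-x) * (2 * x / R\<^sup>2))"
          using x by (intro mult_right_mono S_le) auto
        also have "\<dots> = 2 / R\<^sup>2 * (1 + x / real N)"
          using x N by (simp add: powr_minus field_simps)
        also have "\<dots> \<le> 2 / R\<^sup>2 * (1 + R / real N)"
          using x N by (intro mult_left_mono add_left_mono divide_right_mono) auto
        finally show "norm (S N z * K N z / z) \<le> 2 / R\<^sup>2 * (1 + R / real N)" .
      qed (use R in auto)
      have "norm (2 * pi * \<i> * w) = 2 * pi * norm w" for w by (simp add: norm_mult)
      moreover have "norm IA \<le> 2 * pi * (1 / R)"
        using IA R by (simp add: power2_eq_square mult.commute)
      moreover have "norm IA' \<le> 2 * pi * (1 / R + 1 / real N)"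
      proof -
        have p: "3 * pi / 2 - pi / 2 = pi" by simp
        have r: "2 / R\<^sup>2 * R = 2 / R" using R by (simp add: power2_eq_square)
        have n: "(1 + R / real N) / R = 1 / R + 1 / real N" using R by (simp add: add_divide_distrib)
        have "2 / R\<^sup>2 * (1 + R / real N) * R * pi = 2 / R\<^sup>2 * R * (1 + R / real N) * pi"
          by (simp only: mult_ac)
        also have "\<dots> = 2 * pi * ((1 + R / real N) / R)" unfolding r by simp
        finally have "2 / R\<^sup>2 * (1 + R / real N) * R * (3 * pi / 2 - pi / 2) = 2 * pi * (1 / R + 1 / real N)"
          unfolding p n .
        with IA' show ?thesis by simp
      qed
      ultimately have "2 * pi * norm (G 0 - S N 0) \<le> 2 * pi * (1 / R) + 2 * pi * (1 / R + 1 / real N) + 2 * pi * norm (J N)"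
        using le by simp
      also have "\<dots> = 2 * pi * (2 / R + 1 / real N + norm (J N))"
        by (simp add: distrib_left)
      finally show ?thesis using pi_gt_zero by (simp only: mult_le_cancel_left_pos mult_pos_pos zero_less_numeral)
    qed
    show ?thesis using J bound by (intro exI[of _ J] conjI allI impI)
  qed
  have "(\<lambda>N. S N 0) \<longlonglongrightarrow> G 0"
  proof (rule LIMSEQ_I)
    fix e :: real assume e: "e > 0"
    \<comment> \<open>With R = 4 / e, the main error 2 / R is e / 2.\<close>
    obtain J :: "nat \<Rightarrow> complex" where J: "J \<longlonglongrightarrow> 0" "\<And>N. N > 0 \<Longrightarrow> norm (G 0 - S N 0) \<le> 2 / (4 / e) + 1 / real N + norm (J N)"
      using main[of "4 / e"] e by auto
    have "(\<lambda>N. 2 / (4 / e) + 1 / real N + norm (J N)) \<longlonglongrightarrow> 2 / (4 / e) + 0 + norm (0::complex)"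
      by (intro tendsto_intros J lim_1_over_n)
    moreover have "2 / (4 / e) + 0 + norm (0::complex) < e" using e by simp
    ultimately have "\<forall>\<^sub>F N in sequentially. 2 / (4 / e) + 1 / real N + norm (J N) < e"
      by (rule order_tendstoD)
    then have "\<forall>\<^sub>F N in sequentially. norm (S N 0 - G 0) < e"
      using eventually_gt_at_top[of 0]
    proof eventually_elim
      case (elim N)
      then show ?case using J(2)[of N] unfolding norm_minus_commute[of "S N 0"] by linarith
    qed
    then show "\<exists>no. \<forall>n\<ge>no. norm (S n 0 - G 0) < e" by (simp add: eventually_sequentially)
  qed
  moreover have "S N 0 = (\<Sum>n\<le>N. a n / of_nat n)" for N
  proof -
    have "(of_nat n :: complex) powr (-1) = inverse (of_nat n)" for n by (cases "n = 0") (simp_all add: powr_minus)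
    then show ?thesis by (simp add: S_def divide_inverse)
  qed
  ultimately show ?thesis by (simp add: sums_def_le)
qed

section \<open>The harmonic sum over squarefree numbers\<close>

text \<open>Newman's theorem for 1 / \<zeta>(1 + z), written z / \<open>zeta_ext\<close> (1 + z) so
  that it is defined on an open set containing the imaginary axis. Its value at 0 is 0 because of
  the pole of \<zeta> at 1.\<close>

theorem sums_moebius_over_n: "(\<lambda>n. real_of_int (moebius_mu n) / real n) sums 0"
proof -
  let ?a = "\<lambda>n. complex_of_int (moebius_mu n)"
  define U where "U = {z. Re z > -1} \<inter> (\<lambda>z. zeta_ext (1 + z)) -` (- {0})"
  have hol: "(\<lambda>z. zeta_ext (1 + z)) holomorphic_on {z. Re z > -1}"
  proof -
    have "(zeta_ext \<circ> (\<lambda>z. 1 + z)) holomorphic_on {z. Re z > -1}"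
      by (rule holomorphic_on_compose_gen[OF _ zeta_ext_holomorphic]) (auto intro!: holomorphic_intros)
    then show ?thesis by (simp add: o_def)
  qed
  have "(\<lambda>n. ?a n / of_nat n) sums (0 / zeta_ext (1 + 0))"
  proof (rule Newman_Tauberian[where G = "\<lambda>z. z / zeta_ext (1 + z)"])
    show "norm (?a n) \<le> 1" for n
    proof -
      have "norm (?a n) = real_of_int \<bar>moebius_mu n\<bar>" by (simp only: norm_of_int of_int_abs)
      also have "\<dots> \<le> 1" using abs_moebius_mu_le[of n] by linarith
      finally show ?thesis .
    qed
    show "open U" unfolding U_def
      by (intro continuous_open_preimage holomorphic_on_imp_continuous_on hol open_halfspace_Re_gt open_Compl) simp
    show "{z. Re z \<ge> 0} \<subseteq> U" by (auto simp: U_def zeta_ext_nonzero)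
    show "(\<lambda>z. z / zeta_ext (1 + z)) holomorphic_on U"
      by (intro holomorphic_intros holomorphic_on_subset[OF hol]) (auto simp: U_def)
    fix z :: complex assume z: "Re z > 0"
    have "(\<lambda>n. ?a n * of_nat n powr (- (1 + z))) sums inverse (zeta (1 + z))"
      using z by (intro has_sum_imp_sums has_sum_moebius) auto
    moreover have "zeta_ext (1 + z) = z * zeta (1 + z)" using z by (simp add: zeta_ext_eq)
    moreover have "z \<noteq> 0" using z by auto
    moreover have "- (1 + z) = -1 - z" by simp
    ultimately show "(\<lambda>n. ?a n * of_nat n powr (-1 - z)) sums (z / zeta_ext (1 + z))"
      by (simp add: divide_inverse mult.assoc[symmetric])
  qed
  then have "(\<lambda>n. of_real (real_of_int (moebius_mu n) / real n) :: complex) sums of_real 0" by simp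
  then show ?thesis by (subst (asm) sums_of_real_iff)
qed


section \<open>Tails of the sums of \<mu>(d)/d^2 and \<mu>(d) ln d/d^2\<close>

definition moebius_tail :: "nat \<Rightarrow> real" where
  "moebius_tail X = (\<Sum>d. real_of_int (moebius_mu (d + Suc X)) / real (d + Suc X) ^ 2)"

definition moebius_log_tail :: "nat \<Rightarrow> real" where
  "moebius_log_tail X = (\<Sum>d. real_of_int (moebius_mu (d + Suc X)) / real (d + Suc X) ^ 2 * ln (real (d + Suc X)))"

lemma abs_real_moebius_mu_le: "\<bar>real_of_int (moebius_mu n)\<bar> \<le> 1"
  using abs_moebius_mu_le[of n] by linarith

lemma summable_moebius_log:
  "summable (\<lambda>d. real_of_int (moebius_mu d) / real d ^ 2 * ln (real d))"
proof (rule summable_comparison_test')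
  show "summable (\<lambda>d. 2 * real d powr (-3/2))"
    by (intro summable_mult) (simp add: summable_real_powr_iff)
  fix d :: nat assume d: "d \<ge> 1"
  have "ln (real d) \<le> real d powr (1/2) / (1/2)" using d by (intro ln_powr_bound) auto
  then have "\<bar>real_of_int (moebius_mu d)\<bar> * (ln (real d) / real d ^ 2) \<le> 1 * (2 * real d powr (1/2) / real d ^ 2)"
    using d by (intro mult_mono divide_right_mono abs_real_moebius_mu_le) auto
  also have "real d powr (1/2) / real d ^ 2 = real d powr (-3/2)"
    using d by (simp add: powr_diff[symmetric] flip: powr_numeral)
  then have "1 * (2 * real d powr (1/2) / real d ^ 2) = 2 * real d powr (-3/2)" by simp
  finally show "norm (real_of_int (moebius_mu d) / real d ^ 2 * ln (real d)) \<le> 2 * real d powr (-3/2)"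
    using d by (simp add: abs_mult)
qed

lemma sums_moebius_squares: "(\<lambda>d. real_of_int (moebius_mu d) / real d ^ 2) sums (6 / pi\<^sup>2)"
proof -
  have two: "(of_nat n :: complex) powr (-2) = of_real (1 / real n ^ 2)" for n
  proof (cases "n = 0")
    case False
    then have "(of_nat n :: complex) powr (- of_nat 2) = inverse (of_nat n ^ 2)"
      by (subst powr_minus, subst powr_nat') auto
    then show ?thesis by (simp add: inverse_eq_divide)
  qed simp
  have "(\<lambda>n. (of_nat n :: complex) powr (-2)) sums zeta 2"
    using has_sum_imp_sums[OF has_sum_zeta[of 2]] by simp
  then have "(\<lambda>n. (of_nat (Suc n) :: complex) powr (-2)) sums zeta 2"
    by (subst sums_Suc_iff) simp
  then have "(\<lambda>n. of_real (1 / real (Suc n) ^ 2) :: complex) sums zeta 2" by (simp only: two)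
  moreover have "(\<lambda>n. of_real (1 / real (Suc n) ^ 2) :: complex) sums of_real (pi\<^sup>2 / 6)"
    unfolding sums_of_real_iff using inverse_squares_sums by (simp add: add.commute)
  ultimately have z2: "zeta 2 = of_real (pi\<^sup>2 / 6)" by (rule sums_unique2)
  have "(\<lambda>n. of_int (moebius_mu n) * (of_nat n :: complex) powr (-2)) sums inverse (zeta 2)"
    using has_sum_imp_sums[OF has_sum_moebius[of 2]] by simp
  then have "(\<lambda>n. of_real (real_of_int (moebius_mu n) / real n ^ 2) :: complex) sums of_real (6 / pi\<^sup>2)"
    by (simp add: z2 two field_simps)
  then show ?thesis by (subst (asm) sums_of_real_iff)
qed

text \<open>Partial summation with the partial sums s of \<mu>(d)/d and the weights 1/d. The
  boundary term at X gives e/X; the other boundary term and the telescoping sum of weight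
  differences together give another e/X.\<close>

lemma moebius_tail_bound:
  assumes e: "\<And>n. n \<ge> X \<Longrightarrow> \<bar>\<Sum>d\<le>n. real_of_int (moebius_mu d) / real d\<bar> \<le> e" and X: "X > 0"
  shows "\<bar>moebius_tail X\<bar> \<le> 2 * e / real X"
proof -
  define s where "s = (\<lambda>n. \<Sum>d\<le>n. real_of_int (moebius_mu d) / real d)"
  define p where "p = (\<lambda>j. \<Sum>i<j. real_of_int (moebius_mu (i + Suc X)) / real (i + Suc X) ^ 2)"
  define r where "r = (\<lambda>j. \<Sum>i<j. s (i + X) * (1 / real (i + X) - 1 / real (Suc (i + X))))"
  have p_eq: "p j = s (j + X) / real (j + X) - s X / real X + r j" for j
  proof (induction j)
    case (Suc j)
    have "p (Suc j) = p j + real_of_int (moebius_mu (Suc (j + X))) / real (Suc (j + X)) / real (Suc (j + X))"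
      by (simp add: p_def power2_eq_square)
    also have "real_of_int (moebius_mu (Suc (j + X))) / real (Suc (j + X)) = s (Suc (j + X)) - s (j + X)"
      by (simp add: s_def)
    finally show ?case by (simp add: Suc r_def diff_divide_distrib right_diff_distrib)
  qed (simp add: p_def r_def)
  have r_le: "\<bar>r j\<bar> \<le> e * (1 / real X - 1 / real (j + X))" for j
  proof (induction j)
    case (Suc j)
    have "\<bar>s (j + X) * (1 / real (j + X) - 1 / real (Suc (j + X)))\<bar> \<le> e * (1 / real (j + X) - 1 / real (Suc (j + X)))"
      unfolding abs_mult using e[of "j + X"] X by (simp add: s_def mult_mono frac_le)
    moreover have "r (Suc j) = r j + s (j + X) * (1 / real (j + X) - 1 / real (Suc (j + X)))"
      by (simp add: r_def)
    ultimately show ?case using Suc abs_triangle_ineq[of "r j" "s (j + X) * (1 / real (j + X) - 1 / real (Suc (j + X)))"]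
      by (simp add: right_diff_distrib)
  qed (simp add: r_def)
  have "\<bar>p j\<bar> \<le> 2 * e / real X" for j
  proof -
    have "\<bar>s (j + X) / real (j + X)\<bar> \<le> e / real (j + X)" "\<bar>s X / real X\<bar> \<le> e / real X"
      using e[of "j + X"] e[of X] X by (simp_all add: s_def divide_right_mono)
    then have "\<bar>p j\<bar> \<le> e / real (j + X) + e / real X + e * (1 / real X - 1 / real (j + X))"
      using r_le[of j] unfolding p_eq by linarith
    then show ?thesis by (simp add: right_diff_distrib)
  qed
  moreover have "p \<longlonglongrightarrow> moebius_tail X"
  proof -
    have "summable (\<lambda>d. real_of_int (moebius_mu d) / real d ^ 2)" using sums_moebius_squares by (rule sums_summable)
    then have "summable (\<lambda>d. real_of_int (moebius_mu (d + Suc X)) / real (d + Suc X) ^ 2)"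
      by (rule summable_ignore_initial_segment)
    then show ?thesis unfolding p_def moebius_tail_def by (rule summable_LIMSEQ)
  qed
  ultimately show ?thesis by (intro LIMSEQ_le_const2[OF tendsto_rabs]) auto
qed

text \<open>Partial summation against \<open>moebius_tail\<close> with the weights ln d - ln X.
  Subtracting ln X times the tail makes the weights start at 0, so no logarithm is lost. The
  boundary term gives e/X through ln(n/X) \<le> n/X, the sum gives 2e/X through 1/n^2 \<le> 2 (1/n -
  1/(n+1)).\<close>

lemma moebius_log_tail_bound:
  assumes e: "\<And>n. n \<ge> X \<Longrightarrow> \<bar>moebius_tail n\<bar> \<le> e / real n" and X: "X > 0" and e0: "e \<ge> 0"
  shows "\<bar>moebius_log_tail X - ln (real X) * moebius_tail X\<bar> \<le> 3 * e / real X"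
proof -
  define T where "T = moebius_tail"
  define f where "f = (\<lambda>i. real_of_int (moebius_mu (i + Suc X)) / real (i + Suc X) ^ 2)"
  define p where "p = (\<lambda>j. \<Sum>i<j. f i * ln (real (i + Suc X)) - ln (real X) * f i)"
  define r where "r = (\<lambda>j. \<Sum>i<j. T (i + X) * (ln (real (Suc (i + X))) - ln (real (i + X))))"
  have sumf: "summable (\<lambda>d. real_of_int (moebius_mu d) / real d ^ 2)" using sums_moebius_squares by (rule sums_summable)
  have T_step: "T (j + X) - T (Suc (j + X)) = f j" for j
  proof -
    have "summable (\<lambda>d. real_of_int (moebius_mu (d + Suc (j + X))) / real (d + Suc (j + X)) ^ 2)"
      using summable_ignore_initial_segment[OF sumf] .
    from suminf_split_head[OF this] show ?thesis
      by (simp add: T_def moebius_tail_def f_def)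
  qed
  have p_eq: "p j = r j - T (j + X) * (ln (real (j + X)) - ln (real X))" for j
  proof (induction j)
    case (Suc j)
    have "p (Suc j) = p j + (T (j + X) - T (Suc (j + X))) * (ln (real (Suc (j + X))) - ln (real X))"
      unfolding T_step by (simp add: p_def algebra_simps)
    then show ?case unfolding Suc by (simp add: r_def algebra_simps)
  qed (simp add: p_def r_def)
  have r_le: "\<bar>r j\<bar> \<le> 2 * e * (1 / real X - 1 / real (j + X))" for j
  proof (induction j)
    case (Suc j)
    define n where "n = j + X"
    have n: "n > 0" using X by (simp add: n_def)
    have ln: "ln (real (Suc n)) - ln (real n) \<le> 1 / real n"
    proof -
      have "ln (real (Suc n)) - ln (real n) = ln (real (Suc n) / real n)"
        using n by (simp add: ln_div del: of_nat_Suc)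
      also have "real (Suc n) / real n = 1 + 1 / real n" using n by (simp add: field_simps)
      also have "ln \<dots> \<le> 1 / real n" by (rule ln_add_one_self_le_self2, rule less_le_trans[of _ 0]) auto
      finally show ?thesis .
    qed
    have "\<bar>T n * (ln (real (Suc n)) - ln (real n))\<bar> \<le> e / real n * (1 / real n)"
      unfolding abs_mult using e[of n] n ln by (intro mult_mono) (auto simp: T_def n_def e0)
    also have "\<dots> = e * (1 / real n ^ 2)" by (simp add: power2_eq_square)
    also have "\<dots> \<le> e * (2 * (1 / real n - 1 / real (Suc n)))"
    proof (rule mult_left_mono[OF _ e0])
      have "1 / real n - 1 / real (Suc n) = 1 / (real n * (real n + 1))" using n by (simp add: field_simps)
      moreover have "real n * (real n + 1) \<le> 2 * real n ^ 2" using n by (simp add: power2_eq_square distrib_left)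
      then have "2 / (2 * real n ^ 2) \<le> 2 / (real n * (real n + 1))" using n by (intro divide_left_mono) auto
      ultimately show "1 / real n ^ 2 \<le> 2 * (1 / real n - 1 / real (Suc n))" by simp
    qed
    finally have "\<bar>T n * (ln (real (Suc n)) - ln (real n))\<bar> \<le> 2 * e * (1 / real n - 1 / real (Suc n))"
      by (simp only: mult.assoc mult.left_commute)
    moreover have "r (Suc j) = r j + T n * (ln (real (Suc n)) - ln (real n))"
      by (simp add: r_def n_def)
    ultimately show ?case using Suc abs_triangle_ineq[of "r j" "T n * (ln (real (Suc n)) - ln (real n))"]
      by (simp add: right_diff_distrib n_def)
  qed (simp add: r_def)
  have "\<bar>p j\<bar> \<le> 3 * e / real X" for j
  proof -
    define n where "n = j + X"
    have n: "n \<ge> X" by (simp add: n_def)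
    have "ln (real n) - ln (real X) \<le> real n / real X"
      using n X ln_le_minus_one[of "real n / real X"] by (simp add: ln_div)
    moreover have "ln (real n) - ln (real X) \<ge> 0" using n X by simp
    ultimately have "\<bar>T n * (ln (real n) - ln (real X))\<bar> \<le> e / real n * (real n / real X)"
      unfolding abs_mult using e[OF n] e0 by (intro mult_mono) (auto simp: T_def)
    also have "\<dots> = e / real X" using n X by simp
    finally have "\<bar>T n * (ln (real n) - ln (real X))\<bar> \<le> e / real X" .
    moreover have "2 * e * (1 / real X - 1 / real (j + X)) \<le> 2 * e / real X"
      using e0 by (simp add: right_diff_distrib)
    ultimately show ?thesis using r_le[of j] unfolding p_eq n_def by (simp add: add_divide_distrib)
  qed
  moreover have "p \<longlonglongrightarrow> moebius_log_tail X - ln (real X) * moebius_tail X"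
  proof -
    have "summable f" "summable (\<lambda>i. f i * ln (real (i + Suc X)))"
      unfolding f_def
      using summable_ignore_initial_segment[OF sumf, of "Suc X"] summable_ignore_initial_segment[OF summable_moebius_log, of "Suc X"]
      by auto
    then have "(\<lambda>i. f i * ln (real (i + Suc X)) - ln (real X) * f i) sums (moebius_log_tail X - ln (real X) * moebius_tail X)"
      unfolding moebius_tail_def moebius_log_tail_def f_def[symmetric]
      by (intro sums_diff sums_mult summable_sums) (auto simp: f_def)
    then show ?thesis by (simp add: p_def sums_def)
  qed
  ultimately show ?thesis by (intro LIMSEQ_le_const2[OF tendsto_rabs]) auto
qed

lemma moebius_tails_small:
  assumes "e > 0"
  obtains X0 where "X0 > 0" "\<And>X. X \<ge> X0 \<Longrightarrow> \<bar>moebius_tail X\<bar> \<le> e / real X"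
    "\<And>X. X \<ge> X0 \<Longrightarrow> \<bar>moebius_log_tail X - ln (real X) * moebius_tail X\<bar> \<le> e / real X"
proof -
  have "(\<lambda>n. \<Sum>d\<le>n. real_of_int (moebius_mu d) / real d) \<longlonglongrightarrow> 0"
    using sums_moebius_over_n by (simp add: sums_def_le)
  \<comment> \<open>The 6 is 2 * 3: the first partial summation doubles the bound, the second
    triples it.\<close>
  then have "\<forall>\<^sub>F n in sequentially. norm ((\<Sum>d\<le>n. real_of_int (moebius_mu d) / real d) - 0) < e / 6"
    using assms unfolding tendsto_iff dist_norm by (metis zero_less_divide_iff zero_less_numeral)
  then obtain X1 where X1: "\<And>n. n \<ge> X1 \<Longrightarrow> \<bar>\<Sum>d\<le>n. real_of_int (moebius_mu d) / real d\<bar> \<le> e / 6"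
    unfolding eventually_sequentially by (auto intro: less_imp_le)
  define X0 where "X0 = Suc X1"
  have T: "\<bar>moebius_tail X\<bar> \<le> (e / 3) / real X" if "X \<ge> X0" for X
  proof -
    have "X > 0" "\<And>n. n \<ge> X \<Longrightarrow> n \<ge> X1" using that by (auto simp: X0_def)
    with moebius_tail_bound[of X "e / 6"] X1 show ?thesis by simp
  qed
  show thesis
  proof
    show "X0 > 0" by (simp add: X0_def)
    fix X assume X: "X \<ge> X0"
    have "(e / 3) / real X \<le> e / real X" using assms by (intro divide_right_mono) auto
    with T[OF X] show "\<bar>moebius_tail X\<bar> \<le> e / real X" by simp
    show "\<bar>moebius_log_tail X - ln (real X) * moebius_tail X\<bar> \<le> e / real X"
      using moebius_log_tail_bound[of X "e / 3"] T X assms by (simp add: X0_def)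
  qed
qed

section \<open>Hyperbola method\<close>

text \<open>Detect squarefreeness by the sum of \<mu>(d) over squares dividing n, and write n = d^2
  * e. Letting d run up to N is harmless, since for d^2 > N the harmonic sum is empty.\<close>

lemma sum_squarefree_eq:
  "(\<Sum>n\<in>{1..N}. if squarefree n then 1 / real n else 0)
     = (\<Sum>d\<in>{1..N}. real_of_int (moebius_mu d) / real d ^ 2 * harm (N div d\<^sup>2))"
proof -
  have fin: "finite {d. d\<^sup>2 dvd n}" if "n > 0" for n :: nat
  proof -
    have "square_part n > 0" using that by (intro Nat.gr0I) simp
    then show ?thesis unfolding dvd_square_part_iff[symmetric] by (rule finite_divisors_nat)
  qed
  have "(\<Sum>n\<in>{1..N}. if squarefree n then 1 / real n else 0)
      = (\<Sum>n\<in>{1..N}. \<Sum>d | d\<^sup>2 dvd n. real_of_int (moebius_mu d) / real n)"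
  proof (rule sum.cong[OF refl])
    fix n assume "n \<in> {1..N}"
    then have "(\<Sum>d | d\<^sup>2 dvd n. real_of_int (moebius_mu d)) = (if squarefree n then 1 else 0)"
      using sum_moebius_square_divisors[of n] by (simp flip: of_int_sum)
    then show "(if squarefree n then 1 / real n else 0) = (\<Sum>d | d\<^sup>2 dvd n. real_of_int (moebius_mu d) / real n)"
      by (simp flip: sum_divide_distrib)
  qed
  also have "\<dots> = (\<Sum>(n, d)\<in>Sigma {1..N} (\<lambda>n. {d. d\<^sup>2 dvd n}). real_of_int (moebius_mu d) / real n)"
    by (rule sum.Sigma) (auto intro: fin)
  also have "\<dots> = (\<Sum>(d, e)\<in>Sigma {1..N} (\<lambda>d. {1..N div d\<^sup>2}). real_of_int (moebius_mu d) / real d ^ 2 * inverse (real e))"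
  proof (rule sum.reindex_bij_witness[of _ "\<lambda>(d, e). (d\<^sup>2 * e, d)" "\<lambda>(n, d). (d, n div d\<^sup>2)"], goal_cases)
    case (2 p)
    then obtain n d where p: "p = (n, d)" "1 \<le> n" "n \<le> N" "d\<^sup>2 dvd n" by auto
    then have d: "d > 0" by (auto intro!: Nat.gr0I)
    have "d \<le> d\<^sup>2" by (simp add: power2_eq_square)
    also have "d\<^sup>2 \<le> n" using p by (simp add: dvd_imp_le)
    finally have "d \<le> N" using p by simp
    then show ?case using p d by (auto simp: div_le_mono dvd_imp_le div_greater_zero_iff Suc_le_eq)
  next
    case (4 p)
    then obtain d e where p: "p = (d, e)" "1 \<le> d" "d \<le> N" "1 \<le> e" "e \<le> N div d\<^sup>2" by auto
    then have "e * d\<^sup>2 \<le> N" by (simp add: less_eq_div_iff_mult_less_eq)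
    then show ?case using p by (auto simp: mult.commute)
  next
    case (5 p)
    then obtain n d where p: "p = (n, d)" "1 \<le> n" "n \<le> N" "d\<^sup>2 dvd n" by auto
    then have "d > 0" by (auto intro!: Nat.gr0I)
    with p show ?case by (auto elim!: dvdE simp: field_simps)
  qed auto
  also have "\<dots> = (\<Sum>d\<in>{1..N}. \<Sum>e\<in>{1..N div d\<^sup>2}. real_of_int (moebius_mu d) / real d ^ 2 * inverse (real e))"
    by (rule sum.Sigma[symmetric]) auto
  finally show ?thesis by (simp add: harm_def sum_distrib_left)
qed

lemma moebius_tail_diff:
  assumes "X \<le> Y"
  shows "(\<Sum>d\<in>{X<..Y}. real_of_int (moebius_mu d) / real d ^ 2) = moebius_tail X - moebius_tail Y"
  using assms
proof (induction Y rule: dec_induct)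
  case (step Y)
  have "summable (\<lambda>d. real_of_int (moebius_mu (d + Suc Y)) / real (d + Suc Y) ^ 2)"
    using summable_ignore_initial_segment[OF sums_summable[OF sums_moebius_squares]] .
  from suminf_split_head[OF this]
  have "moebius_tail Y - moebius_tail (Suc Y) = real_of_int (moebius_mu (Suc Y)) / real (Suc Y) ^ 2"
    by (simp add: moebius_tail_def)
  moreover have "{X<..Suc Y} = insert (Suc Y) {X<..Y}" using step by auto
  ultimately show ?case using step by simp
qed simp

lemma sum_moebius_initial:
  "(\<Sum>d\<in>{1..X}. real_of_int (moebius_mu d) / real d ^ 2) = 6 / pi\<^sup>2 - moebius_tail X"
proof -
  have "(\<Sum>d<Suc X. real_of_int (moebius_mu d) / real d ^ 2) = 6 / pi\<^sup>2 - moebius_tail X"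
    using suminf_split_initial_segment[OF sums_summable[OF sums_moebius_squares], of "Suc X"]
      sums_unique[OF sums_moebius_squares] by (simp add: moebius_tail_def)
  then show ?thesis by (simp only: lessThan_Suc_atMost atMost_atLeast0) (simp add: sum.atLeast_Suc_atMost)
qed

lemma sum_moebius_log_initial:
  "(\<Sum>d\<in>{1..X}. real_of_int (moebius_mu d) / real d ^ 2 * ln (real d))
     = (\<Sum>d. real_of_int (moebius_mu d) / real d ^ 2 * ln (real d)) - moebius_log_tail X"
proof -
  have "(\<Sum>d<Suc X. real_of_int (moebius_mu d) / real d ^ 2 * ln (real d))
      = (\<Sum>d. real_of_int (moebius_mu d) / real d ^ 2 * ln (real d)) - moebius_log_tail X"
    using suminf_split_initial_segment[OF summable_moebius_log, of "Suc X"]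
    by (simp add: moebius_log_tail_def)
  then show ?thesis by (simp only: lessThan_Suc_atMost atMost_atLeast0) (simp add: sum.atLeast_Suc_atMost)
qed

text \<open>With m = N div q and y = N/q, both \<open>harm m\<close> minus Euler's constant and ln y
  lie between ln m and ln(m + 1), an interval of length at most 1/m. This is at most 2/y because y <
  m + 1 \<le> 2 m.\<close>

lemma harm_div_approx:
  assumes q: "0 < q" "q \<le> N"
  shows "\<bar>harm (N div q) - (ln (real N / real q) + euler_mascheroni)\<bar> \<le> 2 * real q / real N"
proof -
  define m where "m = N div q"
  define y where "y = real N / real q"
  have m: "m > 0" using q by (simp add: m_def div_greater_zero_iff)
  have "m * q \<le> N" "N < Suc m * q"
    using q by (simp_all add: m_def dividend_less_times_div mult.commute)
  then have "real (m * q) \<le> real N" "real N < real (Suc m * q)" by (simp_all only: of_nat_le_iff of_nat_less_iff)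
  then have my: "real m \<le> y" "y < real m + 1" using q by (simp_all add: y_def field_simps)
  have lower: "ln (real m) + euler_mascheroni \<le> harm m"
  proof -
    obtain k where k: "m = Suc k" using m by (cases m) auto
    have "euler_mascheroni \<le> harm (Suc k) - ln (real (Suc k))"
      by (rule decseq_ge[OF decseq_harm_diff_ln LIMSEQ_Suc[OF euler_mascheroni_LIMSEQ]])
    then show ?thesis by (simp add: k)
  qed
  have upper: "harm m \<le> ln (real m + 1) + euler_mascheroni"
  proof -
    obtain k where k: "m = Suc k" using m by (cases m) auto
    have "0 \<le> 1 / real (2 * (k + 2))" by simp
    then have "harm (Suc k) - ln (real (k + 2)) \<le> euler_mascheroni" using euler_mascheroni_lower[of k] by linarith
    then show ?thesis by (simp add: k add.commute)
  qed
  have "ln (real m + 1) - ln (real m) \<le> 1 / real m"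
  proof -
    have "ln (real m + 1) - ln (real m) = ln ((real m + 1) / real m)"
      using m by (subst ln_div) auto
    also have "(real m + 1) / real m = 1 + 1 / real m" using m by (simp add: field_simps)
    also have "ln \<dots> \<le> 1 / real m" by (rule ln_add_one_self_le_self2, rule less_le_trans[of _ 0]) auto
    finally show ?thesis .
  qed
  moreover have "ln (real m) \<le> ln y" "ln y \<le> ln (real m + 1)" using my m by auto
  ultimately have "\<bar>harm m - (ln y + euler_mascheroni)\<bar> \<le> 1 / real m" using lower upper by linarith
  also have "\<dots> \<le> 2 / y"
  proof -
    have "y \<le> 2 * real m" using my m by linarith
    then have "2 / (2 * real m) \<le> 2 / y" using my m by (intro divide_left_mono) auto
    then show ?thesis by simp
  qed
  finally show ?thesis by (simp add: y_def m_def)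
qed

text \<open>Dirichlet's hyperbola method: for \<open>d > X\<close> the order of summation is interchanged, so that only the
  tails of \<open>\<Sum>\<mu>(d)/d\<^sup>2\<close> enter.\<close>

lemma squarefree_sum_error:
  assumes X: "X > 0" "X\<^sup>2 \<le> N" and e: "e \<ge> 0"
    and T: "\<And>Y. Y \<ge> X \<Longrightarrow> \<bar>moebius_tail Y\<bar> \<le> e / real Y"
    and TL: "\<bar>moebius_log_tail X - ln (real X) * moebius_tail X\<bar> \<le> e / real X"
  shows "\<bar>(\<Sum>n\<in>{1..N}. if squarefree n then 1 / real n else 0) - (6 / pi\<^sup>2 * ln (real N)
      + (6 / pi\<^sup>2 * euler_mascheroni - 2 * (\<Sum>d. real_of_int (moebius_mu d) / real d ^ 2 * ln (real d))))\<bar>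
    \<le> 2 * real X / real N + e / real X * (ln (real N / real X ^ 2) + euler_mascheroni + 2 + 2 * (real N / real (Suc X) ^ 2))"
proof -
  define c where "c = (\<lambda>d. real_of_int (moebius_mu d) / real d ^ 2)"
  define \<gamma> where "\<gamma> = (euler_mascheroni :: real)"
  \<comment> \<open>The largest cofactor k for which some d > X satisfies k * d^2 \<le> N.\<close>
  define M where "M = N div (Suc X)\<^sup>2"
  define l where "l = (\<Sum>d. real_of_int (moebius_mu d) / real d ^ 2 * ln (real d))"
  have "X \<le> X\<^sup>2" by (simp add: power2_eq_square)
  then have XN: "X \<le> N" and N: "N > 0" using X by auto
  have abs_c: "\<bar>c d\<bar> \<le> 1 / real d ^ 2" for d
    unfolding c_def abs_divide using abs_real_moebius_mu_le[of d] by (simp add: divide_right_mono)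
  define E where "E = (\<Sum>d\<in>{1..X}. c d * (harm (N div d\<^sup>2) - (ln (real N / real (d\<^sup>2)) + \<gamma>)))"
  have E: "\<bar>E\<bar> \<le> 2 * real X / real N"
  proof -
    have "\<bar>E\<bar> \<le> (\<Sum>d\<in>{1..X}. 2 / real N)"
      unfolding E_def
    proof (rule order_trans[OF sum_abs], rule sum_mono)
      fix d assume d: "d \<in> {1..X}"
      have "d\<^sup>2 \<le> X\<^sup>2" using d by (intro power_mono) auto
      from this X(2) have "d\<^sup>2 \<le> N" by (rule le_trans)
      then have "\<bar>harm (N div d\<^sup>2) - (ln (real N / real (d\<^sup>2)) + \<gamma>)\<bar> \<le> 2 * real (d\<^sup>2) / real N"
        unfolding \<gamma>_def using d X by (intro harm_div_approx) auto
      then have "\<bar>c d * (harm (N div d\<^sup>2) - (ln (real N / real (d\<^sup>2)) + \<gamma>))\<bar> \<le> 1 / real d ^ 2 * (2 * real (d\<^sup>2) / real N)"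
        unfolding abs_mult using abs_c[of d] by (intro mult_mono) auto
      also have "\<dots> = 2 / real N" using d by simp
      finally show "\<bar>c d * (harm (N div d\<^sup>2) - (ln (real N / real (d\<^sup>2)) + \<gamma>))\<bar> \<le> 2 / real N" .
    qed
    then show ?thesis by (simp add: mult.commute)
  qed
  have first: "(\<Sum>d\<in>{1..X}. c d * harm (N div d\<^sup>2))
      = (ln (real N) + \<gamma>) * (6 / pi\<^sup>2 - moebius_tail X) - 2 * (l - moebius_log_tail X) + E"
  proof -
    have "(\<Sum>d\<in>{1..X}. c d * harm (N div d\<^sup>2)) = (\<Sum>d\<in>{1..X}. c d * (ln (real N / real (d\<^sup>2)) + \<gamma>)) + E"
      unfolding E_def sum.distrib[symmetric] by (simp add: algebra_simps)
    also have "(\<Sum>d\<in>{1..X}. c d * (ln (real N / real (d\<^sup>2)) + \<gamma>)) = (\<Sum>d\<in>{1..X}. (ln (real N) + \<gamma>) * c d - 2 * (c d * ln (real d)))"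
    proof (rule sum.cong[OF refl])
      fix d assume "d \<in> {1..X}"
      then have eq: "ln (real N / real (d\<^sup>2)) = ln (real N) - 2 * ln (real d)"
        using N by (simp add: ln_div ln_realpow)
      show "c d * (ln (real N / real (d\<^sup>2)) + \<gamma>) = (ln (real N) + \<gamma>) * c d - 2 * (c d * ln (real d))"
        unfolding eq by (simp add: algebra_simps)
    qed
    also have "\<dots> = (ln (real N) + \<gamma>) * (6 / pi\<^sup>2 - moebius_tail X) - 2 * (l - moebius_log_tail X)"
      unfolding sum_subtractf sum_distrib_left[symmetric] c_def sum_moebius_initial sum_moebius_log_initial l_def ..
    finally show ?thesis .
  qed
  \<comment> \<open>For a fixed cofactor k, the condition k * d^2 \<le> N means d \<le> Y k, so the
    inner sum over d is a difference of two tails.\<close>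
  define Y where "Y = (\<lambda>e. floor_sqrt (N div e))"
  define F where "F = (\<Sum>d\<in>{X<..N}. c d * harm (N div d\<^sup>2))"
  have Y_ge: "X \<le> Y k" if "k \<in> {1..M}" for k
  proof -
    have k: "k > 0" "k * (Suc X)\<^sup>2 \<le> N"
      using that unfolding M_def by (simp_all add: less_eq_div_iff_mult_less_eq)
    have "X\<^sup>2 \<le> (Suc X)\<^sup>2" by (intro power_mono) auto
    then have "X\<^sup>2 * k \<le> N" using k by (metis mult.commute mult_le_mono2 order_trans)
    then show ?thesis unfolding Y_def using k by (simp add: le_floor_sqrt_iff less_eq_div_iff_mult_less_eq)
  qed
  have F_eq: "F = (\<Sum>k\<in>{1..M}. inverse (real k) * (moebius_tail X - moebius_tail (Y k)))"
  proof -
    have mem: "d \<in> {X<..N} \<and> k \<in> {1..N div d\<^sup>2} \<longleftrightarrow> k \<in> {1..M} \<and> d \<in> {X<..Y k}" for d k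
    proof (cases "d > X \<and> k \<ge> 1")
      case True
      then have d: "d > 0" and k: "k > 0" using X by auto
      have "d \<le> Y k \<longleftrightarrow> k * d\<^sup>2 \<le> N" using k
        by (simp add: Y_def le_floor_sqrt_iff less_eq_div_iff_mult_less_eq mult.commute)
      moreover have "k \<le> N div d\<^sup>2 \<longleftrightarrow> k * d\<^sup>2 \<le> N" using d by (simp add: less_eq_div_iff_mult_less_eq)
      moreover have "k \<le> M" "d \<le> N" if "k * d\<^sup>2 \<le> N"
      proof -
        have "(Suc X)\<^sup>2 \<le> d\<^sup>2" using True by (intro power_mono) auto
        then have "k * (Suc X)\<^sup>2 \<le> N" using that by (meson mult_le_mono2 order_trans)
        then show "k \<le> M" unfolding M_def by (subst less_eq_div_iff_mult_less_eq) auto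
        have "d \<le> k * d\<^sup>2" using d k by (simp add: power2_eq_square)
        then show "d \<le> N" using that by simp
      qed
      ultimately show ?thesis using True by auto
    qed auto
    have mem1: "k \<in> {1..M}" "d \<in> {X<..Y k}" if "d \<in> {X<..N}" "k \<in> {1..N div d\<^sup>2}" for d k
      using mem[of d k] that by blast+
    have mem2: "d \<in> {X<..N}" "k \<in> {1..N div d\<^sup>2}" if "k \<in> {1..M}" "d \<in> {X<..Y k}" for d k
      using mem[of d k] that by blast+
    have "F = (\<Sum>d\<in>{X<..N}. \<Sum>k\<in>{1..N div d\<^sup>2}. inverse (real k) * c d)"
      by (simp add: F_def harm_def sum_distrib_left mult.commute)
    also have "\<dots> = (\<Sum>(d, k)\<in>Sigma {X<..N} (\<lambda>d. {1..N div d\<^sup>2}). inverse (real k) * c d)"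
      by (rule sum.Sigma) auto
    also have "\<dots> = (\<Sum>(k, d)\<in>Sigma {1..M} (\<lambda>k. {X<..Y k}). inverse (real k) * c d)"
      by (rule sum.reindex_bij_witness[of _ prod.swap prod.swap]) (auto simp del: atLeastAtMost_iff greaterThanAtMost_iff One_nat_def intro: mem1 mem2)
    also have "\<dots> = (\<Sum>k\<in>{1..M}. \<Sum>d\<in>{X<..Y k}. inverse (real k) * c d)"
      by (rule sum.Sigma[symmetric]) auto
    also have "\<dots> = (\<Sum>k\<in>{1..M}. inverse (real k) * (moebius_tail X - moebius_tail (Y k)))"
      unfolding sum_distrib_left[symmetric] c_def
      by (intro sum.cong refl arg_cong2[where f = "(*)"] moebius_tail_diff Y_ge)
    finally show "F = (\<Sum>k\<in>{1..M}. inverse (real k) * (moebius_tail X - moebius_tail (Y k)))" .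
  qed
  have F: "\<bar>F\<bar> \<le> 2 * (real N / real (Suc X) ^ 2) * (e / real X)"
  proof -
    have "\<bar>F\<bar> \<le> (\<Sum>k\<in>{1..M}. 2 * (e / real X))"
      unfolding F_eq
    proof (rule order_trans[OF sum_abs], rule sum_mono)
      fix k assume k: "k \<in> {1..M}"
      have "e / real (Y k) \<le> e / real X" using Y_ge[OF k] X e by (intro divide_left_mono) auto
      then have "\<bar>moebius_tail X - moebius_tail (Y k)\<bar> \<le> 2 * (e / real X)"
        using T[of X] T[of "Y k"] Y_ge[OF k] by simp
      then have "\<bar>inverse (real k) * (moebius_tail X - moebius_tail (Y k))\<bar> \<le> 1 * (2 * (e / real X))"
        unfolding abs_mult using k by (intro mult_mono) (auto simp: inverse_le_1_iff)
      then show "\<bar>inverse (real k) * (moebius_tail X - moebius_tail (Y k))\<bar> \<le> 2 * (e / real X)" by simp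
    qed
    also have "\<dots> = 2 * real M * (e / real X)" by simp
    also have "real M \<le> real N / real (Suc X) ^ 2"
      unfolding M_def by (metis of_nat_div_le_of_nat of_nat_power)
    then have "2 * real M * (e / real X) \<le> 2 * (real N / real (Suc X) ^ 2) * (e / real X)"
      using e by (intro mult_right_mono mult_left_mono) auto
    finally show ?thesis .
  qed
  have "(\<Sum>n\<in>{1..N}. if squarefree n then 1 / real n else 0) = (\<Sum>d\<in>{1..X} \<union> {X<..N}. c d * harm (N div d\<^sup>2))"
    unfolding sum_squarefree_eq c_def using XN by (intro sum.cong) auto
  also have "\<dots> = (\<Sum>d\<in>{1..X}. c d * harm (N div d\<^sup>2)) + F"
    unfolding F_def by (rule sum.union_disjoint) auto
  finally have A: "(\<Sum>n\<in>{1..N}. if squarefree n then 1 / real n else 0)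
      = (ln (real N) + \<gamma>) * (6 / pi\<^sup>2 - moebius_tail X) - 2 * (l - moebius_log_tail X) + E + F"
    unfolding first .
  \<comment> \<open>With ln N split in this way, the ln X part of the tail term combines with
    \<open>moebius_log_tail X\<close> to the difference controlled by TL, and the remaining
    logarithm is bounded when X has order sqrt N.\<close>
  have lnN: "ln (real N) = ln (real N / real X ^ 2) + 2 * ln (real X)"
    using N X by (simp add: ln_div ln_realpow)
  have "real X ^ 2 \<le> real N" using X(2) by (simp flip: of_nat_power)
  then have ln_pos: "ln (real N / real X ^ 2) \<ge> 0" using X by simp
  have split: "(\<Sum>n\<in>{1..N}. if squarefree n then 1 / real n else 0) - (6 / pi\<^sup>2 * ln (real N) + (6 / pi\<^sup>2 * \<gamma> - 2 * l))
      = E + F - (ln (real N / real X ^ 2) + \<gamma>) * moebius_tail X + 2 * (moebius_log_tail X - ln (real X) * moebius_tail X)"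
    unfolding A lnN by (simp add: algebra_simps)
  have aux: "\<bar>L\<bar> \<le> a + b + c + 2 * d"
    if "L = E' + F' - P + 2 * W" "\<bar>P\<bar> \<le> c" "\<bar>E'\<bar> \<le> a" "\<bar>F'\<bar> \<le> b" "\<bar>W\<bar> \<le> d" for L E' F' P W a b c d :: real
    using that by linarith
  have P: "\<bar>(ln (real N / real X ^ 2) + \<gamma>) * moebius_tail X\<bar> \<le> (ln (real N / real X ^ 2) + \<gamma>) * (e / real X)"
    unfolding abs_mult using ln_pos T[of X] euler_mascheroni_pos by (intro mult_mono) (auto simp: \<gamma>_def)
  have "\<bar>(\<Sum>n\<in>{1..N}. if squarefree n then 1 / real n else 0) - (6 / pi\<^sup>2 * ln (real N) + (6 / pi\<^sup>2 * \<gamma> - 2 * l))\<bar>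
      \<le> 2 * real X / real N + 2 * (real N / real (Suc X) ^ 2) * (e / real X) + (ln (real N / real X ^ 2) + \<gamma>) * (e / real X) + 2 * (e / real X)"
    by (rule aux[OF split P E F TL])
  also have "\<dots> = 2 * real X / real N + e / real X * (ln (real N / real X ^ 2) + \<gamma> + 2 + 2 * (real N / real (Suc X) ^ 2))"
    by (simp add: algebra_simps)
  finally show ?thesis by (simp add: \<gamma>_def l_def)
qed

text \<open>Take X = floor (\<delta> sqrt N). The terms up to X cost at most 2 \<delta> / sqrt N.
  Since N / X^2 stays bounded in terms of \<delta>, the tails cost a constant depending on \<delta>
  times e / sqrt N, and e can be chosen after \<delta>.\<close>

theorem squarefree_harmonic_sum:
  obtains C where "(\<lambda>N. (\<Sum>n\<in>{1..N}. if squarefree n then 1 / real n else 0) - (6 / pi\<^sup>2 * ln (real N) + C))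
    \<in> o(\<lambda>N. real N powr (- 1 / 2))"
proof
  define C where "C = 6 / pi\<^sup>2 * euler_mascheroni - 2 * (\<Sum>d. real_of_int (moebius_mu d) / real d ^ 2 * ln (real d))"
  define R where "R = (\<lambda>N. (\<Sum>n\<in>{1..N}. if squarefree n then 1 / real n else 0) - (6 / pi\<^sup>2 * ln (real N) + C))"
  show "R \<in> o(\<lambda>N. real N powr (- 1 / 2))"
  proof (rule landau_o.smallI)
    fix \<eta> :: real assume \<eta>: "\<eta> > 0"
    define \<delta> where "\<delta> = min 1 \<eta> / 3"
    have \<delta>: "\<delta> > 0" "\<delta> \<le> 1" "3 * \<delta> \<le> \<eta>" using \<eta> by (auto simp: \<delta>_def min_def)
    \<comment> \<open>Bounds the bracket in \<open>squarefree_sum_error\<close>: eventually X is at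
      least half of \<delta> sqrt N, so N / X^2 \<le> 4 / \<delta>^2, while X + 1 exceeds \<delta>
      sqrt N.\<close>
    define K where "K = ln (4 / \<delta>\<^sup>2) + euler_mascheroni + 2 + 2 / \<delta>\<^sup>2"
    have "ln (4 / \<delta>\<^sup>2) \<ge> 0" using \<delta> power_le_one[of \<delta> 2] by simp
    then have K: "K > 0" using euler_mascheroni_pos unfolding K_def by (intro add_nonneg_pos add_pos_nonneg) auto
    \<comment> \<open>Chosen so that the tails contribute exactly \<delta> / sqrt N; together with 2
      \<delta> / sqrt N this is at most \<eta> / sqrt N.\<close>
    define e where "e = \<delta>\<^sup>2 / (2 * K)"
    have e: "e > 0" using \<delta> K by (simp add: e_def)
    from moebius_tails_small[OF e] obtain X0 where X0: "X0 > 0" "\<And>X. X \<ge> X0 \<Longrightarrow> \<bar>moebius_tail X\<bar> \<le> e / real X"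
      "\<And>X. X \<ge> X0 \<Longrightarrow> \<bar>moebius_log_tail X - ln (real X) * moebius_tail X\<bar> \<le> e / real X" by blast
    have "filterlim (\<lambda>N. \<delta> * sqrt (real N)) at_top sequentially"
      by (intro filterlim_tendsto_pos_mult_at_top[OF tendsto_const] \<delta> filterlim_compose[OF sqrt_at_top filterlim_real_sequentially])
    then have "\<forall>\<^sub>F N in sequentially. real X0 \<le> \<delta> * sqrt (real N)" by (simp add: filterlim_at_top)
    then show "\<forall>\<^sub>F N in sequentially. norm (R N) \<le> \<eta> * norm (real N powr (- 1 / 2))"
    proof eventually_elim
      fix N assume N: "real X0 \<le> \<delta> * sqrt (real N)"
      define r where "r = sqrt (real N)"
      define X where "X = nat \<lfloor>\<delta> * r\<rfloor>"
      have "\<delta> * r > 0" using N X0(1) by (simp add: r_def)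
      then have r: "r > 0" using \<delta> by (simp add: zero_less_mult_iff)
      have Nr: "real N = r ^ 2" by (simp add: r_def)
      have floor: "real X = of_int \<lfloor>\<delta> * r\<rfloor>" using \<open>\<delta> * r > 0\<close> by (simp add: X_def)
      have X: "X \<ge> X0" "real X \<le> \<delta> * r"
        using N floor by (simp_all add: X_def r_def le_nat_floor)
      have X3: "\<delta> * r < real (Suc X)" using floor by linarith
      have X1: "X > 0" using X(1) X0(1) by simp
      have "real X \<le> r" using X(2) \<delta> r by (meson mult_left_le_one_le order_trans less_imp_le)
      then have "real X ^ 2 \<le> r ^ 2" by (intro power_mono) auto
      then have XN: "X\<^sup>2 \<le> N" unfolding Nr[symmetric] by (simp flip: of_nat_power)
      have X2: "\<delta> * r \<le> 2 * real X" using X3 X1 by simp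
      have "1 / real X \<le> 2 / (\<delta> * r)"
      proof -
        have "2 / (2 * real X) \<le> 2 / (\<delta> * r)" using X2 X1 \<open>\<delta> * r > 0\<close> by (intro divide_left_mono) auto
        then show ?thesis by simp
      qed
      then have "e * (1 / real X) \<le> e * (2 / (\<delta> * r))" using e by (intro mult_left_mono) auto
      then have eX: "e / real X \<le> 2 * e / (\<delta> * r)" by (simp add: mult.commute)
      have b1: "real N / real (Suc X) ^ 2 \<le> 1 / \<delta>\<^sup>2"
      proof -
        have "(\<delta> * r) ^ 2 \<le> real (Suc X) ^ 2" using X3 \<open>\<delta> * r > 0\<close> by (intro power_mono) auto
        then have "real N / real (Suc X) ^ 2 \<le> r ^ 2 / (\<delta> * r) ^ 2"
          unfolding Nr using \<delta> r by (intro divide_left_mono mult_pos_pos zero_less_power) auto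
        then show ?thesis using r by (simp add: power_mult_distrib)
      qed
      have b2: "real N / real X ^ 2 \<le> 4 / \<delta>\<^sup>2"
      proof -
        have "(\<delta> * r) ^ 2 \<le> (2 * real X) ^ 2" using X2 \<open>\<delta> * r > 0\<close> by (intro power_mono) auto
        then have "4 * r ^ 2 / (2 * real X) ^ 2 \<le> 4 * r ^ 2 / (\<delta> * r) ^ 2"
          using \<delta> r X1 by (intro divide_left_mono mult_pos_pos zero_less_power) auto
        then show ?thesis unfolding Nr using r by (simp add: power_mult_distrib)
      qed
      have "real N / real X ^ 2 > 0" using r X1 by (simp add: Nr)
      then have b3: "ln (real N / real X ^ 2) \<le> ln (4 / \<delta>\<^sup>2)" using b2 by (simp only: ln_mono)
      have "real N / real X ^ 2 \<ge> 1" using \<open>real X ^ 2 \<le> r ^ 2\<close> X1 by (simp add: Nr)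
      then have "ln (real N / real X ^ 2) \<ge> 0" by simp
      then have nn: "0 \<le> ln (real N / real X ^ 2) + euler_mascheroni + 2 + 2 * (real N / real (Suc X) ^ 2)"
        using euler_mascheroni_pos by (intro add_nonneg_nonneg) auto
      have "\<bar>R N\<bar> \<le> 2 * real X / real N + e / real X * (ln (real N / real X ^ 2) + euler_mascheroni + 2 + 2 * (real N / real (Suc X) ^ 2))"
        unfolding R_def C_def using X X0 XN X1 e by (intro squarefree_sum_error) auto
      also have "\<dots> \<le> 2 * \<delta> / r + 2 * e / (\<delta> * r) * K"
      proof (intro add_mono mult_mono)
        show "2 * real X / real N \<le> 2 * \<delta> / r"
          using X(2) r unfolding Nr by (simp add: field_simps power2_eq_square)
        show "ln (real N / real X ^ 2) + euler_mascheroni + 2 + 2 * (real N / real (Suc X) ^ 2) \<le> K"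
          unfolding K_def using b1 b3 by simp
      qed (use eX nn e \<delta> r in auto)
      also have "2 * e / (\<delta> * r) * K = \<delta> / r"
        using K \<delta> r by (simp add: e_def field_simps power2_eq_square)
      also have "2 * \<delta> / r + \<delta> / r = 3 * \<delta> * (1 / r)" by (simp add: add_divide_distrib[symmetric])
      also have "\<dots> \<le> \<eta> * (1 / r)" using \<delta> r by (intro mult_right_mono) auto
      also have "1 / r = real N powr (- 1 / 2)"
        using r by (simp add: r_def powr_minus powr_half_sqrt[symmetric] inverse_eq_divide)
      finally show "norm (R N) \<le> \<eta> * norm (real N powr (- 1 / 2))" by simp
    qed
  qed
qed

section \<open>The part of \<open>2 ^ n - 1\<close> prime to \<open>S\<close>\<close>

text \<open>For m > 0 and a set S of primes, q is m times |m|_S; with m = 2^n - 1 it turns out to be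
  the number of fixed points of the n-th iterate.\<close>

definition S_free_decomp :: "nat set \<Rightarrow> nat \<Rightarrow> nat \<Rightarrow> nat \<Rightarrow> bool" where
  "S_free_decomp S m q b \<longleftrightarrow> m = q * b \<and> (\<forall>p. prime p \<longrightarrow> p dvd q \<longrightarrow> p \<notin> S) \<and> (\<forall>p. prime p \<longrightarrow> p dvd b \<longrightarrow> p \<in> S)"

lemma S_free_decomp_exists:
  assumes "m > 0"
  shows "\<exists>q b. S_free_decomp S m q b"
  using assms
proof (induction m rule: less_induct)
  case (less m)
  show ?case
  proof (cases "\<exists>p. prime p \<and> p \<in> S \<and> p dvd m")
    case True
    then obtain p m' where p: "prime p" "p \<in> S" "m = p * m'" by blast
    have "m' < m" "m' > 0" using p less.prems prime_gt_1_nat[of p] by auto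
    then obtain q b where "S_free_decomp S m' q b" using less.IH by blast
    then have "S_free_decomp S m q (p * b)"
      using p by (auto simp: S_free_decomp_def prime_dvd_mult_iff dest: primes_dvd_imp_eq)
    then show ?thesis by blast
  next
    case False
    then have "S_free_decomp S m m 1" by (auto simp: S_free_decomp_def)
    then show ?thesis by blast
  qed
qed

lemma coprime_int_nat_primeI:
  assumes "\<And>p. prime p \<Longrightarrow> p dvd q \<Longrightarrow> \<not> int p dvd y"
  shows "coprime (int q) y"
proof (rule ccontr)
  define g where "g = nat (gcd (int q) y)"
  have g: "int g = gcd (int q) y" by (simp add: g_def)
  assume "\<not> coprime (int q) y"
  then have "g \<noteq> 1" using g by (metis coprime_iff_gcd_eq_1 of_nat_1)
  then obtain p where p: "prime p" "p dvd g" using prime_factor_nat by blast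
  then have "int p dvd gcd (int q) y" unfolding g[symmetric] by simp
  then have "p dvd q" "int p dvd y" by auto
  with p assms show False by blast
qed

section \<open>Arithmetic of 2^n - 1\<close>

lemma power_cong_linear:
  fixes x :: int
  shows "[x ^ j = 1 + int j * (x - 1)] (mod (x - 1)\<^sup>2)"
proof (induction j)
  case (Suc j)
  have "[x ^ j * x = (1 + int j * (x - 1)) * x] (mod (x - 1)\<^sup>2)"
    using Suc by (rule cong_mult) simp
  moreover have "(1 + int j * (x - 1)) * x = (1 + int (Suc j) * (x - 1)) + int j * (x - 1)\<^sup>2"
    by (simp add: algebra_simps power2_eq_square)
  moreover have "[(1 + int (Suc j) * (x - 1)) + int j * (x - 1)\<^sup>2 = 1 + int (Suc j) * (x - 1)] (mod (x - 1)\<^sup>2)"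
    by (simp add: cong_def)
  ultimately show ?case by (metis cong_trans mult.commute power_Suc)
qed simp

text \<open>A case of lifting the exponent: for a prime l it says that l divides the sum exactly
  once. To first order in x - 1 the sum is l + (x - 1) times l (l - 1) / 2, and oddness of l makes l
  (l - 1) / 2 a multiple of l.\<close>

lemma geometric_sum_cong_prime:
  fixes x :: int and l :: nat
  assumes l: "odd l" and x: "int l dvd x - 1"
  shows "[(\<Sum>j<l. x ^ j) = int l] (mod (int l)\<^sup>2)"
proof -
  have "(int l)\<^sup>2 dvd (x - 1)\<^sup>2" using x by (rule dvd_power_same)
  then have "[x ^ j = 1 + int j * (x - 1)] (mod (int l)\<^sup>2)" for j
    using power_cong_linear[of x j] cong_dvd_modulus by blast
  then have "[(\<Sum>j<l. x ^ j) = (\<Sum>j<l. 1 + int j * (x - 1))] (mod (int l)\<^sup>2)"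
    by (rule cong_sum)
  also have "(\<Sum>j<l. 1 + int j * (x - 1)) = int l + (\<Sum>j<l. int j) * (x - 1)"
    by (simp add: sum.distrib sum_distrib_right)
  also have "[int l + (\<Sum>j<l. int j) * (x - 1) = int l] (mod (int l)\<^sup>2)"
  proof -
    obtain t where t: "l = 2 * t + 1" using l by (elim oddE)
    have "(\<Sum>j<Suc n. int j) * 2 = int n * (int n + 1)" for n
      by (induction n) (simp_all add: algebra_simps)
    from this[of "2 * t"] have "(\<Sum>j<l. int j) * 2 = 2 * (int t * int l)" by (simp add: t)
    then have "(\<Sum>j<l. int j) = int t * int l" by simp
    then have "(int l)\<^sup>2 dvd (\<Sum>j<l. int j) * (x - 1)"
      using x by (auto simp: power2_eq_square intro: mult_dvd_mono)
    then show ?thesis by (simp add: cong_iff_dvd_diff)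
  qed
  finally show ?thesis .
qed

text \<open>A squarefree d uses at most one factor l, whereas n contains two, so one of them can be
  spared.\<close>

lemma squarefree_dvd_div_prime:
  fixes d n l :: nat
  assumes "squarefree d" "d dvd n" "prime l" "l\<^sup>2 dvd n"
  shows "d dvd n div l"
proof -
  obtain c where c: "n = l * (l * c)" using assms(4) unfolding power2_eq_square dvd_def mult.assoc by blast
  have l0: "l > 0" using assms(3) by (simp add: prime_gt_0_nat)
  show ?thesis
  proof (cases "l dvd d")
    case True
    then obtain e where e: "d = l * e" by blast
    have "coprime l e"
    proof (rule ccontr)
      assume "\<not> coprime l e"
      then have "l dvd e" using assms(3) prime_imp_coprime by blast
      then have "l\<^sup>2 dvd d" using e by (simp add: power2_eq_square)
      then show False using assms(1,3) squarefreeD not_prime_unit by blast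
    qed
    moreover have "e dvd l * c" using assms(2) c e l0 by simp
    ultimately have "e dvd c" by (metis coprime_commute coprime_dvd_mult_right_iff)
    then show ?thesis using c e l0 by simp
  next
    case False
    with assms(3) have "coprime l d" by (rule prime_imp_coprime)
    then have "coprime d l" by (simp add: coprime_commute)
    then have "d dvd l * c" using assms(2) c by (metis coprime_dvd_mult_right_iff)
    then show ?thesis using c l0 by simp
  qed
qed

lemma ord_2_dvd_iff:
  fixes p n k :: nat
  assumes "prime p" "p dvd 2 ^ n - 1" "n > 0"
  shows "odd p" "ord p 2 dvd k \<longleftrightarrow> p dvd 2 ^ k - 1"
proof -
  have "odd (2 ^ n - 1 :: nat)" using assms by simp
  with assms(2) show "odd p" by (meson dvd_trans)
  have "ord p 2 dvd k \<longleftrightarrow> [2 ^ k = 1] (mod p)" by (rule ord_divides[symmetric])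
  also have "\<dots> \<longleftrightarrow> p dvd 2 ^ k - 1" by (rule cong_altdef_nat) simp
  finally show "ord p 2 dvd k \<longleftrightarrow> p dvd 2 ^ k - 1" .
qed

lemma S_free_part_squarefree:
  assumes S: "S = {p. prime p \<and> odd p \<and> \<not> squarefree (ord p 2)}"
    and n: "n > 0" "squarefree n" and q: "S_free_decomp S (2 ^ n - 1) q b"
  shows "q = 2 ^ n - 1"
proof -
  have m: "2 ^ n - 1 = q * b" using q by (simp add: S_free_decomp_def)
  have "b = 1"
  proof (rule ccontr)
    assume "b \<noteq> 1"
    then obtain p where p: "prime p" "p dvd b" using prime_factor_nat by blast
    then have "p \<in> S" "p dvd 2 ^ n - 1" using q m by (auto simp: S_free_decomp_def)
    then have "ord p 2 dvd n" "\<not> squarefree (ord p 2)"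
      using ord_2_dvd_iff(2)[of p n n] p n S by auto
    then show False using n squarefree_mono by blast
  qed
  with m show ?thesis by simp
qed

text \<open>Put n = r * l and x = 2^r, so that 2^n - 1 = (x - 1) * Q. A prime p dividing q has
  squarefree order, which divides r by \<open>squarefree_dvd_div_prime\<close>, so p divides x - 1.
  Modulo p the geometric sum Q is l, so q and Q can share only the prime l. In that case l is odd
  and divides Q exactly once. Hence q divides (x - 1) * l.\<close>

lemma S_free_part_not_squarefree:
  assumes S: "S = {p. prime p \<and> odd p \<and> \<not> squarefree (ord p 2)}"
    and n: "n > 0" "\<not> squarefree n" and q: "S_free_decomp S (2 ^ n - 1) q b"
  shows "q \<le> n * 2 ^ (n div 2)"
proof -
  obtain l where l: "prime l" "l\<^sup>2 dvd n"
    using n squarefree_factorial_semiring'[of n] by (auto simp: squarefree_factorial_semiring)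
  define r where "r = n div l"
  have nr: "n = r * l" using l by (metis dvd_div_mult_self dvd_mult_left power2_eq_square r_def)
  have r0: "r > 0" using nr n by (intro Nat.gr0I) auto
  define x where "x = (2::int) ^ r"
  define Q where "Q = (\<Sum>j<l. x ^ j)"
  have m: "2 ^ n - 1 = q * b" using q by (simp add: S_free_decomp_def)
  have xl: "(x - 1) * Q = int q * int b"
  proof -
    have "(x - 1) * Q = x ^ l - 1" unfolding Q_def by (rule power_diff_1_eq[symmetric])
    also have "\<dots> = int (2 ^ n - 1)" by (simp add: x_def nr power_mult of_nat_diff)
    also have "\<dots> = int (q * b)" by (simp only: m)
    finally show ?thesis by simp
  qed
  have px: "int p dvd x - 1" "odd p" if p: "prime p" "p dvd q" for p
  proof -
    have "p dvd 2 ^ n - 1" using p m by simp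
    note ord = ord_2_dvd_iff(1)[OF p(1) this n(1)] ord_2_dvd_iff(2)[OF p(1) this n(1)]
    show "odd p" by (rule ord(1))
    have "p \<notin> S" using p q by (auto simp: S_free_decomp_def)
    then have "squarefree (ord p 2)" using p ord S by auto
    moreover have "ord p 2 dvd n" using ord(2)[of n] p m by simp
    ultimately have "ord p 2 dvd r" unfolding r_def using l by (rule squarefree_dvd_div_prime)
    then have "p dvd 2 ^ r - 1" using ord(2) by simp
    then have "int p dvd int (2 ^ r - 1)" by (simp only: int_dvd_int_iff)
    then show "int p dvd x - 1" by (simp add: x_def of_nat_diff)
  qed
  have Ql: "p = l" if p: "prime p" "p dvd q" "int p dvd Q" for p
  proof -
    have "[x = 1] (mod int p)" using px[OF p(1,2)] by (simp add: cong_iff_dvd_diff)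
    then have "[x ^ j = 1] (mod int p)" for j using cong_pow[of x 1 "int p" j] by simp
    then have "[Q = (\<Sum>j<l. 1)] (mod int p)" unfolding Q_def by (rule cong_sum)
    then have "int p dvd int l" using p(3) by (simp add: cong_dvd_iff)
    then show ?thesis using p l by (simp add: primes_dvd_imp_eq)
  qed
  have "int q dvd (x - 1) * int l"
  proof (cases "l dvd q \<and> int l dvd Q")
    case True
    then obtain Q' where Q': "Q = int l * Q'" by blast
    have "\<not> int p dvd Q'" if p: "prime p" "p dvd q" for p
    proof
      assume "int p dvd Q'"
      then have "p = l" using Ql p Q' by simp
      then have "(int l)\<^sup>2 dvd Q" using \<open>int p dvd Q'\<close> Q' by (simp add: power2_eq_square)
      moreover have "[Q = int l] (mod (int l)\<^sup>2)" unfolding Q_def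
        using px[OF p] \<open>p = l\<close> by (intro geometric_sum_cong_prime) auto
      ultimately have "(int l)\<^sup>2 dvd int l" using cong_dvd_iff by blast
      then show False using l by (simp add: power2_eq_square)
    qed
    then have "coprime (int q) Q'" by (rule coprime_int_nat_primeI)
    moreover have "int q dvd ((x - 1) * int l) * Q'" using xl Q' by (simp add: mult.assoc)
    ultimately show ?thesis by (simp add: coprime_dvd_mult_left_iff)
  next
    case False
    have "coprime (int q) Q"
      using False Ql by (intro coprime_int_nat_primeI) blast
    moreover have "int q dvd (x - 1) * Q" using xl by simp
    ultimately show ?thesis by (simp add: coprime_dvd_mult_left_iff)
  qed
  moreover have "x - 1 > 0" using r0 by (simp add: x_def)
  then have "(x - 1) * int l > 0" using l by (simp add: prime_gt_0_nat)
  ultimately have "int q \<le> (x - 1) * int l" by (rule zdvd_imp_le)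
  also have "\<dots> \<le> x * int l" by (simp add: mult_right_mono)
  also have "\<dots> = int (l * 2 ^ r)" by (simp add: x_def)
  finally have "q \<le> l * 2 ^ r" by (simp only: of_nat_le_iff)
  also have "\<dots> \<le> n * 2 ^ (n div 2)"
  proof (rule mult_mono)
    show "l \<le> n" using nr r0 by simp
    have "r * 2 \<le> n" using nr prime_ge_2_nat[OF l(1)] by simp
    then show "(2::nat) ^ r \<le> 2 ^ (n div 2)" by (intro power_increasing) auto
  qed auto
  finally show ?thesis .
qed

section \<open>Fixed points\<close>

definition S_denom :: "nat set \<Rightarrow> int \<Rightarrow> bool" where
  "S_denom S b \<longleftrightarrow> b > 0 \<and> (\<forall>p::nat. prime p \<longrightarrow> int p dvd b \<longrightarrow> p \<in> S)"

lemma S_denom_mult: "S_denom S b \<Longrightarrow> S_denom S c \<Longrightarrow> S_denom S (b * c)"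
  by (auto simp: S_denom_def prime_dvd_mult_iff)

lemma S_denom_1 [simp]: "S_denom S 1"
  by (auto simp: S_denom_def)

text \<open>In lowest terms the p-adic absolute value exceeds 1 exactly when p divides the
  denominator; and reducing a fraction replaces its denominator by a divisor, which stays
  admissible.\<close>

lemma R_ring_iff: "r \<in> R_ring S \<longleftrightarrow> (\<exists>a b. r = of_int a / of_int b \<and> S_denom S b)"
proof
  assume r: "r \<in> R_ring S"
  obtain a b where ab: "quotient_of r = (a, b)" by force
  have b: "b > 0" "coprime a b" "r = of_int a / of_int b"
    using ab quotient_of_denom_pos quotient_of_coprime quotient_of_div by blast+
  have "p \<in> S" if p: "prime p" "int p dvd b" for p :: nat
  proof (rule ccontr)
    assume "p \<notin> S"
    then have le: "padic_abs p r \<le> 1" using r p by (auto simp: R_ring_def)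
    have p1: "p > 1" using p(1) by (rule prime_gt_1_nat)
    have "\<not> int p dvd a" using p b p1 by (meson coprime_common_divisor not_prime_unit prime_nat_int_transfer)
    then have ma: "multiplicity (int p) a = 0" by (rule not_dvd_imp_multiplicity_0)
    have mb: "multiplicity (int p) b > 0" using p b p1 by (simp add: prime_multiplicity_gt_zero_iff)
    have "r \<noteq> 0"
    proof
      assume "r = 0"
      then have "a = 0" using b by simp
      then show False using \<open>\<not> int p dvd a\<close> by simp
    qed
    then have "padic_abs p r = real p ^ multiplicity (int p) b" by (simp add: padic_abs_def ab ma)
    moreover have "real p ^ multiplicity (int p) b > 1" using mb p1 by (simp add: one_less_power)
    ultimately show False using le by simp
  qed
  with b have "S_denom S b" by (simp add: S_denom_def)
  with b show "\<exists>a b. r = of_int a / of_int b \<and> S_denom S b" by blast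
next
  assume "\<exists>a b. r = of_int a / of_int b \<and> S_denom S b"
  then obtain c d where r: "r = of_int c / of_int d" "S_denom S d" by blast
  obtain a b where ab: "quotient_of r = (a, b)" by force
  have b: "b > 0" "coprime a b" "r = of_int a / of_int b"
    using ab quotient_of_denom_pos quotient_of_coprime quotient_of_div by blast+
  have d: "d > 0" using r by (simp add: S_denom_def)
  have "of_int (a * d) = (of_int (c * b) :: rat)" using r b d by (simp add: field_simps)
  then have "a * d = c * b" by (simp only: of_int_eq_iff)
  then have "b dvd d * a" by (metis dvd_triv_right mult.commute)
  then have bd: "b dvd d" using b by (simp add: coprime_dvd_mult_left_iff coprime_commute)
  have "padic_abs p r \<le> 1" if p: "prime p" "p \<notin> S" for p
  proof (cases "r = 0")
    case False
    have "\<not> int p dvd d" using p r by (auto simp: S_denom_def)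
    then have "\<not> int p dvd b" using bd dvd_trans by blast
    then have "multiplicity (int p) b = 0" by (rule not_dvd_imp_multiplicity_0)
    then have "padic_abs p r = inverse (real p ^ multiplicity (int p) a)"
      using False by (simp add: padic_abs_def ab power_int_minus)
    moreover have "real p \<ge> 1" using p prime_ge_1_nat by simp
    ultimately show ?thesis by (simp add: inverse_le_1_iff)
  qed (simp add: padic_abs_def)
  then show "r \<in> R_ring S" by (simp add: R_ring_def)
qed

lemma R_ring_of_int [simp]: "of_int a \<in> R_ring S"
  unfolding R_ring_iff by (intro exI[of _ a] exI[of _ 1]) simp

lemma R_ring_0 [simp]: "0 \<in> R_ring S" and R_ring_1 [simp]: "1 \<in> R_ring S"
  using R_ring_of_int[of 0] R_ring_of_int[of 1] by simp_all

lemma R_ring_inverse_denom: "S_denom S b \<Longrightarrow> 1 / of_int b \<in> R_ring S"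
  unfolding R_ring_iff by (intro exI[of _ 1] exI[of _ b]) simp

lemma R_ring_add: "r \<in> R_ring S \<Longrightarrow> s \<in> R_ring S \<Longrightarrow> r + s \<in> R_ring S"
  unfolding R_ring_iff
proof (elim exE conjE)
  fix a b c d assume "r = of_int a / of_int b" "S_denom S b" "s = of_int c / of_int d" "S_denom S d"
  moreover from this have "b \<noteq> 0" "d \<noteq> 0" by (auto simp: S_denom_def)
  ultimately show "\<exists>a b. r + s = of_int a / of_int b \<and> S_denom S b"
    by (intro exI[of _ "a * d + c * b"] exI[of _ "b * d"]) (simp add: S_denom_mult field_simps)
qed

lemma R_ring_mult: "r \<in> R_ring S \<Longrightarrow> s \<in> R_ring S \<Longrightarrow> r * s \<in> R_ring S"
  unfolding R_ring_iff
proof (elim exE conjE)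
  fix a b c d assume "r = of_int a / of_int b" "S_denom S b" "s = of_int c / of_int d" "S_denom S d"
  then show "\<exists>a b. r * s = of_int a / of_int b \<and> S_denom S b"
    by (intro exI[of _ "a * c"] exI[of _ "b * d"]) (simp add: S_denom_mult)
qed

lemma R_ring_of_nat_mult: "r \<in> R_ring S \<Longrightarrow> of_nat n * r \<in> R_ring S"
  using R_ring_mult[OF R_ring_of_int[of "int n"]] by simp

lemma R_ring_power_2_mult: "r \<in> R_ring S \<Longrightarrow> 2 ^ n * r \<in> R_ring S"
  using R_ring_of_nat_mult[of r S "2 ^ n"] by simp

lemma R_ring_uminus: "r \<in> R_ring S \<Longrightarrow> - r \<in> R_ring S"
  using R_ring_mult[OF R_ring_of_int[of "-1"]] by simp

lemma R_ring_diff: "r \<in> R_ring S \<Longrightarrow> s \<in> R_ring S \<Longrightarrow> r - s \<in> R_ring S"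
  using R_ring_add[OF _ R_ring_uminus] by fastforce

section \<open>Characters of \<open>R\<^sub>S\<close> and iterates of
  \<open>T\<^sub>S\<close>\<close>

abbreviation dual_R :: "nat set \<Rightarrow> (rat \<Rightarrow> complex) set" where
  "dual_R S \<equiv> carrier (pontryagin_dual (R_group S))"

lemma dual_R_iff:
  "u \<in> dual_R S \<longleftrightarrow> u \<in> extensional (R_ring S) \<and> (\<forall>r\<in>R_ring S. norm (u r) = 1) \<and>
     (\<forall>r\<in>R_ring S. \<forall>s\<in>R_ring S. u (r + s) = u r * u s)"
  by (auto simp: pontryagin_dual_def hom_def R_group_def circle_group_def)

lemma dual_R_norm: "u \<in> dual_R S \<Longrightarrow> r \<in> R_ring S \<Longrightarrow> norm (u r) = 1"
  and dual_R_add: "u \<in> dual_R S \<Longrightarrow> r \<in> R_ring S \<Longrightarrow> s \<in> R_ring S \<Longrightarrow> u (r + s) = u r * u s"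
  and dual_R_extensional: "u \<in> dual_R S \<Longrightarrow> u \<in> extensional (R_ring S)"
  by (auto simp: dual_R_iff)

lemma dual_R_0: "u \<in> dual_R S \<Longrightarrow> u 0 = 1"
  using dual_R_add[of u S 0 0] dual_R_norm[of u S 0] by auto

lemma dual_R_of_nat: "u \<in> dual_R S \<Longrightarrow> r \<in> R_ring S \<Longrightarrow> u (of_nat n * r) = u r ^ n"
proof (induction n)
  case (Suc n)
  have "u (of_nat (Suc n) * r) = u (r + of_nat n * r)" by (simp add: algebra_simps)
  with Suc show ?case by (simp add: dual_R_add R_ring_of_nat_mult)
qed (simp add: dual_R_0)

lemma dual_R_of_int:
  assumes u: "u \<in> dual_R S" and r: "r \<in> R_ring S"
  shows "u (of_int c * r) = u r powi c"
proof (cases "c \<ge> 0")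
  case True
  then show ?thesis using dual_R_of_nat[OF u r, of "nat c"] by (simp add: power_int_def)
next
  case False
  define n where "n = nat (- c)"
  have c: "c = - int n" using False by (simp add: n_def)
  have "u (of_nat n * r) * u (- (of_nat n * r)) = 1"
    using dual_R_add[OF u R_ring_of_nat_mult[OF r] R_ring_uminus[OF R_ring_of_nat_mult[OF r]], of n n] dual_R_0[OF u] by simp
  then have "u r ^ n * u (- (of_nat n * r)) = 1" by (simp add: dual_R_of_nat[OF u r])
  then show ?thesis unfolding c by (simp add: power_int_minus inverse_unique)
qed

lemma T_map_eq: "T_map S u = (\<lambda>r\<in>R_ring S. u (2 * r))"
  by (simp add: T_map_def dual_endo_def compose_def R_group_def)

lemma T_map_funpow:
  assumes "u \<in> dual_R S"
  shows "(T_map S ^^ k) u = (\<lambda>r\<in>R_ring S. u (2 ^ k * r))"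
proof (induction k)
  case 0
  then show ?case using dual_R_extensional[OF assms] by (simp add: extensional_restrict)
next
  case (Suc k)
  have "2 * r \<in> R_ring S" if "r \<in> R_ring S" for r using R_ring_power_2_mult[OF that, of 1] by simp
  then show ?case using Suc by (auto simp: T_map_eq fun_eq_iff mult_ac)
qed

lemma T_map_funpow_in:
  assumes "u \<in> dual_R S"
  shows "(T_map S ^^ k) u \<in> dual_R S"
  unfolding T_map_funpow[OF assms] using assms
  by (auto simp: dual_R_iff R_ring_add R_ring_power_2_mult distrib_left)

text \<open>Restrictions of characters of the real line. They show that the dual is nonempty and
  provide the separated points for the lower entropy bound.\<close>

lemma cis_char_in_dual_R: "(\<lambda>r\<in>R_ring S. cis (t * of_rat r)) \<in> dual_R S"
  by (auto simp: dual_R_iff R_ring_add of_rat_add distrib_left cis_mult)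

section \<open>Counting the fixed points\<close>

lemma of_int_in_multiples_R_ring:
  assumes q: "\<And>p. prime p \<Longrightarrow> p dvd q \<Longrightarrow> p \<notin> S" and q0: "q > 0" and k: "of_int k / of_nat q \<in> R_ring S"
  shows "int q dvd k"
proof -
  obtain a b where ab: "of_int k / of_nat q = (of_int a / of_int b :: rat)" "S_denom S b"
    using k unfolding R_ring_iff by blast
  have b: "b > 0" using ab by (simp add: S_denom_def)
  have "of_int (k * b) = (of_int (a * int q) :: rat)" using ab b q0 by (simp add: field_simps)
  then have "k * b = a * int q" by (simp only: of_int_eq_iff)
  then have "int q dvd k * b" by simp
  moreover have "coprime (int q) b"
    using q ab by (intro coprime_int_nat_primeI) (auto simp: S_denom_def)
  ultimately show ?thesis by (simp add: coprime_dvd_mult_left_iff)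
qed

text \<open>For r = a / b the denominator b is coprime to q. Multiply a / b by a Bezout relation x q
  + y b = 1: the second summand becomes an integer, the first a multiple of q in the ring.\<close>

lemma R_ring_decompose:
  assumes q: "\<And>p. prime p \<Longrightarrow> p dvd q \<Longrightarrow> p \<notin> S" and r: "r \<in> R_ring S"
  obtains k s where "s \<in> R_ring S" "r = of_int k + of_nat q * s"
proof -
  obtain a b where ab: "r = of_int a / of_int b" "S_denom S b" using r unfolding R_ring_iff by blast
  have "coprime (int q) b" using q ab by (intro coprime_int_nat_primeI) (auto simp: S_denom_def)
  then obtain x y where xy: "x * int q + y * b = 1" by (metis bezout_int coprime_imp_gcd_eq_1)
  have b: "b > 0" using ab by (simp add: S_denom_def)
  have "r = of_int (a * (x * int q + y * b)) / of_int b" using ab xy by simp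
  also have "\<dots> = of_int (a * y) + of_nat q * (of_int (a * x) * (1 / of_int b))"
    using b by (simp add: field_simps)
  finally show thesis
    using that R_ring_mult[OF R_ring_of_int R_ring_inverse_denom[OF ab(2)]] by blast
qed

lemma powi_eq_if_root_of_unity:
  fixes z :: complex
  assumes "z ^ q = 1" "int q dvd k - l" "q > 0"
  shows "z powi k = z powi l"
proof -
  obtain c where "k = l + int q * c" using assms(2) by (metis dvdE add.commute diff_add_cancel)
  moreover have "z \<noteq> 0" using assms by (auto simp: power_0_left)
  ultimately show ?thesis using assms by (simp add: power_int_add power_int_mult)
qed

text \<open>Being fixed by the n-th iterate means being trivial on the multiples of 2^n - 1 = q * b
  in \<open>R\<^sub>S\<close>. Since b is a unit there, these are the multiples of q.\<close>

lemma fixed_points_T_map_iff: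
  assumes n: "n > 0" and dec: "S_free_decomp S (2 ^ n - 1) q b" and u: "u \<in> dual_R S"
  shows "(T_map S ^^ n) u = u \<longleftrightarrow> (\<forall>r\<in>R_ring S. u (of_nat q * r) = 1)"
proof -
  have m: "2 ^ n - 1 = q * b" using dec by (simp add: S_free_decomp_def)
  have m0: "(2::nat) ^ n - 1 > 0" using one_less_power[of "2::nat" n] n by simp
  have b0: "b > 0" using m m0 by (intro Nat.gr0I) auto
  have Sb: "S_denom S (int b)" using dec b0 by (auto simp: S_free_decomp_def S_denom_def)
  have pow: "(2::rat) ^ n = of_nat (q * b) + 1"
    using m m0 by (metis of_nat_1 of_nat_add of_nat_numeral of_nat_power le_add_diff_inverse2 less_imp_le_nat zero_less_diff)
  have "(T_map S ^^ n) u = u \<longleftrightarrow> (\<forall>r\<in>R_ring S. u (2 ^ n * r) = u r)"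
    unfolding T_map_funpow[OF u] using dual_R_extensional[OF u] by (auto simp: fun_eq_iff extensional_def)
  also have "\<dots> \<longleftrightarrow> (\<forall>r\<in>R_ring S. u (of_nat (q * b) * r) = 1)"
  proof (intro ball_cong refl)
    fix r assume r: "r \<in> R_ring S"
    have *: "2 ^ n * r = of_nat (q * b) * r + r" unfolding pow by (simp add: algebra_simps)
    have "u (2 ^ n * r) = u (of_nat (q * b) * r) * u r"
      unfolding * by (rule dual_R_add[OF u R_ring_of_nat_mult[OF r] r])
    moreover have "u r \<noteq> 0" using dual_R_norm[OF u r] by auto
    ultimately show "u (2 ^ n * r) = u r \<longleftrightarrow> u (of_nat (q * b) * r) = 1" by simp
  qed
  also have "\<dots> \<longleftrightarrow> (\<forall>r\<in>R_ring S. u (of_nat q * r) = 1)"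
  proof safe
    fix r assume *: "\<forall>r\<in>R_ring S. u (of_nat (q * b) * r) = 1" and r: "r \<in> R_ring S"
    have "1 / of_int (int b) * r \<in> R_ring S" using R_ring_mult[OF R_ring_inverse_denom[OF Sb] r] .
    moreover have "of_nat (q * b) * (1 / of_int (int b) * r) = of_nat q * r" using b0 by simp
    ultimately show "u (of_nat q * r) = 1" using * by metis
  next
    fix r assume *: "\<forall>r\<in>R_ring S. u (of_nat q * r) = 1" and r: "r \<in> R_ring S"
    have "of_nat (q * b) * r = of_nat q * (of_nat b * r)" by simp
    then show "u (of_nat (q * b) * r) = 1" using * R_ring_of_nat_mult[OF r, of b] by metis
  qed
  finally show ?thesis .
qed

text \<open>\<open>R\<^sub>S = \<int> + qR\<^sub>S\<close> and \<open>\<int> \<inter> qR\<^sub>S = q\<int>\<close>, so a character that is trivial on \<open>qR\<^sub>S\<close> is determined by its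
  value at 1, which can be any \<open>q\<close>-th root of unity.\<close>

lemma card_fixed_points_T_map:
  assumes n: "n > 0" and dec: "S_free_decomp S (2 ^ n - 1) q b"
  shows "finite {u \<in> dual_R S. (T_map S ^^ n) u = u}" "card {u \<in> dual_R S. (T_map S ^^ n) u = u} = q"
proof -
  define Fx where "Fx = {u \<in> dual_R S. (T_map S ^^ n) u = u}"
  have Fx: "Fx = {u \<in> dual_R S. \<forall>r\<in>R_ring S. u (of_nat q * r) = 1}"
    using fixed_points_T_map_iff[OF n dec] by (auto simp: Fx_def)
  have qS: "\<And>p. prime p \<Longrightarrow> p dvd q \<Longrightarrow> p \<notin> S" using dec by (simp add: S_free_decomp_def)
  have m: "2 ^ n - 1 = q * b" using dec by (simp add: S_free_decomp_def)
  have "(2::nat) ^ n - 1 > 0" using one_less_power[of "2::nat" n] n by simp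
  then have q0: "q > 0" using m by (intro Nat.gr0I) auto
  have bij: "bij_betw (\<lambda>u. u 1) Fx {z. z ^ q = 1}"
    unfolding bij_betw_def
  proof
    show "inj_on (\<lambda>u. u 1) Fx"
    proof (rule inj_onI)
      fix u v assume uv: "u \<in> Fx" "v \<in> Fx" "u 1 = v 1"
      have val: "w r = w 1 powi k" if w: "w \<in> Fx" and s: "s \<in> R_ring S" "r = of_int k + of_nat q * s" for w r s k
      proof -
        have "w \<in> dual_R S" "w (of_nat q * s) = 1" using w s by (auto simp: Fx)
        then show ?thesis
          using dual_R_add[of w S "of_int k" "of_nat q * s"] dual_R_of_int[of w S 1 k] s R_ring_of_nat_mult[OF s(1)] by simp
      qed
      have "u r = v r" if "r \<in> R_ring S" for r
        using R_ring_decompose[OF qS that] val uv by metis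
      moreover have "u \<in> extensional (R_ring S)" "v \<in> extensional (R_ring S)"
        using uv dual_R_extensional by (auto simp: Fx)
      ultimately show "u = v" by (intro extensionalityI) auto
    qed
    show "(\<lambda>u. u 1) ` Fx = {z. z ^ q = 1}"
    proof safe
      fix u assume "u \<in> Fx"
      then have "u \<in> dual_R S" "u (of_nat q * 1) = 1" by (auto simp: Fx simp del: mult_1_right)
      then show "u 1 ^ q = 1" using dual_R_of_nat[of u S 1 q] by simp
    next
      fix z :: complex assume z: "z ^ q = 1"
      have nz: "norm z = 1" using z q0 by (metis norm_one norm_power power_eq_1_iff norm_ge_zero zero_less_iff_neq_zero)
      then have z0: "z \<noteq> 0" by auto
      \<comment> \<open>The integer part of r is determined only modulo q, which does not affect the
        powers of a q-th root of unity z.\<close>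
      define \<kappa> where "\<kappa> = (\<lambda>r. SOME k. \<exists>s\<in>R_ring S. r = of_int k + of_nat q * s)"
      have \<kappa>: "\<exists>s\<in>R_ring S. r = of_int (\<kappa> r) + of_nat q * s" if "r \<in> R_ring S" for r
        unfolding \<kappa>_def by (rule someI_ex) (use R_ring_decompose[OF qS that] in metis)
      have uniq: "z powi k = z powi l" if "s \<in> R_ring S" "of_int k - of_int l = of_nat q * s" for k l s
      proof -
        have "of_int (k - l) / of_nat q \<in> R_ring S" using that q0 by simp
        then have "int q dvd k - l" using of_int_in_multiples_R_ring[OF qS q0] by blast
        then show ?thesis using powi_eq_if_root_of_unity[OF z _ q0] by blast
      qed
      define u where "u = (\<lambda>r\<in>R_ring S. z powi \<kappa> r)"
      have eval: "u r = z powi k" if r: "r \<in> R_ring S" and s: "s \<in> R_ring S" "r = of_int k + of_nat q * s" for r k s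
      proof -
        obtain t where t: "t \<in> R_ring S" "r = of_int (\<kappa> r) + of_nat q * t" using \<kappa>[OF r] by blast
        have "of_int (\<kappa> r) - of_int k = of_nat q * (s - t)" using t(2) s(2) by (simp add: algebra_simps)
        then have "z powi \<kappa> r = z powi k" using uniq R_ring_diff[OF s(1) t(1)] by blast
        then show ?thesis using r by (simp add: u_def)
      qed
      have "u \<in> dual_R S"
        unfolding dual_R_iff
      proof (intro conjI ballI)
        show "u \<in> extensional (R_ring S)" by (simp add: u_def)
        show "norm (u r) = 1" if "r \<in> R_ring S" for r using that nz by (simp add: u_def norm_power_int)
        fix r r' assume r: "r \<in> R_ring S" "r' \<in> R_ring S"
        obtain s where s: "s \<in> R_ring S" "r = of_int (\<kappa> r) + of_nat q * s" using \<kappa>[OF r(1)] by blast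
        obtain s' where s': "s' \<in> R_ring S" "r' = of_int (\<kappa> r') + of_nat q * s'" using \<kappa>[OF r(2)] by blast
        have "r + r' = of_int (\<kappa> r + \<kappa> r') + of_nat q * (s + s')" using s s' by (simp add: algebra_simps)
        then have "u (r + r') = z powi (\<kappa> r + \<kappa> r')"
          using eval[OF R_ring_add[OF r] R_ring_add[OF s(1) s'(1)]] by blast
        then show "u (r + r') = u r * u r'" using r z0 by (simp add: u_def power_int_add)
      qed
      moreover have "u (of_nat q * r) = 1" if "r \<in> R_ring S" for r
        using eval[OF R_ring_of_nat_mult[OF that] that, of q 0] by simp
      moreover have "u 1 = z" using eval[OF R_ring_1 R_ring_0, of 1] by simp
      ultimately show "z \<in> (\<lambda>u. u 1) ` Fx" unfolding Fx by blast
    qed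
  qed
  have fin: "finite {z::complex. z ^ q = 1}" and card: "card {z::complex. z ^ q = 1} = q"
    using q0 by (simp_all add: finite_roots_unity card_roots_unity_eq)
  have "finite Fx" using bij_betw_finite[OF bij] fin by simp
  then show "finite {u \<in> dual_R S. (T_map S ^^ n) u = u}" unfolding Fx_def .
  have "card Fx = q" using bij_betw_same_card[OF bij] card by simp
  then show "card {u \<in> dual_R S. (T_map S ^^ n) u = u} = q" unfolding Fx_def .
qed

section \<open>Topological entropy\<close>

abbreviation R_space :: "nat set \<Rightarrow> (rat \<Rightarrow> complex) topology" where
  "R_space S \<equiv> dual_topology (R_group S)"

lemma R_space_eq:
  "R_space S = subtopology (product_topology (\<lambda>_. euclidean) (R_ring S)) (dual_R S)"
  by (simp add: dual_topology_def R_group_def)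

lemma topspace_R_space [simp]: "topspace (R_space S) = dual_R S"
  unfolding R_space_eq by (auto simp: PiE_iff dual_R_iff extensional_def)

lemma continuous_map_eval:
  assumes "r \<in> R_ring S"
  shows "continuous_map (R_space S) euclidean (\<lambda>u. u r)"
  unfolding R_space_eq
  by (intro continuous_map_from_subtopology continuous_map_product_projection[OF assms])

lemma continuous_map_complex_mult:
  fixes f g :: "'a \<Rightarrow> complex"
  shows "continuous_map X euclidean f \<Longrightarrow> continuous_map X euclidean g \<Longrightarrow> continuous_map X euclidean (\<lambda>x. f x * g x)"
  by (simp add: continuous_map_atin tendsto_mult)

text \<open>Tychonoff: the dual is cut out of a product of circles by the closed conditions u (r +
  s) = u r * u s.\<close>

lemma compact_space_R_space: "compact_space (R_space S)"
proof -
  let ?P = "product_topology (\<lambda>_. euclidean) (R_ring S) :: (rat \<Rightarrow> complex) topology"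
  let ?K = "PiE (R_ring S) (\<lambda>_. sphere (0::complex) 1)"
  have K: "compactin ?P ?K" by (simp add: compactin_PiE)
  define C where "C = (\<lambda>r s. {u \<in> topspace ?P. u (r + s) = u r * u s})"
  have C: "closedin ?P (C r s)" if "r \<in> R_ring S" "s \<in> R_ring S" for r s
    unfolding C_def using that
    by (intro closedin_continuous_maps_eq[where Y = euclidean] continuous_map_complex_mult
        continuous_map_product_projection R_ring_add) auto
  have ne: "R_ring S \<noteq> {}" using R_ring_0[of S] by blast
  have "closedin ?P (\<Inter>s\<in>R_ring S. C r s)" if "r \<in> R_ring S" for r
    using ne C[OF that] by (intro closedin_Inter) auto
  then have "closedin ?P (\<Inter>r\<in>R_ring S. \<Inter>s\<in>R_ring S. C r s)"
    using ne by (intro closedin_Inter) auto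
  with K have "compactin ?P (?K \<inter> (\<Inter>r\<in>R_ring S. \<Inter>s\<in>R_ring S. C r s))"
    by (rule compact_Int_closedin)
  also have "?K \<inter> (\<Inter>r\<in>R_ring S. \<Inter>s\<in>R_ring S. C r s) = dual_R S"
    unfolding dual_R_iff set_eq_iff using ne by (simp add: C_def PiE_iff) blast
  finally show ?thesis unfolding R_space_eq by (rule compact_space_subtopology)
qed

text \<open>Lets one coordinate control finitely many: if r = c / d, then u r is the c-th power of u
  (1 / d).\<close>

lemma R_ring_common_denominator:
  assumes "finite F" "F \<subseteq> R_ring S"
  shows "\<exists>d. S_denom S d \<and> (\<forall>r\<in>F. \<exists>c. r = of_int c * (1 / of_int d))"
  using assms
proof (induction F)
  case empty
  show ?case by (intro exI[of _ 1]) simp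
next
  case (insert r F)
  then obtain d where d: "S_denom S d" "\<forall>r\<in>F. \<exists>c. r = of_int c * (1 / of_int d)" by auto
  obtain a b where ab: "r = of_int a / of_int b" "S_denom S b" using insert by (auto simp: R_ring_iff)
  have nz: "b \<noteq> 0" "d \<noteq> 0" using ab d by (auto simp: S_denom_def)
  have "\<exists>c. s = of_int c * (1 / of_int (d * b))" if "s \<in> insert r F" for s
  proof (cases "s = r")
    case True
    then show ?thesis using ab nz by (intro exI[of _ "a * d"]) simp
  next
    case False
    then have "s \<in> F" using that by simp
    from bspec[OF d(2) this] obtain c where "s = of_int c * (1 / of_int d)" ..
    then show ?thesis using nz by (intro exI[of _ "c * b"]) simp
  qed
  then have "\<forall>s\<in>insert r F. \<exists>c. s = of_int c * (1 / of_int (d * b))" by (rule ballI)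
  with S_denom_mult[OF d(1) ab(2)]
  have "S_denom S (d * b) \<and> (\<forall>s\<in>insert r F. \<exists>c. s = of_int c * (1 / of_int (d * b)))" ..
  then show ?case ..
qed

text \<open>A basic neighbourhood restricts finitely many coordinates. With a common denominator d,
  all of them are continuous functions of the single coordinate u (1 / d).\<close>

lemma openin_R_space_basis:
  assumes A: "openin (R_space S) A" and x: "x \<in> A"
  shows "\<exists>d \<epsilon>. S_denom S d \<and> \<epsilon> > 0 \<and>
    (\<forall>u\<in>dual_R S. norm (u (1 / of_int d) - x (1 / of_int d)) < \<epsilon> \<longrightarrow> u \<in> A)"
proof -
  obtain W where W: "openin (product_topology (\<lambda>_. euclidean) (R_ring S)) W" "A = W \<inter> dual_R S"
    using A unfolding R_space_eq openin_subtopology by blast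
  then obtain V where V: "finite {r \<in> R_ring S. V r \<noteq> UNIV}" "\<And>r. r \<in> R_ring S \<Longrightarrow> open (V r)"
    "x \<in> PiE (R_ring S) V" "PiE (R_ring S) V \<subseteq> W"
    using x unfolding openin_product_topology_alt by fastforce
  define F where "F = {r \<in> R_ring S. V r \<noteq> UNIV}"
  obtain d where d: "S_denom S d" "\<forall>r\<in>F. \<exists>c. r = of_int c * (1 / of_int d)"
    using R_ring_common_denominator[of F S] V(1) by (auto simp: F_def)
  define t where "t = (1 / of_int d :: rat)"
  have t: "t \<in> R_ring S" unfolding t_def by (rule R_ring_inverse_denom[OF d(1)])
  obtain c where c: "\<And>r. r \<in> F \<Longrightarrow> r = of_int (c r) * t" using d(2) unfolding t_def by metis
  have xX: "x \<in> dual_R S" using x W by auto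
  have "\<forall>\<^sub>F z in nhds (x t). \<forall>r\<in>F. z powi c r \<in> V r"
  proof (rule eventually_ball_finite)
    show "finite F" using V(1) by (simp add: F_def)
    show "\<forall>r\<in>F. \<forall>\<^sub>F z in nhds (x t). z powi c r \<in> V r"
    proof
      fix r assume r: "r \<in> F"
      have rR: "r \<in> R_ring S" using r by (simp add: F_def)
      have "x t \<noteq> 0" using dual_R_norm[OF xX t] by auto
      then have "((\<lambda>z. z powi c r) \<longlongrightarrow> x t powi c r) (nhds (x t))"
        by (intro tendsto_power_int filterlim_ident)
      moreover have "x t powi c r = x r" using dual_R_of_int[OF xX t, of "c r"] c[OF r] by simp
      moreover have "x r \<in> V r" using V(3) rR by (auto simp: PiE_iff)
      ultimately show "\<forall>\<^sub>F z in nhds (x t). z powi c r \<in> V r"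
        using V(2)[OF rR] by (auto dest: topological_tendstoD)
    qed
  qed
  then obtain \<epsilon> where \<epsilon>: "\<epsilon> > 0" "\<And>z r. dist z (x t) < \<epsilon> \<Longrightarrow> r \<in> F \<Longrightarrow> z powi c r \<in> V r"
    unfolding eventually_nhds_metric by blast
  have "u \<in> A" if u: "u \<in> dual_R S" "norm (u t - x t) < \<epsilon>" for u
  proof -
    have "u r \<in> V r" if r: "r \<in> R_ring S" for r
    proof (cases "r \<in> F")
      case True
      then have "u r = u t powi c r" using dual_R_of_int[OF u(1) t, of "c r"] c[OF True] by simp
      then show ?thesis using \<epsilon>(2) True u(2) by (simp add: dist_norm)
    qed (use r in \<open>simp add: F_def\<close>)
    then have "u \<in> PiE (R_ring S) V" using dual_R_extensional[OF u(1)] by (simp add: PiE_iff)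
    then show ?thesis using V(4) W u by blast
  qed
  then show ?thesis using d(1) \<epsilon>(1) unfolding t_def by blast
qed

lemma dual_R_power_denom:
  assumes "u \<in> dual_R S" "S_denom S (int e * d)" "e > 0"
  shows "u (1 / of_int d) = u (1 / of_int (int e * d)) ^ e"
proof -
  have "1 / of_int d = of_nat e * (1 / of_int (int e * d) :: rat)" using assms by simp
  then show ?thesis using dual_R_of_nat[OF assms(1) R_ring_inverse_denom[OF assms(2)], of e] by simp
qed

section \<open>Upper bound for the entropy\<close>

text \<open>A Lebesgue number for the pseudometric given by the coordinate 1 / d. Compactness leaves
  finitely many local denominators, and d is their product. The local coordinates are e-th powers of
  the coordinate 1 / d with e \<le> d, so distances grow at most by the factor d.\<close>

lemma open_cover_Lebesgue_number:
  assumes U: "open_cover (R_space S) U"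
  obtains d \<eta> where "S_denom S d" "\<eta> > 0"
    "\<And>Y. Y \<subseteq> dual_R S \<Longrightarrow> (\<And>u v. u \<in> Y \<Longrightarrow> v \<in> Y \<Longrightarrow> norm (u (1 / of_int d) - v (1 / of_int d)) < \<eta>) \<Longrightarrow> \<exists>A\<in>U. Y \<subseteq> A"
proof -
  have "\<exists>A d \<epsilon>. A \<in> U \<and> S_denom S d \<and> \<epsilon> > 0 \<and>
      (\<forall>u\<in>dual_R S. norm (u (1 / of_int d) - x (1 / of_int d)) < \<epsilon> \<longrightarrow> u \<in> A)" if "x \<in> dual_R S" for x
  proof -
    have "x \<in> \<Union>U" using U that by (simp add: open_cover_def)
    then obtain A where A: "A \<in> U" "x \<in> A" "openin (R_space S) A"
      using U by (auto simp: open_cover_def)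
    then show ?thesis using openin_R_space_basis[OF A(3,2)] by blast
  qed
  then obtain A dn \<epsilon> where loc: "\<And>x. x \<in> dual_R S \<Longrightarrow> A x \<in> U" "\<And>x. x \<in> dual_R S \<Longrightarrow> S_denom S (dn x)"
    "\<And>x. x \<in> dual_R S \<Longrightarrow> \<epsilon> x > 0"
    "\<And>x u. x \<in> dual_R S \<Longrightarrow> u \<in> dual_R S \<Longrightarrow> norm (u (1 / of_int (dn x)) - x (1 / of_int (dn x))) < \<epsilon> x \<Longrightarrow> u \<in> A x"
    by metis
  define B where "B = (\<lambda>x. {u \<in> topspace (R_space S). u (1 / of_int (dn x)) \<in> ball (x (1 / of_int (dn x))) (\<epsilon> x / 2)})"
  have "openin (R_space S) (B x)" if "x \<in> dual_R S" for x
    unfolding B_def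
    by (intro openin_continuous_map_preimage[where Y = euclidean] continuous_map_eval R_ring_inverse_denom loc that) simp
  then have opens: "\<forall>A\<in>B ` dual_R S. openin (R_space S) A" by blast
  have "x \<in> B x" if "x \<in> dual_R S" for x using that loc(3)[OF that] by (simp add: B_def)
  then have covers: "dual_R S \<subseteq> \<Union>(B ` dual_R S)" by blast
  have "\<exists>\<F>. finite \<F> \<and> \<F> \<subseteq> B ` dual_R S \<and> dual_R S \<subseteq> \<Union>\<F>"
    by (rule compact_space_R_space[of S, unfolded compact_space_alt topspace_R_space, THEN spec, THEN mp, OF conjI[OF opens covers]])
  then obtain \<F> where "finite \<F>" "\<F> \<subseteq> B ` dual_R S" "dual_R S \<subseteq> \<Union>\<F>" by blast
  moreover from this obtain F where "F \<subseteq> dual_R S" "finite F" "\<F> = B ` F" using finite_subset_image by metis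
  ultimately have F: "finite F" "F \<subseteq> dual_R S" "dual_R S \<subseteq> (\<Union>x\<in>F. B x)" by auto
  define d where "d = (\<Prod>x\<in>F. dn x)"
  have d: "S_denom S d" unfolding d_def using F(1,2) loc(2)
    by (induction F) (auto intro!: S_denom_mult)
  have d0: "d > 0" using d by (simp add: S_denom_def)
  have nonempty: "dual_R S \<noteq> {}" using cis_char_in_dual_R by blast
  then have F0: "F \<noteq> {}" using F by auto
  \<comment> \<open>The division by d compensates the growth under e-th powers; the 2 leaves half of
    the radius \<epsilon> x for the distance from v to the centre x.\<close>
  define \<eta> where "\<eta> = Min (\<epsilon> ` F) / (2 * real_of_int d)"
  have min: "Min (\<epsilon> ` F) > 0" using F F0 loc(3) by (subst Min_gr_iff) auto
  then have \<eta>: "\<eta> > 0" using d0 by (simp add: \<eta>_def)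
  show thesis
  proof (rule that[OF d \<eta>])
    fix Y assume Y: "Y \<subseteq> dual_R S" and small: "\<And>u v. u \<in> Y \<Longrightarrow> v \<in> Y \<Longrightarrow> norm (u (1 / of_int d) - v (1 / of_int d)) < \<eta>"
    show "\<exists>A\<in>U. Y \<subseteq> A"
    proof (cases "Y = {}")
      case True
      then show ?thesis using nonempty loc(1) by blast
    next
      case False
      then obtain v where v: "v \<in> Y" by blast
      then obtain x where x: "x \<in> F" "v \<in> B x" using Y F(3) by blast
      have xX: "x \<in> dual_R S" using x F by blast
      have "dn x dvd d" unfolding d_def using F(1) x(1) by (intro dvd_prodI)
      then obtain e' where e': "d = dn x * e'" by blast
      have dx: "dn x > 0" using loc(2)[OF xX] by (simp add: S_denom_def)
      then have "e' > 0" using d0 e' by (simp add: zero_less_mult_iff)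
      define e where "e = nat e'"
      have e: "e > 0" "d = int e * dn x" using \<open>e' > 0\<close> e' by (simp_all add: e_def)
      have "int e \<le> d" using e dx by (simp add: mult_le_cancel_left1)
      then have ed: "real e \<le> real_of_int d" by linarith
      have "Y \<subseteq> A x"
      proof
        fix u assume u: "u \<in> Y"
        have pw: "w (1 / of_int (dn x)) = w (1 / of_int d) ^ e" "norm (w (1 / of_int d)) = 1" if "w \<in> Y" for w
          using dual_R_power_denom[of w S e "dn x"] dual_R_norm[OF _ R_ring_inverse_denom[OF d], of w] that Y d e by auto
        have "norm (u (1 / of_int (dn x)) - v (1 / of_int (dn x))) \<le> real e * norm (u (1 / of_int d) - v (1 / of_int d))"
          unfolding pw(1)[OF u] pw(1)[OF v] using pw(2)[OF u] pw(2)[OF v] by (intro norm_power_diff) auto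
        also have "\<dots> \<le> real_of_int d * \<eta>"
          using small[OF u v] ed \<eta> by (intro mult_mono) auto
        also have "\<dots> \<le> \<epsilon> x / 2"
          using Min_le[of "\<epsilon> ` F" "\<epsilon> x"] F x d0 by (simp add: \<eta>_def)
        finally have "norm (u (1 / of_int (dn x)) - v (1 / of_int (dn x))) \<le> \<epsilon> x / 2" .
        moreover have "norm (v (1 / of_int (dn x)) - x (1 / of_int (dn x))) < \<epsilon> x / 2"
          using x(2) by (simp add: B_def dist_norm norm_minus_commute)
        ultimately have "norm (u (1 / of_int (dn x)) - x (1 / of_int (dn x))) < \<epsilon> x"
          using norm_triangle_ineq[of "u (1 / of_int (dn x)) - v (1 / of_int (dn x))" "v (1 / of_int (dn x)) - x (1 / of_int (dn x))"] by simp
        then show "u \<in> A x" using loc(4)[OF xX] u Y by blast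
      qed
      then show ?thesis using loc(1)[OF xX] by blast
    qed
  qed
qed

lemma norm_cis_diff_le: "norm (cis s - cis t) \<le> \<bar>s - t\<bar>"
proof -
  have "cis s - cis t = cis t * (cis (s - t) - 1)" by (simp add: right_diff_distrib cis_mult)
  then have "norm (cis s - cis t) = norm (cis (s - t) - 1)" by (simp add: norm_mult)
  also have "\<dots> = 2 * \<bar>sin ((s - t) / 2)\<bar>" using dist_exp_i_1[of "s - t"] by (simp add: cis_conv_exp)
  also have "\<dots> \<le> \<bar>s - t\<bar>" using abs_sin_x_le_abs_x[of "(s - t) / 2"] by simp
  finally show ?thesis .
qed

lemma exists_cis:
  fixes z :: complex
  assumes "norm z = 1"
  obtains t where "0 \<le> t" "t < 1" "z = cis (2 * pi * t)"
proof -
  have "z = cis (Arg2pi z)" using assms Arg2pi_eq[of z] by (simp add: cis_conv_exp)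
  moreover have "0 \<le> Arg2pi z" "Arg2pi z < 2 * pi" using Arg2pi by auto
  ultimately show thesis using that[of "Arg2pi z / (2 * pi)"] by simp
qed

text \<open>The k-th iterate raises the coordinate u r, with r = 1 / d, to the power 2^k. If the
  circle is cut into M * 2^n arcs, the images of an arc stay below the Lebesgue number for all k <
  n, so each arc lies in a single member of the join.\<close>

lemma iterated_join_small_subcover:
  assumes U: "open_cover (R_space S) U"
  obtains M where "M > 0" "\<And>n. \<exists>V. V \<subseteq> iterated_join (R_space S) (T_map S) U n \<and> finite V \<and>
    \<Union>V = dual_R S \<and> card V \<le> M * 2 ^ n"
proof -
  obtain d \<eta> where d: "S_denom S d" and \<eta>: "\<eta> > 0"
    and small: "\<And>Y. Y \<subseteq> dual_R S \<Longrightarrow> (\<And>u v. u \<in> Y \<Longrightarrow> v \<in> Y \<Longrightarrow> norm (u (1 / of_int d) - v (1 / of_int d)) < \<eta>) \<Longrightarrow> \<exists>A\<in>U. Y \<subseteq> A"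
    using open_cover_Lebesgue_number[OF U] by metis
  define r where "r = (1 / of_int d :: rat)"
  have r: "r \<in> R_ring S" unfolding r_def by (rule R_ring_inverse_denom[OF d])
  \<comment> \<open>An arc of length 2 \<pi> / (M * 2^n), stretched by at most 2^n, has length at
    most 2 \<pi> / M < \<eta>.\<close>
  obtain M :: nat where M: "2 * pi / \<eta> < real M" using reals_Archimedean2 by blast
  have "0 < 2 * pi / \<eta>" using \<eta> by simp
  then have M0: "M > 0" using M by (intro Nat.gr0I) auto
  have ex: "\<exists>V. V \<subseteq> iterated_join (R_space S) (T_map S) U n \<and> finite V \<and> \<Union>V = dual_R S \<and> card V \<le> M * 2 ^ n" for n
  proof -
    define K where "K = M * 2 ^ n"
    have K: "K > 0" using M0 by (simp add: K_def)
    define Y where "Y = (\<lambda>j. {u \<in> dual_R S. \<exists>t. real j \<le> real K * t \<and> real K * t < real j + 1 \<and> u r = cis (2 * pi * t)})"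
    have cover: "\<exists>j<K. u \<in> Y j" if u: "u \<in> dual_R S" for u
    proof -
      obtain t where t: "0 \<le> t" "t < 1" "u r = cis (2 * pi * t)" using exists_cis[OF dual_R_norm[OF u r]] by metis
      define j where "j = nat \<lfloor>real K * t\<rfloor>"
      have j: "real j \<le> real K * t" "real K * t < real j + 1" using t by (simp_all add: j_def)
      have "real K * t < real K * 1" using t K by (intro mult_strict_left_mono) auto
      then have "j < K" using j by linarith
      then show ?thesis using t j u unfolding Y_def by blast
    qed
    have small_image: "\<exists>A\<in>U. (T_map S ^^ k) ` Y j \<subseteq> A" if k: "k < n" for j k
    proof (rule small)
      show "(T_map S ^^ k) ` Y j \<subseteq> dual_R S" using T_map_funpow_in by (auto simp: Y_def)
      fix u' v' assume "u' \<in> (T_map S ^^ k) ` Y j" "v' \<in> (T_map S ^^ k) ` Y j"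
      then obtain u v where uv: "u \<in> Y j" "u' = (T_map S ^^ k) u" "v \<in> Y j" "v' = (T_map S ^^ k) v" by blast
      have val: "(T_map S ^^ k) w r = w r ^ 2 ^ k" "norm (w r) = 1" if "w \<in> Y j" for w
        using that dual_R_of_nat[of w S r "2 ^ k"] dual_R_norm[of w S r] r T_map_funpow[of w S k] by (auto simp: Y_def)
      obtain s t where st: "real j \<le> real K * s" "real K * s < real j + 1" "u r = cis (2 * pi * s)"
        "real j \<le> real K * t" "real K * t < real j + 1" "v r = cis (2 * pi * t)" using uv by (auto simp: Y_def)
      have "real K * \<bar>s - t\<bar> = \<bar>real K * s - real K * t\<bar>" by (simp add: abs_mult flip: right_diff_distrib)
      also have "\<dots> < 1" using st by linarith
      finally have "real K * \<bar>s - t\<bar> < 1" .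
      then have st_le: "\<bar>s - t\<bar> \<le> 1 / real K" using K by (simp add: field_simps)
      have "norm (u' r - v' r) \<le> real (2 ^ k) * norm (u r - v r)"
        unfolding uv val(1)[OF uv(1)] val(1)[OF uv(3)] using val(2)[OF uv(1)] val(2)[OF uv(3)]
        by (intro norm_power_diff) auto
      also have "\<dots> \<le> 2 ^ n * (2 * pi * (1 / real K))"
      proof (rule mult_mono)
        show "real (2 ^ k) \<le> 2 ^ n" using k by (simp add: power_increasing)
        have "norm (u r - v r) \<le> 2 * pi * \<bar>s - t\<bar>"
          using norm_cis_diff_le[of "2 * pi * s" "2 * pi * t"] st by (simp add: abs_mult flip: right_diff_distrib)
        also have "\<dots> \<le> 2 * pi * (1 / real K)" using st_le by (intro mult_left_mono) auto
        finally show "norm (u r - v r) \<le> 2 * pi * (1 / real K)" .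
      qed auto
      also have "\<dots> = 2 * pi / real M" using M0 by (simp add: K_def)
      also have "\<dots> < \<eta>" using M M0 \<eta> by (simp add: field_simps)
      finally show "norm (u' (1 / of_int d) - v' (1 / of_int d)) < \<eta>" by (simp add: r_def)
    qed
    define A where "A = (\<lambda>j k. SOME A. A \<in> U \<and> (T_map S ^^ k) ` Y j \<subseteq> A)"
    have A: "A j k \<in> U" "(T_map S ^^ k) ` Y j \<subseteq> A j k" if "k < n" for j k
      unfolding A_def using someI_ex[OF small_image[OF that, of j, unfolded Bex_def]] by blast+
    define W where "W = (\<lambda>j. {x \<in> topspace (R_space S). \<forall>k<n. (T_map S ^^ k) x \<in> A j k})"
    have "W j \<in> iterated_join (R_space S) (T_map S) U n" for j
      unfolding W_def iterated_join_def using A(1) by blast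
    then have "W ` {..<K} \<subseteq> iterated_join (R_space S) (T_map S) U n" by blast
    moreover have "\<Union>(W ` {..<K}) = dual_R S"
    proof
      show "\<Union>(W ` {..<K}) \<subseteq> dual_R S" by (auto simp: W_def)
      show "dual_R S \<subseteq> \<Union>(W ` {..<K})"
      proof
        fix u assume u: "u \<in> dual_R S"
        then obtain j where j: "j < K" "u \<in> Y j" using cover by blast
        then have "u \<in> W j" using A(2) u unfolding W_def by fastforce
        then show "u \<in> \<Union>(W ` {..<K})" using j by blast
      qed
    qed
    moreover have "card (W ` {..<K}) \<le> K" using card_image_le[of "{..<K}" W] by simp
    ultimately show ?thesis unfolding K_def by (intro exI[of _ "W ` {..<M * 2 ^ n}"]) auto
  qed
  show thesis by (rule that[OF M0 ex])
qed

lemma cover_entropy_le: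
  assumes U: "open_cover (R_space S) U"
  shows "cover_entropy (R_space S) (T_map S) U \<le> ereal (ln 2)"
proof -
  obtain M where M: "M > 0" "\<And>n. \<exists>V. V \<subseteq> iterated_join (R_space S) (T_map S) U n \<and> finite V \<and>
    \<Union>V = dual_R S \<and> card V \<le> M * 2 ^ n" using iterated_join_small_subcover[OF U] by blast
  define c where "c = (\<lambda>n. cover_number (R_space S) (iterated_join (R_space S) (T_map S) U n))"
  have c_eq: "cover_number (R_space S) (iterated_join (R_space S) (T_map S) U n) = c n" for n by (simp add: c_def)
  have c: "c n \<le> M * 2 ^ n" for n
  proof -
    obtain V where V: "V \<subseteq> iterated_join (R_space S) (T_map S) U n" "finite V" "\<Union>V = dual_R S" "card V \<le> M * 2 ^ n"
      using M(2)[of n] by (elim exE conjE)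
    have "c n \<le> card V" unfolding c_def cover_number_def using V by (intro cInf_lower) auto
    with V show ?thesis by simp
  qed
  have le: "ln (real (c n)) / real n \<le> ln (real M) / real n + ln 2" if n: "n > 0" for n
  proof -
    have "ln (real (c n)) \<le> ln (real (M * 2 ^ n))"
    proof (cases "c n = 0")
      \<comment> \<open>Here \<open>ln 0\<close> is 0, so only the sign of the right side
        matters.\<close>
      case True
      have "1 \<le> M * 2 ^ n" using M(1) by simp
      then have "real 1 \<le> real (M * 2 ^ n)" by (simp only: of_nat_le_iff)
      then have "ln (real (M * 2 ^ n)) \<ge> 0" by (intro ln_ge_zero) simp
      then show ?thesis using True by simp
    next
      case False
      have "real (c n) \<le> real (M * 2 ^ n)" using c[of n] by (simp only: of_nat_le_iff)
      then show ?thesis using False by (intro ln_mono) auto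
    qed
    also have "\<dots> = ln (real M) + real n * ln 2" using M(1) by (simp add: ln_mult ln_realpow)
    finally have "ln (real (c n)) / real n \<le> (ln (real M) + real n * ln 2) / real n" by (intro divide_right_mono) auto
    then show ?thesis using n by (simp add: add_divide_distrib)
  qed
  have "cover_entropy (R_space S) (T_map S) U \<le> limsup (\<lambda>n. ereal (ln (real M) / real n + ln 2))"
    unfolding cover_entropy_def c_eq
    using le by (intro Limsup_mono eventually_mono[OF eventually_gt_at_top[of 0]]) auto
  also have "\<dots> = ereal (ln 2)"
  proof (rule lim_imp_Limsup)
    have "(\<lambda>n. ln (real M) / real n + ln 2) \<longlonglongrightarrow> 0 + ln 2"
      by (intro tendsto_intros lim_const_over_n)
    then show "(\<lambda>n. ereal (ln (real M) / real n + ln 2)) \<longlonglongrightarrow> ereal (ln 2)" by simp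
  qed simp
  finally show ?thesis .
qed

section \<open>Lower bound for the entropy\<close>

text \<open>Write j - i = 2^a * c with c odd. After k = n - 1 - a doublings the two angles differ by
  \<pi> c, so the points are antipodal.\<close>

lemma cis_dyadic_separated:
  fixes i j n :: nat
  assumes ij: "i < j" "j < 2 ^ n"
  shows "\<exists>k<n. norm (cis (2 * pi * real i / 2 ^ n * 2 ^ k) - cis (2 * pi * real j / 2 ^ n * 2 ^ k)) = 2"
proof -
  define m where "m = j - i"
  have m: "m > 0" "m < 2 ^ n" using ij by (auto simp: m_def)
  define a where "a = multiplicity 2 m"
  obtain c where c: "m = 2 ^ a * c" "odd c"
    using multiplicity_decompose'[of m 2] m unfolding a_def by auto
  have "c > 0" using c m by (intro Nat.gr0I) auto
  then have "2 ^ a \<le> m" using c by simp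
  from this m(2) have "(2::nat) ^ a < 2 ^ n" by (rule le_less_trans)
  then have a: "a < n" by simp
  define k where "k = n - 1 - a"
  have k: "k < n" "n = k + a + 1" using a by (auto simp: k_def)
  obtain e where e: "c = 2 * e + 1" using c by (elim oddE)
  have jm: "real j = real i + 2 ^ a * real c" using ij c(1) unfolding m_def by (metis add_diff_inverse_nat less_imp_le_nat not_less of_nat_add of_nat_mult of_nat_numeral of_nat_power)
  have "2 * pi * real j / 2 ^ n * 2 ^ k = 2 * pi * real i / 2 ^ n * 2 ^ k + (2 * pi * (2 ^ a * real c)) / 2 ^ n * 2 ^ k"
    unfolding jm by (simp add: algebra_simps add_divide_distrib)
  also have "(2 * pi * (2 ^ a * real c)) / 2 ^ n * 2 ^ k = pi * real c"
    unfolding k(2) by (simp add: power_add)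
  finally have "cis (2 * pi * real j / 2 ^ n * 2 ^ k) = cis (2 * pi * real i / 2 ^ n * 2 ^ k) * cis (pi * real c)"
    by (simp add: cis_mult)
  also have "cis (pi * real c) = -1"
    unfolding e by (simp add: complex_eq_iff distrib_left cos_add sin_add mult.commute[of pi])
  finally have "norm (cis (2 * pi * real i / 2 ^ n * 2 ^ k) - cis (2 * pi * real j / 2 ^ n * 2 ^ k)) = norm (2 * cis (2 * pi * real i / 2 ^ n * 2 ^ k))"
    by simp
  then show ?thesis using k(1) by (intro exI[of _ k]) (simp add: norm_mult)
qed

text \<open>Cover the dual by the sets where the coordinate at 1 lies in an open disc of radius 1;
  no such set contains two points with antipodal coordinates. By
  \<open>cis_dyadic_separated\<close>, 2^n suitable characters lie in pairwise different members of
  every subcover of the n-th join.\<close>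

lemma exists_cover_entropy_ge:
  "\<exists>U. open_cover (R_space S) U \<and> ereal (ln 2) \<le> cover_entropy (R_space S) (T_map S) U"
proof -
  define U where "U = (\<lambda>z. {u \<in> topspace (R_space S). u 1 \<in> ball z 1}) ` sphere (0::complex) 1"
  have U: "open_cover (R_space S) U"
    unfolding open_cover_def
  proof
    show "\<forall>u\<in>U. openin (R_space S) u"
    proof
      fix u assume "u \<in> U"
      then obtain z where u: "u = {u \<in> topspace (R_space S). u 1 \<in> ball z 1}" unfolding U_def by blast
      show "openin (R_space S) u"
        unfolding u by (rule openin_continuous_map_preimage[OF continuous_map_eval[OF R_ring_1]]) simp
    qed
    have "u \<in> \<Union>U" if "u \<in> dual_R S" for u
      using that dual_R_norm[of u S 1] by (auto simp: U_def intro!: bexI[of _ "u 1"])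
    then show "\<Union>U = topspace (R_space S)" by (auto simp: U_def)
  qed
  obtain M where "M > 0" and M: "\<And>n. \<exists>V. V \<subseteq> iterated_join (R_space S) (T_map S) U n \<and> finite V \<and>
    \<Union>V = dual_R S \<and> card V \<le> M * 2 ^ n" using iterated_join_small_subcover[OF U] by blast
  define c where "c = (\<lambda>n. cover_number (R_space S) (iterated_join (R_space S) (T_map S) U n))"
  have c_eq: "cover_number (R_space S) (iterated_join (R_space S) (T_map S) U n) = c n" for n by (simp add: c_def)
  have c: "2 ^ n \<le> c n" for n
  proof -
    define w where "w = (\<lambda>j. \<lambda>r\<in>R_ring S. cis (2 * pi * real j / 2 ^ n * of_rat r))"
    have w: "w j \<in> dual_R S" for j unfolding w_def by (rule cis_char_in_dual_R)
    \<comment> \<open>The subcover from M shows that the set of cardinalities is nonempty, so its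
      infimum is attained.\<close>
    have "c n \<in> {card V |V. V \<subseteq> iterated_join (R_space S) (T_map S) U n \<and> finite V \<and> \<Union>V = topspace (R_space S)}"
      unfolding c_def cover_number_def using M[of n] by (intro Inf_nat_def1) auto
    then obtain V where V: "V \<subseteq> iterated_join (R_space S) (T_map S) U n" "finite V" "\<Union>V = dual_R S" "c n = card V"
      by auto
    have "\<exists>v\<in>V. w j \<in> v" for j using w[of j] V(3) by blast
    then obtain g where g: "\<And>j. g j \<in> V" "\<And>j. w j \<in> g j" by metis
    have False if ij: "i < j" "j < 2 ^ n" "g i = g j" for i j
    proof -
      obtain k where k: "k < n" "norm (cis (2 * pi * real i / 2 ^ n * 2 ^ k) - cis (2 * pi * real j / 2 ^ n * 2 ^ k)) = 2"
        using cis_dyadic_separated[OF ij(1,2)] by blast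
      obtain u where u: "g i = {x \<in> topspace (R_space S). \<forall>k<n. (T_map S ^^ k) x \<in> u k}" "\<forall>k<n. u k \<in> U"
        using g(1)[of i] V(1) by (force simp: iterated_join_def)
      obtain z where z: "u k = {u \<in> topspace (R_space S). u 1 \<in> ball z 1}" using u(2) k(1) by (force simp: U_def)
      have val: "(T_map S ^^ k) (w l) 1 = cis (2 * pi * real l / 2 ^ n * 2 ^ k)" for l
        unfolding T_map_funpow[OF w] using R_ring_power_2_mult[of 1 S k] by (simp add: w_def of_rat_power)
      have "(T_map S ^^ k) (w i) \<in> u k" "(T_map S ^^ k) (w j) \<in> u k"
        using g(2)[of i] g(2)[of j] ij(3) u(1) k(1) by auto
      then have "norm (z - cis (2 * pi * real i / 2 ^ n * 2 ^ k)) < 1" "norm (z - cis (2 * pi * real j / 2 ^ n * 2 ^ k)) < 1"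
        unfolding z by (simp_all add: dist_norm val)
      then have "norm ((z - cis (2 * pi * real j / 2 ^ n * 2 ^ k)) - (z - cis (2 * pi * real i / 2 ^ n * 2 ^ k))) < 2"
        using norm_triangle_ineq4[of "z - cis (2 * pi * real j / 2 ^ n * 2 ^ k)" "z - cis (2 * pi * real i / 2 ^ n * 2 ^ k)"] by linarith
      with k(2) show False by simp
    qed
    then have "inj_on g {..<2 ^ n}" by (intro inj_onI) (metis lessThan_iff linorder_neqE_nat)
    then have "card {..<2 ^ n :: nat} \<le> card V" using g(1) V(2) by (intro card_inj_on_le) auto
    then show ?thesis using V(4) by simp
  qed
  have "ereal (ln 2) \<le> cover_entropy (R_space S) (T_map S) U"
    unfolding cover_entropy_def c_eq
  proof (rule le_Limsup)
    show "\<forall>\<^sub>F n in sequentially. ereal (ln 2) \<le> ereal (ln (real (c n)) / real n)"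
      using eventually_gt_at_top[of 0]
    proof eventually_elim
      case (elim n)
      have "real (2 ^ n) \<le> real (c n)" using c[of n] by (simp only: of_nat_le_iff)
      then have "ln (real (2 ^ n)) \<le> ln (real (c n))" by (intro ln_mono) auto
      then have "real n * ln 2 \<le> ln (real (c n))" by (simp add: ln_realpow)
      then show ?case using elim by (simp add: field_simps)
    qed
  qed simp
  with U show ?thesis by blast
qed

theorem entropy_T_eq: "entropy_T S = ln 2"
proof -
  have "topological_entropy (R_space S) (T_map S) = ereal (ln 2)"
    unfolding topological_entropy_def
  proof (rule antisym)
    show "(SUP U\<in>{U. open_cover (R_space S) U}. cover_entropy (R_space S) (T_map S) U) \<le> ereal (ln 2)"
      by (rule SUP_least) (simp add: cover_entropy_le)
    show "ereal (ln 2) \<le> (SUP U\<in>{U. open_cover (R_space S) U}. cover_entropy (R_space S) (T_map S) U)"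
      using exists_cover_entropy_ge[of S] by (meson SUP_upper2 mem_Collect_eq)
  qed
  then show ?thesis by (simp add: entropy_T_def)
qed

section \<open>Closed orbits\<close>

definition least_period_points :: "'a set \<Rightarrow> ('a \<Rightarrow> 'a) \<Rightarrow> nat \<Rightarrow> 'a set" where
  "least_period_points A f n = {x \<in> A. (f ^^ n) x = x \<and> (\<forall>k. 0 < k \<longrightarrow> k < n \<longrightarrow> (f ^^ k) x \<noteq> x)}"

text \<open>If the points at times i < j coincide, applying n - j further steps shows that x returns
  at time n - j + i, which is less than n.\<close>

lemma funpow_inj_least_period:
  assumes "x \<in> least_period_points A f n"
  shows "inj_on (\<lambda>k. (f ^^ k) x) {..<n}"
proof -
  have False if ij: "i < j" "j < n" "(f ^^ i) x = (f ^^ j) x" for i j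
  proof -
    have "(f ^^ (n - j + i)) x = (f ^^ (n - j)) ((f ^^ j) x)" by (simp add: funpow_add ij(3))
    also have "\<dots> = (f ^^ (n - j + j)) x" by (simp only: funpow_add o_apply)
    also have "\<dots> = x" using ij assms by (simp add: least_period_points_def)
    finally show False using assms ij by (auto simp: least_period_points_def)
  qed
  then show ?thesis by (intro inj_onI) (metis lessThan_iff linorder_neqE_nat)
qed

lemma orbit_image_eq_range:
  assumes "(f ^^ n) x = x" "n > 0"
  shows "(\<lambda>k. (f ^^ k) x) ` {..<n} = range (\<lambda>k. (f ^^ k) x)"
proof
  show "range (\<lambda>k. (f ^^ k) x) \<subseteq> (\<lambda>k. (f ^^ k) x) ` {..<n}"
  proof safe
    fix k
    have "(f ^^ k) x = (f ^^ (k mod n)) x" using funpow_mod_eq[OF assms(1), of k] by simp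
    then show "(f ^^ k) x \<in> (\<lambda>k. (f ^^ k) x) ` {..<n}" using assms(2) by (intro image_eqI[of _ _ "k mod n"]) auto
  qed
qed auto

text \<open>The list of times 0, ..., n has n + 1 entries and its last point repeats the first, so
  cardinality n forces the points at times below n to be distinct, that is, least period n.\<close>

lemma closed_orbit_iff:
  "closed_orbit A f n \<tau> \<longleftrightarrow> n > 0 \<and> (\<exists>x\<in>least_period_points A f n. \<tau> = range (\<lambda>k. (f ^^ k) x))"
proof
  assume "closed_orbit A f n \<tau>"
  then obtain x where x: "x \<in> A" "(f ^^ n) x = x" "\<tau> = (\<lambda>k. (f ^^ k) x) ` {0..n}" "card \<tau> = n"
    by (auto simp: closed_orbit_def)
  have n: "n > 0" using x by (intro Nat.gr0I) auto
  have "{0..n} = insert n {..<n}" by auto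
  moreover have "x \<in> (\<lambda>k. (f ^^ k) x) ` {..<n}" using n by (intro image_eqI[of _ _ 0]) auto
  ultimately have \<tau>: "\<tau> = (\<lambda>k. (f ^^ k) x) ` {..<n}" using x by auto
  then have inj: "inj_on (\<lambda>k. (f ^^ k) x) {..<n}" using x(4) by (intro eq_card_imp_inj_on) auto
  have "(f ^^ k) x \<noteq> x" if "0 < k" "k < n" for k
    using inj_onD[OF inj, of k 0] that by auto
  then have "x \<in> least_period_points A f n" using x by (simp add: least_period_points_def)
  moreover have "\<tau> = range (\<lambda>k. (f ^^ k) x)" unfolding \<tau> by (rule orbit_image_eq_range[OF x(2) n])
  ultimately show "n > 0 \<and> (\<exists>x\<in>least_period_points A f n. \<tau> = range (\<lambda>k. (f ^^ k) x))"
    using n by blast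
next
  assume "n > 0 \<and> (\<exists>x\<in>least_period_points A f n. \<tau> = range (\<lambda>k. (f ^^ k) x))"
  then obtain x where x: "n > 0" "x \<in> least_period_points A f n" "\<tau> = range (\<lambda>k. (f ^^ k) x)" by blast
  have fx: "x \<in> A" "(f ^^ n) x = x" using x(2) by (auto simp: least_period_points_def)
  have \<tau>: "\<tau> = (\<lambda>k. (f ^^ k) x) ` {..<n}" using orbit_image_eq_range[OF fx(2) x(1)] x(3) by simp
  have "{0..n} = insert n {..<n}" by auto
  then have "(\<lambda>k. (f ^^ k) x) ` {0..n} = insert ((f ^^ n) x) (range (\<lambda>k. (f ^^ k) x))"
    using orbit_image_eq_range[OF fx(2) x(1)] by simp
  then have "\<tau> = (\<lambda>k. (f ^^ k) x) ` {0..n}" unfolding x(3) by (simp add: insert_absorb)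
  moreover have "card \<tau> = n" unfolding \<tau> using card_image[OF funpow_inj_least_period[OF x(2)]] by simp
  ultimately show "closed_orbit A f n \<tau>" using fx unfolding closed_orbit_def by blast
qed

lemma closed_orbit_card: "closed_orbit A f n \<tau> \<Longrightarrow> card \<tau> = n"
  by (auto simp: closed_orbit_def)

text \<open>The orbits partition the points of least period n into classes of size n.\<close>

lemma card_closed_orbits:
  assumes inv: "\<And>x. x \<in> A \<Longrightarrow> f x \<in> A" and fin: "finite (least_period_points A f n)" and n: "n > 0"
  shows "finite {\<tau>. closed_orbit A f n \<tau>}"
    "n * card {\<tau>. closed_orbit A f n \<tau>} = card (least_period_points A f n)"
proof -
  define orb where "orb = (\<lambda>x. range (\<lambda>k. (f ^^ k) x))"
  define orbs where "orbs = orb ` least_period_points A f n"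
  have orbs: "{\<tau>. closed_orbit A f n \<tau>} = orbs" using n by (auto simp: closed_orbit_iff orbs_def orb_def)
  have pow_in: "(f ^^ k) x \<in> A" if "x \<in> A" for k x using that inv by (induction k) auto
  have sub: "(f ^^ j) x \<in> least_period_points A f n" if x: "x \<in> least_period_points A f n" for j x
  proof -
    have fx: "x \<in> A" "(f ^^ n) x = x" using x by (auto simp: least_period_points_def)
    have comm: "(f ^^ a) ((f ^^ b) x) = (f ^^ b) ((f ^^ a) x)" for a b
      by (metis add.commute comp_apply funpow_add)
    \<comment> \<open>Running n * j - j further steps completes a multiple of n; on periodic points
      this inverts the j-th iterate.\<close>
    have ret: "(f ^^ (n * j - j)) ((f ^^ j) x) = x"
    proof -
      have "n * j \<ge> j" using n by simp
      then have "(f ^^ (n * j - j)) ((f ^^ j) x) = (f ^^ (n * j)) x" by (metis comp_apply funpow_add le_add_diff_inverse2)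
      also have "\<dots> = x" using funpow_mod_eq[OF fx(2), of "n * j"] by simp
      finally show ?thesis .
    qed
    have "(f ^^ k) ((f ^^ j) x) \<noteq> (f ^^ j) x" if k: "0 < k" "k < n" for k
    proof
      assume *: "(f ^^ k) ((f ^^ j) x) = (f ^^ j) x"
      have "(f ^^ k) x = (f ^^ k) ((f ^^ (n * j - j)) ((f ^^ j) x))" by (simp only: ret)
      also have "\<dots> = (f ^^ (n * j - j)) ((f ^^ k) ((f ^^ j) x))" by (metis add.commute comp_apply funpow_add)
      also have "\<dots> = x" by (simp only: * ret)
      finally show False using x k by (auto simp: least_period_points_def)
    qed
    then show ?thesis using pow_in[OF fx(1)] comm[of n j] fx(2) by (simp add: least_period_points_def)
  qed
  have orb_eq: "orb y = orb x" if x: "x \<in> least_period_points A f n" and y: "y \<in> orb x" for x y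
  proof -
    obtain j where j: "y = (f ^^ j) x" using y by (auto simp: orb_def)
    have fx: "(f ^^ n) x = x" using x by (auto simp: least_period_points_def)
    have "(f ^^ k) y = (f ^^ (k + j)) x" for k by (simp add: j funpow_add)
    then have "orb y \<subseteq> orb x" by (auto simp: orb_def)
    moreover have "(f ^^ k) x = (f ^^ (k + (n * j - j))) y" for k
    proof -
      have "n * j \<ge> j" using n by simp
      then have "(f ^^ (n * j - j)) y = (f ^^ (n * j)) x" unfolding j by (metis comp_apply funpow_add le_add_diff_inverse2)
      also have "\<dots> = x" using funpow_mod_eq[OF fx, of "n * j"] by simp
      finally show ?thesis by (simp add: funpow_add)
    qed
    then have "orb x \<subseteq> orb y" by (auto simp: orb_def)
    ultimately show ?thesis by blast
  qed
  have "x \<in> orb x" for x unfolding orb_def by (intro image_eqI[of _ _ 0]) auto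
  then have un: "\<Union>orbs = least_period_points A f n" using sub by (auto simp: orbs_def orb_def)
  have finO: "finite orbs" using fin by (simp add: orbs_def)
  have "n * card orbs = card (\<Union>orbs)"
  proof (rule card_partition[OF finO])
    show "finite (\<Union>orbs)" using fin un by simp
    show "card c = n" if "c \<in> orbs" for c using that orbs closed_orbit_card by blast
    fix c d assume cd: "c \<in> orbs" "d \<in> orbs" "c \<noteq> d"
    show "c \<inter> d = {}"
    proof (rule ccontr)
      assume "c \<inter> d \<noteq> {}"
      then obtain y where "y \<in> c" "y \<in> d" by blast
      then have "orb y = c" "orb y = d" using cd orb_eq by (auto simp: orbs_def)
      then show False using cd by simp
    qed
  qed
  then show "finite {\<tau>. closed_orbit A f n \<tau>}"
    "n * card {\<tau>. closed_orbit A f n \<tau>} = card (least_period_points A f n)"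
    using finO un orbs by simp_all
qed

text \<open>If \<open>x\<close> is fixed by \<open>f ^^ n\<close> and by \<open>f ^^ k\<close>, it is also fixed by \<open>f ^^ (n - k)\<close>; so a point of
  period \<open>n\<close> that does not have least period \<open>n\<close> has a period \<open>k \<le> n div 2\<close>.\<close>

lemma card_least_period_points_ge:
  assumes fin: "\<And>k. k > 0 \<Longrightarrow> finite {x \<in> A. (f ^^ k) x = x}"
    and le: "\<And>k. k > 0 \<Longrightarrow> card {x \<in> A. (f ^^ k) x = x} \<le> 2 ^ k" and n: "n > 0"
  shows "card {x \<in> A. (f ^^ n) x = x} \<le> card (least_period_points A f n) + 2 * 2 ^ (n div 2)"
proof -
  define Fx where "Fx = (\<lambda>k. {x \<in> A. (f ^^ k) x = x})"
  have "Fx n \<subseteq> least_period_points A f n \<union> (\<Union>k\<in>{1..n div 2}. Fx k)"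
  proof
    fix x assume x: "x \<in> Fx n"
    show "x \<in> least_period_points A f n \<union> (\<Union>k\<in>{1..n div 2}. Fx k)"
    proof (cases "x \<in> least_period_points A f n")
      case False
      then obtain k where k: "0 < k" "k < n" "(f ^^ k) x = x"
        using x by (auto simp: Fx_def least_period_points_def)
      have "(f ^^ (n - k)) x = (f ^^ (n - k)) ((f ^^ k) x)" by (simp only: k(3))
      also have "\<dots> = (f ^^ (n - k + k)) x" by (simp only: funpow_add o_apply)
      also have "\<dots> = x" using k x by (simp add: Fx_def)
      finally have k': "(f ^^ (n - k)) x = x" .
      have "k \<le> n div 2 \<or> n - k \<le> n div 2" by linarith
      then have "k \<in> {1..n div 2} \<and> x \<in> Fx k \<or> n - k \<in> {1..n div 2} \<and> x \<in> Fx (n - k)"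
        using k k' x by (auto simp: Fx_def)
      then show ?thesis by blast
    qed simp
  qed
  moreover have finF: "finite (Fx k)" if "k > 0" for k using fin[OF that] by (simp add: Fx_def)
  moreover have "least_period_points A f n \<subseteq> Fx n" by (auto simp: least_period_points_def Fx_def)
  then have finL: "finite (least_period_points A f n)" using finF[OF n] finite_subset by blast
  ultimately have "card (Fx n) \<le> card (least_period_points A f n \<union> (\<Union>k\<in>{1..n div 2}. Fx k))"
    by (intro card_mono) auto
  also have "\<dots> \<le> card (least_period_points A f n) + card (\<Union>k\<in>{1..n div 2}. Fx k)" by (rule card_Un_le)
  also have "card (\<Union>k\<in>{1..n div 2}. Fx k) \<le> (\<Sum>k\<in>{1..n div 2}. card (Fx k))" by (rule card_UN_le) simp
  also have "\<dots> \<le> (\<Sum>k\<in>{1..n div 2}. 2 ^ k)" using le by (intro sum_mono) (simp add: Fx_def)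
  also have "\<dots> \<le> 2 * 2 ^ (n div 2)"
  proof -
    have "(\<Sum>k\<in>{1..m}. (2::nat) ^ k) \<le> 2 * 2 ^ m" for m by (induction m) auto
    then show ?thesis .
  qed
  finally show ?thesis by (simp add: Fx_def)
qed

section \<open>Orbits of \<open>T\<^sub>S\<close> and the Mertens sum\<close>

lemma card_fixed_points_T_map_le:
  assumes k: "k > 0"
  shows "finite {u \<in> dual_R S. (T_map S ^^ k) u = u}" "card {u \<in> dual_R S. (T_map S ^^ k) u = u} \<le> 2 ^ k"
proof -
  have "(2::nat) ^ k - 1 > 0" using one_less_power[of "2::nat" k] k by simp
  then obtain q b where qb: "S_free_decomp S (2 ^ k - 1) q b" using S_free_decomp_exists by blast
  show "finite {u \<in> dual_R S. (T_map S ^^ k) u = u}" by (rule card_fixed_points_T_map(1)[OF k qb])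
  have eq: "2 ^ k - 1 = q * b" using qb by (simp add: S_free_decomp_def)
  then have "b > 0" using \<open>(2::nat) ^ k - 1 > 0\<close> by (intro Nat.gr0I) auto
  then have "q \<le> q * b" by simp
  then have "q \<le> 2 ^ k" unfolding eq[symmetric] by simp
  then show "card {u \<in> dual_R S. (T_map S ^^ k) u = u} \<le> 2 ^ k" using card_fixed_points_T_map(2)[OF k qb] by simp
qed

lemma finite_least_period_points_T_map:
  assumes "n > 0"
  shows "finite (least_period_points (dual_R S) (T_map S) n)"
  by (rule finite_subset[OF _ card_fixed_points_T_map_le(1)[OF assms]]) (auto simp: least_period_points_def)

text \<open>Each orbit of length n has weight 2^(-n), and n points of least period n make up one
  orbit.\<close>

lemma mertens_sum_eq:
  "mertens_sum S N = (\<Sum>n\<in>{1..N}. real (card (least_period_points (dual_R S) (T_map S) n)) / (real n * 2 ^ n))"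
proof -
  define Or where "Or = (\<lambda>n. {\<tau>. closed_orbit (dual_R S) (T_map S) n \<tau>})"
  have inv: "T_map S u \<in> dual_R S" if "u \<in> dual_R S" for u using T_map_funpow_in[OF that, of 1] by simp
  have Or: "finite (Or n)" "n * card (Or n) = card (least_period_points (dual_R S) (T_map S) n)" if "n > 0" for n
    unfolding Or_def using card_closed_orbits[OF inv finite_least_period_points_T_map[OF that] that] by auto
  have pos: "n > 0" if "\<tau> \<in> Or n" for n \<tau> using that by (simp add: Or_def closed_orbit_iff)
  have "{\<tau>. \<exists>n\<le>N. closed_orbit (dual_R S) (T_map S) n \<tau>} = (\<Union>n\<in>{1..N}. Or n)"
    using pos by (fastforce simp: Or_def Suc_le_eq)
  then have "mertens_sum S N = (\<Sum>\<tau>\<in>(\<Union>n\<in>{1..N}. Or n). exp (- ln 2 * real (card \<tau>)))"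
    by (simp add: mertens_sum_def entropy_T_eq)
  also have "\<dots> = (\<Sum>n\<in>{1..N}. \<Sum>\<tau>\<in>Or n. exp (- ln 2 * real (card \<tau>)))"
    using Or(1) by (intro sum.UNION_disjoint) (auto simp: Or_def dest!: closed_orbit_card)
  also have "\<dots> = (\<Sum>n\<in>{1..N}. real (card (least_period_points (dual_R S) (T_map S) n)) / (real n * 2 ^ n))"
  proof (rule sum.cong[OF refl])
    fix n assume "n \<in> {1..N}"
    then have n: "n > 0" by simp
    have "exp (- ln 2 * real n) = 1 / (2::real) ^ n"
      using exp_of_nat_mult[of n "ln (2::real)"] by (simp add: exp_minus mult.commute inverse_eq_divide)
    then have "(\<Sum>\<tau>\<in>Or n. exp (- ln 2 * real (card \<tau>))) = (\<Sum>\<tau>\<in>Or n. 1 / (2::real) ^ n)"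
      by (intro sum.cong) (auto simp: Or_def dest!: closed_orbit_card)
    also have "\<dots> = real (card (Or n)) / 2 ^ n" by simp
    also have "\<dots> = real (n * card (Or n)) / (real n * 2 ^ n)" using n by simp
    finally show "(\<Sum>\<tau>\<in>Or n. exp (- ln 2 * real (card \<tau>))) =
        real (card (least_period_points (dual_R S) (T_map S) n)) / (real n * 2 ^ n)"
      unfolding Or(2)[OF n] .
  qed
  finally show ?thesis .
qed

text \<open>The rational 3/2 replaces sqrt 2, as 2 \<le> (3/2)^2; hence the ratio (3/2) / 2 =
  3/4.\<close>

lemma power_half_le: "(2::real) ^ (n div 2) / 2 ^ n \<le> (3 / 4) ^ n"
proof -
  have "(2::real) ^ (n div 2) \<le> ((3 / 2)\<^sup>2) ^ (n div 2)" by (intro power_mono) (simp_all add: power2_eq_square)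
  also have "\<dots> = (3 / 2) ^ (2 * (n div 2))" by (simp only: power_mult)
  also have "\<dots> \<le> (3 / 2) ^ n" by (intro power_increasing) auto
  finally have "(2::real) ^ (n div 2) / 2 ^ n \<le> (3 / 2) ^ n / 2 ^ n" by (intro divide_right_mono) auto
  also have "\<dots> = (3 / 4) ^ n" by (simp flip: power_divide)
  finally show ?thesis .
qed

lemma least_period_points_T_map_approx:
  assumes S: "S = {p. prime p \<and> odd p \<and> \<not> squarefree (ord p 2)}" and n: "n > 0"
  shows "\<bar>real (card (least_period_points (dual_R S) (T_map S) n)) / (real n * 2 ^ n) - (if squarefree n then 1 / real n else 0)\<bar>
    \<le> 3 * (3 / 4) ^ n"
proof -
  define P where "P = card (least_period_points (dual_R S) (T_map S) n)"
  have m0: "(2::nat) ^ n - 1 > 0" using one_less_power[of "2::nat" n] n by simp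
  then obtain q b where qb: "S_free_decomp S (2 ^ n - 1) q b" using S_free_decomp_exists by blast
  note card_q = card_fixed_points_T_map[OF n qb]
  have "P \<le> q" unfolding P_def card_q(2)[symmetric]
    by (rule card_mono[OF card_q(1)]) (auto simp: least_period_points_def)
  have "q \<le> P + 2 * 2 ^ (n div 2)"
    using card_least_period_points_ge[of "dual_R S" "T_map S" n] card_fixed_points_T_map_le n
    unfolding card_q(2) P_def by blast
  show ?thesis
  proof (cases "squarefree n")
    case True
    then have q: "q = 2 ^ n - 1" using S_free_part_squarefree[OF S n _ qb] by simp
    then have "real q = 2 ^ n - 1" using m0 by (simp add: of_nat_diff)
    moreover have "real P \<le> real q" using \<open>P \<le> q\<close> by simp
    moreover have "real q \<le> real (P + 2 * 2 ^ (n div 2))" using \<open>q \<le> P + 2 * 2 ^ (n div 2)\<close> by (simp only: of_nat_le_iff)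
    then have "real q \<le> real P + 2 * 2 ^ (n div 2)" by simp
    moreover have "(1::real) \<le> 2 ^ (n div 2)" by simp
    \<comment> \<open>Of the factor 3, two come from points of smaller period and one from the
      summand -1 in 2^n - 1.\<close>
    ultimately have "\<bar>real P - 2 ^ n\<bar> \<le> 3 * 2 ^ (n div 2)" by linarith
    moreover have "real P / (real n * 2 ^ n) - 1 / real n = (real P - 2 ^ n) / (real n * 2 ^ n)"
      using n by (simp add: field_simps)
    ultimately have "\<bar>real P / (real n * 2 ^ n) - 1 / real n\<bar> \<le> 3 * 2 ^ (n div 2) / (real n * 2 ^ n)"
      by (simp add: abs_mult divide_right_mono)
    also have "\<dots> \<le> 3 * 2 ^ (n div 2) / (1 * 2 ^ n)"
      using n by (intro divide_left_mono mult_right_mono) auto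
    also have "\<dots> \<le> 3 * (3 / 4) ^ n" using power_half_le[of n] by simp
    finally show ?thesis using True by (simp add: P_def)
  next
    case False
    then have "q \<le> n * 2 ^ (n div 2)" using S_free_part_not_squarefree[OF S n _ qb] by simp
    then have "P \<le> n * 2 ^ (n div 2)" using \<open>P \<le> q\<close> by simp
    then have "real P \<le> real (n * 2 ^ (n div 2))" by (simp only: of_nat_le_iff)
    then have "real P / (real n * 2 ^ n) \<le> real (n * 2 ^ (n div 2)) / (real n * 2 ^ n)"
      by (intro divide_right_mono) auto
    also have "\<dots> = 2 ^ (n div 2) / 2 ^ n" using n by simp
    also have "\<dots> \<le> 3 * (3 / 4) ^ n" using power_half_le[of n] by (rule order_trans) simp
    finally show ?thesis using False by (simp add: P_def)
  qed
qed

lemma sum_geometric_bound_smallo: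
  fixes e :: "nat \<Rightarrow> real"
  assumes e: "\<And>n. n > 0 \<Longrightarrow> \<bar>e n\<bar> \<le> 3 * (3 / 4) ^ n"
  obtains E where "(\<lambda>N. (\<Sum>n\<in>{1..N}. e n) - E) \<in> o(\<lambda>N. real N powr (- 1 / 2))"
proof
  \<comment> \<open>Nothing is assumed about e at 0, so that term is replaced by 0.\<close>
  define g where "g = (\<lambda>n. if n = 0 then 0 else e n)"
  have g: "norm (g n) \<le> 3 * (3 / 4) ^ n" for n using e[of n] by (simp add: g_def)
  \<comment> \<open>The 12 is 3 / (1 - 3/4).\<close>
  have geom: "(\<lambda>n. 3 * (3 / 4 :: real) ^ (n + k)) sums (12 * (3 / 4) ^ k)" for k
    using sums_mult[OF geometric_sums[of "3 / 4 :: real"], of "3 * (3 / 4) ^ k"] by (simp add: power_add mult_ac)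
  have sg: "summable g" using summable_comparison_test'[of "\<lambda>n. 3 * (3 / 4) ^ n" 0 g] g geom[of 0] by (auto dest: sums_summable)
  have eq: "(\<Sum>n\<in>{1..N}. e n) = (\<Sum>n<Suc N. g n)" for N
    unfolding lessThan_Suc_atMost atMost_atLeast0 by (subst sum.atLeast_Suc_atMost) (auto simp: g_def)
  have bound: "norm ((\<Sum>n\<in>{1..N}. e n) - suminf g) \<le> norm (12 * (3 / 4 :: real) ^ Suc N)" for N
  proof -
    have "suminf g = (\<Sum>n. g (n + Suc N)) + (\<Sum>n<Suc N. g n)" by (rule suminf_split_initial_segment[OF sg])
    then have "norm ((\<Sum>n\<in>{1..N}. e n) - suminf g) = norm (\<Sum>n. g (n + Suc N))" unfolding eq by simp
    also have "\<dots> \<le> (\<Sum>n. 3 * (3 / 4) ^ (n + Suc N))"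
      by (rule norm_suminf_le[OF g sums_summable[OF geom]])
    also have "\<dots> = 12 * (3 / 4) ^ Suc N" by (rule sums_unique[OF geom, symmetric])
    finally show ?thesis by simp
  qed
  have "(\<lambda>N. (\<Sum>n\<in>{1..N}. e n) - suminf g) \<in> O(\<lambda>N. 12 * (3 / 4 :: real) ^ Suc N)"
    by (rule landau_o.big_mono) (intro always_eventually allI bound)
  also have "(\<lambda>N. 12 * (3 / 4 :: real) ^ Suc N) \<in> o(\<lambda>N. real N powr (- 1 / 2))"
    by real_asymp
  finally show "(\<lambda>N. (\<Sum>n\<in>{1..N}. e n) - suminf g) \<in> o(\<lambda>N. real N powr (- 1 / 2))" .
qed

theorem mainTheorem7:
  fixes S :: "nat set"
  assumes "S = {p. prime p \<and> odd p \<and> \<not> squarefree (ord p 2)}"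
  shows "\<exists>C::real. (\<lambda>N. mertens_sum S N - (6 / pi\<^sup>2 * ln (real N) + C))
           \<in> o(\<lambda>N. real N powr (- 1 / 2))"
proof -
  define a where "a = (\<lambda>n. real (card (least_period_points (dual_R S) (T_map S) n)) / (real n * 2 ^ n))"
  define s where "s = (\<lambda>n. if squarefree n then 1 / real n else 0)"
  obtain C where C: "(\<lambda>N. (\<Sum>n\<in>{1..N}. s n) - (6 / pi\<^sup>2 * ln (real N) + C)) \<in> o(\<lambda>N. real N powr (- 1 / 2))"
    unfolding s_def by (rule squarefree_harmonic_sum)
  have "\<bar>a n - s n\<bar> \<le> 3 * (3 / 4) ^ n" if "n > 0" for n
    unfolding a_def s_def by (rule least_period_points_T_map_approx[OF assms that])
  then obtain E where E: "(\<lambda>N. (\<Sum>n\<in>{1..N}. a n - s n) - E) \<in> o(\<lambda>N. real N powr (- 1 / 2))"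
    by (rule sum_geometric_bound_smallo)
  \<comment> \<open>The constant has two sources: C from the harmonic sum over squarefree numbers
    and E, the limit of the accumulated differences from it.\<close>
  have eq: "mertens_sum S N - (6 / pi\<^sup>2 * ln (real N) + (C + E))
      = ((\<Sum>n\<in>{1..N}. s n) - (6 / pi\<^sup>2 * ln (real N) + C)) + ((\<Sum>n\<in>{1..N}. a n - s n) - E)" for N
    unfolding mertens_sum_eq a_def[symmetric] by (simp add: sum_subtractf)
  have "(\<lambda>N. mertens_sum S N - (6 / pi\<^sup>2 * ln (real N) + (C + E))) \<in> o(\<lambda>N. real N powr (- 1 / 2))"
    unfolding eq by (rule sum_in_smallo(1)[OF C E])
  then show ?thesis by blast
qed

end
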